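(* Let $(\mathcal C,X,\tau)$ be a trivalent ribbon category over $\mathbb C$ with $\dim\mathcal C(4)\le5$, and suppose that $\mathcal C$ satisfies the quantum exceptional Jacobi relation (QEJac-$\alpha$) for some $v$ and $\alpha$ with $v^{10}\ne1$ and $v^{12}\neq 1$. Then $\alpha\ne0$, $b+[3]\alpha\neq0$, $v^8\ne 1$, and the following hold: 1. $d=-\dfrac{[5]b}{\alpha}-\{8\}$. 2. $t=\dfrac{b-[5]\alpha}{\{2\}}$. 3. (quantum exceptional square relation) $$S+\frac{\alpha\Psi_6(b+[3]\alpha)}{\Psi_1\Psi_3\Psi_4}\,\sigma+\frac{y_1}{\Psi_3\Psi_4}\,I+\frac{y_2}{\Psi_3\Psi_4}\,H+\frac{\alpha\,y_4}{\Psi_1\Psi_3\Psi_4}\,U+\frac{\alpha\,y_3}{\Psi_1\Psi_3\Psi_4}\,\mathbf 1=0 .$$ 4. (quantum exceptional crossing relation) $$\sigma-\sigma^{-1}+\frac{\Psi_1\Psi_2\Psi_3\Psi_4}{b+[3]\alpha}\,(I-H)-\frac{\Psi_1^2\Psi_2\Psi_3\Psi_4\,\alpha}{b+[3]\alpha}\,(\mathbf 1-U)=0 .$$ Here $$\begin{aligned} y_1&=-b+(-v^{-5}+v^{-3}+2v+v^3+2v^5+v^7)\alpha,\\ y_2&=-b+(-v^{-7}-2v^{-5}-v^{-3}-2v^{-1}-v^3+v^5)\alpha,\\ y_3&=b+(-v^{-9}+v^{-7}-v^{-5}+v^{-3}-v^{-1}+v)\alpha,\\ y_4&=b+(-v^{-1}+v-v^3+v^5-v^7+v^9)\alpha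 . \end{aligned}$$
   Context: For an object $X$ of a ribbon category $\mathcal C$, the $n$-box space is $\mathcal C(n)=\mathrm{Hom}(X^{\otimes n},\mathbf 1_{\mathcal C})$. A trivalent ribbon category $(\mathcal C,X,\tau)$ over a commutative ring $R$ is an $R$-linear ribbon category $\mathcal C$ with a self-dual object $X$ (chosen self-duality $\mathrm{ev}:X\otimes X\to\mathbf 1_{\mathcal C}$, $\mathrm{coev}:\mathbf 1_{\mathcal C}\to X\otimes X$) such that: $\mathcal C(1)=0$; $\mathcal C(0),\mathcal C(2),\mathcal C(3)$ are free $R$-modules of rank 1 generated respectively by the empty diagram $\mathrm{id}_{\mathbf 1_{\mathcal C}}$, the strand $\mathrm{ev}$, and a "trivalent vertex" $\tau\in\mathcal C(3)$; $\mathcal C$ is generated as a ribbon category by $\tau$; and the circle $d=\mathrm{ev}\circ\mathrm{coev}$ and the bigon value $b$ ($m\circ\delta=b\,\mathrm{id}_X$, see below) are non-zero. In such a category $X$ is symmetrically self-dual and $\tau$ is rotationally invariant, so unoriented strand diagrams make sense. Diagrams as morphisms: $m=(\tau\otimes\mathrm{id}_X)(\mathrm{id}_X\otimes\mathrm{id}_X\otimes\mathrm{coev}):X\otimes X\to X$ and $\delta=(m\otimes \mathrm{id}_X)(\mathrm{id}_X\otimes\mathrm{coev}):X\to X\otimes X$. In $\mathrm{End}(X\otimes X)\cong\mathcal C(4)$: $\mathbf 1$ is the identity; $U=\mathrm{coev}\circ\mathrm{ev}$; $I=\delta\circ m$; $H=(\mathrm{id}_X\otimes m)(\delta\otimes\mathrm{id}_X)$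 (two vertical strands joined by a horizontal rung); $S=H\circ H$ (the square, i.e. a 4-gon with four external legs); $\sigma=c_{X,X}^{-1}$ is the negative crossing (over-strand from bottom right to top left), $\sigma^{-1}=c_{X,X}$ the positive crossing, $c$ the braiding. $\mathcal C$ satisfies (QEJac-$\alpha$) for $v\in\mathbb C\setminus\{0\}$ and $\alpha\in\mathbb C$ if $$v^{-3}H\sigma+vI-v^{-1}H+\alpha\,[\sigma+v^4U+v^{-4}\mathbf 1]=0,$$ and also (this is implicitly part of the statement) $$\mathrm{ev}\circ\mathrm{coev}=d,\ \ m\circ\mathrm{coev}=0,\ \ m\circ\delta=b\,\mathrm{id}_X,\ \ H\circ\delta=t\,\delta,\ \ \sigma\circ\delta=-v^6\delta,\ \ \sigma\circ\mathrm{coev}=v^{12}\mathrm{coev};$$ these define $d,b,t$. Notation: $[n]=v^n-v^{-n}$, $\{n\}=v^n+v^{-n}$, $\Psi_1=v-v^{-1}$, $\Psi_2=v+v^{-1}$, $\Psi_3=v^2+1+v^{-2}$, $\Psi_4=v^2+v^{-2}$, $\Psi_6=v^2-1+v^{-2}$. *)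

theory Defs
  imports Complex_Main
begin

section \<open>Linear ribbon categories\<close>

text \<open>
  The objects are all elements of \<open>'o\<close>. All morphism modules \<open>hom A B\<close> are
  submodules of one ambient module on \<open>'m\<close>, so that linear combinations of morphisms are written
  with the addition of \<open>'m\<close>. This costs no generality: for a given linear category take the direct
  sum of its morphism modules as the ambient module. Different morphism modules
  may overlap; composition and tensor product of morphisms are only constrained on composable,
  respectively arbitrary, elements of the morphism modules, and nothing is assumed elsewhere.

  Composition is written in the usual order: \<open>g \<cdot> f\<close> is \<open>g\<close> after \<open>f\<close>. The monoidal structure is
  not assumed to be strict.
\<close>

record ('o, 'm, 'r) ribbon_structure =
  hom :: "'o \<Rightarrow> 'o \<Rightarrow> 'm set"
  ident :: "'o \<Rightarrow> 'm" ("\<i>\<d>\<index>")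
  comp :: "'m \<Rightarrow> 'm \<Rightarrow> 'm" (infixr "\<cdot>\<index>" 70)
  smul :: "'r \<Rightarrow> 'm \<Rightarrow> 'm" (infixr "\<odot>\<index>" 75)
  tens_obj :: "'o \<Rightarrow> 'o \<Rightarrow> 'o" (infixl "\<boxtimes>\<index>" 80)
  tens :: "'m \<Rightarrow> 'm \<Rightarrow> 'm" (infixl "\<otimes>\<index>" 80)
  unit_obj :: 'o ("\<one>\<index>")
  assoc :: "'o \<Rightarrow> 'o \<Rightarrow> 'o \<Rightarrow> 'm"
  lunit :: "'o \<Rightarrow> 'm"
  runit :: "'o \<Rightarrow> 'm"
  braid :: "'o \<Rightarrow> 'o \<Rightarrow> 'm"
  twist :: "'o \<Rightarrow> 'm"
  dual :: "'o \<Rightarrow> 'o"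
  dual_ev :: "'o \<Rightarrow> 'm"
  dual_coev :: "'o \<Rightarrow> 'm"

definition is_inverse :: "('o, 'm, 'r, 'z) ribbon_structure_scheme \<Rightarrow> 'o \<Rightarrow> 'o \<Rightarrow> 'm \<Rightarrow> 'm \<Rightarrow> bool"
  where "is_inverse \<C> A B f g \<longleftrightarrow> f \<in> hom \<C> A B \<and> g \<in> hom \<C> B A \<and>
    g \<cdot>\<^bsub>\<C>\<^esub> f = \<i>\<d>\<^bsub>\<C>\<^esub> A \<and> f \<cdot>\<^bsub>\<C>\<^esub> g = \<i>\<d>\<^bsub>\<C>\<^esub> B"

definition iso :: "('o, 'm, 'r, 'z) ribbon_structure_scheme \<Rightarrow> 'o \<Rightarrow> 'o \<Rightarrow> 'm \<Rightarrow> bool"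
  where "iso \<C> A B f \<longleftrightarrow> (\<exists>g. is_inverse \<C> A B f g)"

text \<open>The inverse in \<open>hom B A\<close> of an isomorphism \<open>f \<in> hom A B\<close>.\<close>

definition inv_mor :: "('o, 'm, 'r, 'z) ribbon_structure_scheme \<Rightarrow> 'o \<Rightarrow> 'o \<Rightarrow> 'm \<Rightarrow> 'm"
  where "inv_mor \<C> A B f = (THE g. is_inverse \<C> A B f g)"

definition assoc_inv :: "('o, 'm, 'r, 'z) ribbon_structure_scheme \<Rightarrow> 'o \<Rightarrow> 'o \<Rightarrow> 'o \<Rightarrow> 'm"
  where "assoc_inv \<C> A B D =
    inv_mor \<C> ((A \<boxtimes>\<^bsub>\<C>\<^esub> B) \<boxtimes>\<^bsub>\<C>\<^esub> D) (A \<boxtimes>\<^bsub>\<C>\<^esub> (B \<boxtimes>\<^bsub>\<C>\<^esub> D)) (assoc \<C> A B D)"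

definition lunit_inv :: "('o, 'm, 'r, 'z) ribbon_structure_scheme \<Rightarrow> 'o \<Rightarrow> 'm"
  where "lunit_inv \<C> A = inv_mor \<C> (\<one>\<^bsub>\<C>\<^esub> \<boxtimes>\<^bsub>\<C>\<^esub> A) A (lunit \<C> A)"

definition runit_inv :: "('o, 'm, 'r, 'z) ribbon_structure_scheme \<Rightarrow> 'o \<Rightarrow> 'm"
  where "runit_inv \<C> A = inv_mor \<C> (A \<boxtimes>\<^bsub>\<C>\<^esub> \<one>\<^bsub>\<C>\<^esub>) A (runit \<C> A)"

definition braid_inv :: "('o, 'm, 'r, 'z) ribbon_structure_scheme \<Rightarrow> 'o \<Rightarrow> 'o \<Rightarrow> 'm"
  where "braid_inv \<C> A B = inv_mor \<C> (A \<boxtimes>\<^bsub>\<C>\<^esub> B) (B \<boxtimes>\<^bsub>\<C>\<^esub> A) (braid \<C> A B)"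

definition twist_inv :: "('o, 'm, 'r, 'z) ribbon_structure_scheme \<Rightarrow> 'o \<Rightarrow> 'm"
  where "twist_inv \<C> A = inv_mor \<C> A A (twist \<C> A)"

text \<open>\<open>B\<close> is a left dual of \<open>A\<close> with evaluation \<open>e : B \<boxtimes> A \<rightarrow> \<one>\<close> and
  coevaluation \<open>k : \<one> \<rightarrow> A \<boxtimes> B\<close>.\<close>

definition dual_pair ::
    "('o, 'm, 'r, 'z) ribbon_structure_scheme \<Rightarrow> 'o \<Rightarrow> 'o \<Rightarrow> 'm \<Rightarrow> 'm \<Rightarrow> bool"
  where "dual_pair \<C> A B e k \<longleftrightarrow>
    e \<in> hom \<C> (B \<boxtimes>\<^bsub>\<C>\<^esub> A) \<one>\<^bsub>\<C>\<^esub> \<and> k \<in> hom \<C> \<one>\<^bsub>\<C>\<^esub> (A \<boxtimes>\<^bsub>\<C>\<^esub> B) \<and>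
    runit \<C> A \<cdot>\<^bsub>\<C>\<^esub> (\<i>\<d>\<^bsub>\<C>\<^esub> A \<otimes>\<^bsub>\<C>\<^esub> e) \<cdot>\<^bsub>\<C>\<^esub> assoc \<C> A B A \<cdot>\<^bsub>\<C>\<^esub> (k \<otimes>\<^bsub>\<C>\<^esub> \<i>\<d>\<^bsub>\<C>\<^esub> A) \<cdot>\<^bsub>\<C>\<^esub> lunit_inv \<C> A
      = \<i>\<d>\<^bsub>\<C>\<^esub> A \<and>
    lunit \<C> B \<cdot>\<^bsub>\<C>\<^esub> (e \<otimes>\<^bsub>\<C>\<^esub> \<i>\<d>\<^bsub>\<C>\<^esub> B) \<cdot>\<^bsub>\<C>\<^esub> assoc_inv \<C> B A B \<cdot>\<^bsub>\<C>\<^esub> (\<i>\<d>\<^bsub>\<C>\<^esub> B \<otimes>\<^bsub>\<C>\<^esub> k) \<cdot>\<^bsub>\<C>\<^esub> runit_inv \<C> B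
      = \<i>\<d>\<^bsub>\<C>\<^esub> B"

locale linear_category =
  module "smul \<C>"
  for \<C> :: "('o, 'm::ab_group_add, 'r::comm_ring_1, 'z) ribbon_structure_scheme" (structure) +
  assumes subspace_hom: "subspace (hom \<C> A B)"
    and ident_in_hom: "\<i>\<d> A \<in> hom \<C> A A"
    and comp_in_hom: "f \<in> hom \<C> A B \<Longrightarrow> g \<in> hom \<C> B D \<Longrightarrow> g \<cdot> f \<in> hom \<C> A D"
    and ident_comp: "f \<in> hom \<C> A B \<Longrightarrow> \<i>\<d> B \<cdot> f = f"
    and comp_ident: "f \<in> hom \<C> A B \<Longrightarrow> f \<cdot> \<i>\<d> A = f"
    and comp_assoc: "f \<in> hom \<C> A B \<Longrightarrow> g \<in> hom \<C> B D \<Longrightarrow> h \<in> hom \<C> D E \<Longrightarrow>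
      (h \<cdot> g) \<cdot> f = h \<cdot> (g \<cdot> f)"
    and comp_add_left: "f \<in> hom \<C> A B \<Longrightarrow> g \<in> hom \<C> B D \<Longrightarrow> g' \<in> hom \<C> B D \<Longrightarrow>
      (g + g') \<cdot> f = g \<cdot> f + g' \<cdot> f"
    and comp_add_right: "f \<in> hom \<C> A B \<Longrightarrow> f' \<in> hom \<C> A B \<Longrightarrow> g \<in> hom \<C> B D \<Longrightarrow>
      g \<cdot> (f + f') = g \<cdot> f + g \<cdot> f'"
    and comp_smul_left: "f \<in> hom \<C> A B \<Longrightarrow> g \<in> hom \<C> B D \<Longrightarrow> (r \<odot> g) \<cdot> f = r \<odot> (g \<cdot> f)"
    and comp_smul_right: "f \<in> hom \<C> A B \<Longrightarrow> g \<in> hom \<C> B D \<Longrightarrow> g \<cdot> (r \<odot> f) = r \<odot> (g \<cdot> f)"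

locale linear_monoidal_category = linear_category +
  assumes tens_in_hom: "f \<in> hom \<C> A B \<Longrightarrow> g \<in> hom \<C> D E \<Longrightarrow> f \<otimes> g \<in> hom \<C> (A \<boxtimes> D) (B \<boxtimes> E)"
    and tens_ident: "\<i>\<d> A \<otimes> \<i>\<d> B = \<i>\<d> (A \<boxtimes> B)"
    and interchange: "f \<in> hom \<C> A B \<Longrightarrow> g \<in> hom \<C> B D \<Longrightarrow> f' \<in> hom \<C> A' B' \<Longrightarrow> g' \<in> hom \<C> B' D' \<Longrightarrow>
      (g \<cdot> f) \<otimes> (g' \<cdot> f') = (g \<otimes> g') \<cdot> (f \<otimes> f')"
    and tens_add_left: "f \<in> hom \<C> A B \<Longrightarrow> f' \<in> hom \<C> A B \<Longrightarrow> g \<in> hom \<C> D E \<Longrightarrow>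
      (f + f') \<otimes> g = f \<otimes> g + f' \<otimes> g"
    and tens_add_right: "f \<in> hom \<C> A B \<Longrightarrow> g \<in> hom \<C> D E \<Longrightarrow> g' \<in> hom \<C> D E \<Longrightarrow>
      f \<otimes> (g + g') = f \<otimes> g + f \<otimes> g'"
    and tens_smul_left: "f \<in> hom \<C> A B \<Longrightarrow> g \<in> hom \<C> D E \<Longrightarrow> (r \<odot> f) \<otimes> g = r \<odot> (f \<otimes> g)"
    and tens_smul_right: "f \<in> hom \<C> A B \<Longrightarrow> g \<in> hom \<C> D E \<Longrightarrow> f \<otimes> (r \<odot> g) = r \<odot> (f \<otimes> g)"
    and assoc_iso: "iso \<C> ((A \<boxtimes> B) \<boxtimes> D) (A \<boxtimes> (B \<boxtimes> D)) (assoc \<C> A B D)"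
    and lunit_iso: "iso \<C> (\<one> \<boxtimes> A) A (lunit \<C> A)"
    and runit_iso: "iso \<C> (A \<boxtimes> \<one>) A (runit \<C> A)"
    and assoc_natural: "f \<in> hom \<C> A A' \<Longrightarrow> g \<in> hom \<C> B B' \<Longrightarrow> h \<in> hom \<C> D D' \<Longrightarrow>
      assoc \<C> A' B' D' \<cdot> ((f \<otimes> g) \<otimes> h) = (f \<otimes> (g \<otimes> h)) \<cdot> assoc \<C> A B D"
    and lunit_natural: "f \<in> hom \<C> A B \<Longrightarrow> lunit \<C> B \<cdot> (\<i>\<d> \<one> \<otimes> f) = f \<cdot> lunit \<C> A"
    and runit_natural: "f \<in> hom \<C> A B \<Longrightarrow> runit \<C> B \<cdot> (f \<otimes> \<i>\<d> \<one>) = f \<cdot> runit \<C> A"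
    and pentagon: "assoc \<C> A B (D \<boxtimes> E) \<cdot> assoc \<C> (A \<boxtimes> B) D E =
      (\<i>\<d> A \<otimes> assoc \<C> B D E) \<cdot> assoc \<C> A (B \<boxtimes> D) E \<cdot> (assoc \<C> A B D \<otimes> \<i>\<d> E)"
    and triangle: "(\<i>\<d> A \<otimes> lunit \<C> B) \<cdot> assoc \<C> A \<one> B = runit \<C> A \<otimes> \<i>\<d> B"

locale linear_ribbon_category = linear_monoidal_category +
  assumes braid_iso: "iso \<C> (A \<boxtimes> B) (B \<boxtimes> A) (braid \<C> A B)"
    and braid_natural: "f \<in> hom \<C> A A' \<Longrightarrow> g \<in> hom \<C> B B' \<Longrightarrow>
      braid \<C> A' B' \<cdot> (f \<otimes> g) = (g \<otimes> f) \<cdot> braid \<C> A B"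
    and hexagon1: "assoc \<C> B D A \<cdot> braid \<C> A (B \<boxtimes> D) \<cdot> assoc \<C> A B D =
      (\<i>\<d> B \<otimes> braid \<C> A D) \<cdot> assoc \<C> B A D \<cdot> (braid \<C> A B \<otimes> \<i>\<d> D)"
    and hexagon2: "assoc_inv \<C> D A B \<cdot> braid \<C> (A \<boxtimes> B) D \<cdot> assoc_inv \<C> A B D =
      (braid \<C> A D \<otimes> \<i>\<d> B) \<cdot> assoc_inv \<C> A D B \<cdot> (\<i>\<d> A \<otimes> braid \<C> B D)"
    and dual: "dual_pair \<C> A (dual \<C> A) (dual_ev \<C> A) (dual_coev \<C> A)"
    and twist_iso: "iso \<C> A A (twist \<C> A)"
    and twist_natural: "f \<in> hom \<C> A B \<Longrightarrow> twist \<C> B \<cdot> f = f \<cdot> twist \<C> A"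
    and twist_tens: "twist \<C> (A \<boxtimes> B) = braid \<C> B A \<cdot> braid \<C> A B \<cdot> (twist \<C> A \<otimes> twist \<C> B)"
    and twist_dual: "(twist \<C> A \<otimes> \<i>\<d> (dual \<C> A)) \<cdot> dual_coev \<C> A =
      (\<i>\<d> A \<otimes> twist \<C> (dual \<C> A)) \<cdot> dual_coev \<C> A"

section \<open>Trivalent ribbon categories\<close>

record ('o, 'm, 'r) trivalent_structure = "('o, 'm, 'r) ribbon_structure" +
  strand :: 'o
  ev :: 'm
  coev :: 'm
  vertex :: 'm

fun tens_pow :: "('o, 'm, 'r, 'z) ribbon_structure_scheme \<Rightarrow> 'o \<Rightarrow> nat \<Rightarrow> 'o" where
  "tens_pow \<C> A 0 = \<one>\<^bsub>\<C>\<^esub>"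
| "tens_pow \<C> A (Suc 0) = A"
| "tens_pow \<C> A (Suc (Suc n)) = tens_pow \<C> A (Suc n) \<boxtimes>\<^bsub>\<C>\<^esub> A"

definition box :: "('o, 'm, 'r, 'z) trivalent_structure_scheme \<Rightarrow> nat \<Rightarrow> 'm set"
  where "box \<C> n = hom \<C> (tens_pow \<C> (strand \<C>) n) \<one>\<^bsub>\<C>\<^esub>"

text \<open>The diagrams below are written in the literature as if \<open>\<C>\<close> were strict; here the associators
  and unitors are inserted. \<open>m : X \<boxtimes> X \<rightarrow> X\<close> and \<open>\<delta> : X \<rightarrow> X \<boxtimes> X\<close> are \<open>merge\<close> and \<open>fork\<close>; the
  remaining diagrams are endomorphisms of \<open>X \<boxtimes> X\<close>.\<close>

context
  fixes \<C> :: "('o, 'm, 'r, 'z) trivalent_structure_scheme" (structure)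
begin

definition merge :: 'm where
  "merge = (let X = strand \<C> in
     lunit \<C> X \<cdot> (vertex \<C> \<otimes> \<i>\<d> X) \<cdot> assoc_inv \<C> (X \<boxtimes> X) X X \<cdot>
     (\<i>\<d> (X \<boxtimes> X) \<otimes> coev \<C>) \<cdot> runit_inv \<C> (X \<boxtimes> X))"

definition fork :: 'm where
  "fork = (let X = strand \<C> in
     (merge \<otimes> \<i>\<d> X) \<cdot> assoc_inv \<C> X X X \<cdot> (\<i>\<d> X \<otimes> coev \<C>) \<cdot> runit_inv \<C> X)"

definition dgm_one :: 'm where "dgm_one = \<i>\<d> (strand \<C> \<boxtimes> strand \<C>)"

definition dgm_U :: 'm where "dgm_U = coev \<C> \<cdot> ev \<C>"

definition dgm_I :: 'm where "dgm_I = fork \<cdot> merge"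

definition dgm_H :: 'm where
  "dgm_H = (let X = strand \<C> in
     (\<i>\<d> X \<otimes> merge) \<cdot> assoc \<C> X X X \<cdot> (fork \<otimes> \<i>\<d> X))"

definition dgm_S :: 'm where "dgm_S = dgm_H \<cdot> dgm_H"

definition pos_crossing :: 'm where "pos_crossing = braid \<C> (strand \<C>) (strand \<C>)"

definition neg_crossing :: 'm where "neg_crossing = braid_inv \<C> (strand \<C>) (strand \<C>)"

end

text \<open>The objects and morphisms of the ribbon subcategory generated by \<open>\<tau>\<close> (together with the strand
  and its self-duality).\<close>

inductive_set gen_objs :: "('o, 'm, 'r, 'z) trivalent_structure_scheme \<Rightarrow> 'o set"
  for \<C> :: "('o, 'm, 'r, 'z) trivalent_structure_scheme" where
  "\<one>\<^bsub>\<C>\<^esub> \<in> gen_objs \<C>"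
| "strand \<C> \<in> gen_objs \<C>"
| "A \<in> gen_objs \<C> \<Longrightarrow> B \<in> gen_objs \<C> \<Longrightarrow> A \<boxtimes>\<^bsub>\<C>\<^esub> B \<in> gen_objs \<C>"
| "A \<in> gen_objs \<C> \<Longrightarrow> dual \<C> A \<in> gen_objs \<C>"

inductive gen_mor :: "('o, 'm::ab_group_add, 'r, 'z) trivalent_structure_scheme \<Rightarrow> 'o \<Rightarrow> 'o \<Rightarrow> 'm \<Rightarrow> bool"
  for \<C> :: "('o, 'm, 'r, 'z) trivalent_structure_scheme" where
  gen_vertex: "gen_mor \<C> (tens_pow \<C> (strand \<C>) 3) \<one>\<^bsub>\<C>\<^esub> (vertex \<C>)"
| gen_ev: "gen_mor \<C> (strand \<C> \<boxtimes>\<^bsub>\<C>\<^esub> strand \<C>) \<one>\<^bsub>\<C>\<^esub> (ev \<C>)"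
| gen_coev: "gen_mor \<C> \<one>\<^bsub>\<C>\<^esub> (strand \<C> \<boxtimes>\<^bsub>\<C>\<^esub> strand \<C>) (coev \<C>)"
| gen_ident: "A \<in> gen_objs \<C> \<Longrightarrow> gen_mor \<C> A A (\<i>\<d>\<^bsub>\<C>\<^esub> A)"
| gen_comp: "gen_mor \<C> A B f \<Longrightarrow> gen_mor \<C> B D g \<Longrightarrow> gen_mor \<C> A D (g \<cdot>\<^bsub>\<C>\<^esub> f)"
| gen_add: "gen_mor \<C> A B f \<Longrightarrow> gen_mor \<C> A B g \<Longrightarrow> gen_mor \<C> A B (f + g)"
| gen_zero: "A \<in> gen_objs \<C> \<Longrightarrow> B \<in> gen_objs \<C> \<Longrightarrow> gen_mor \<C> A B 0"
| gen_smul: "gen_mor \<C> A B f \<Longrightarrow> gen_mor \<C> A B (r \<odot>\<^bsub>\<C>\<^esub> f)"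
| gen_tens: "gen_mor \<C> A B f \<Longrightarrow> gen_mor \<C> D E g \<Longrightarrow>
    gen_mor \<C> (A \<boxtimes>\<^bsub>\<C>\<^esub> D) (B \<boxtimes>\<^bsub>\<C>\<^esub> E) (f \<otimes>\<^bsub>\<C>\<^esub> g)"
| gen_assoc: "A \<in> gen_objs \<C> \<Longrightarrow> B \<in> gen_objs \<C> \<Longrightarrow> D \<in> gen_objs \<C> \<Longrightarrow>
    gen_mor \<C> ((A \<boxtimes>\<^bsub>\<C>\<^esub> B) \<boxtimes>\<^bsub>\<C>\<^esub> D) (A \<boxtimes>\<^bsub>\<C>\<^esub> (B \<boxtimes>\<^bsub>\<C>\<^esub> D)) (assoc \<C> A B D)"
| gen_assoc_inv: "A \<in> gen_objs \<C> \<Longrightarrow> B \<in> gen_objs \<C> \<Longrightarrow> D \<in> gen_objs \<C> \<Longrightarrow>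
    gen_mor \<C> (A \<boxtimes>\<^bsub>\<C>\<^esub> (B \<boxtimes>\<^bsub>\<C>\<^esub> D)) ((A \<boxtimes>\<^bsub>\<C>\<^esub> B) \<boxtimes>\<^bsub>\<C>\<^esub> D) (assoc_inv \<C> A B D)"
| gen_lunit: "A \<in> gen_objs \<C> \<Longrightarrow> gen_mor \<C> (\<one>\<^bsub>\<C>\<^esub> \<boxtimes>\<^bsub>\<C>\<^esub> A) A (lunit \<C> A)"
| gen_lunit_inv: "A \<in> gen_objs \<C> \<Longrightarrow> gen_mor \<C> A (\<one>\<^bsub>\<C>\<^esub> \<boxtimes>\<^bsub>\<C>\<^esub> A) (lunit_inv \<C> A)"
| gen_runit: "A \<in> gen_objs \<C> \<Longrightarrow> gen_mor \<C> (A \<boxtimes>\<^bsub>\<C>\<^esub> \<one>\<^bsub>\<C>\<^esub>) A (runit \<C> A)"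
| gen_runit_inv: "A \<in> gen_objs \<C> \<Longrightarrow> gen_mor \<C> A (A \<boxtimes>\<^bsub>\<C>\<^esub> \<one>\<^bsub>\<C>\<^esub>) (runit_inv \<C> A)"
| gen_braid: "A \<in> gen_objs \<C> \<Longrightarrow> B \<in> gen_objs \<C> \<Longrightarrow>
    gen_mor \<C> (A \<boxtimes>\<^bsub>\<C>\<^esub> B) (B \<boxtimes>\<^bsub>\<C>\<^esub> A) (braid \<C> A B)"
| gen_braid_inv: "A \<in> gen_objs \<C> \<Longrightarrow> B \<in> gen_objs \<C> \<Longrightarrow>
    gen_mor \<C> (B \<boxtimes>\<^bsub>\<C>\<^esub> A) (A \<boxtimes>\<^bsub>\<C>\<^esub> B) (braid_inv \<C> A B)"
| gen_twist: "A \<in> gen_objs \<C> \<Longrightarrow> gen_mor \<C> A A (twist \<C> A)"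
| gen_twist_inv: "A \<in> gen_objs \<C> \<Longrightarrow> gen_mor \<C> A A (twist_inv \<C> A)"
| gen_dual_ev: "A \<in> gen_objs \<C> \<Longrightarrow> gen_mor \<C> (dual \<C> A \<boxtimes>\<^bsub>\<C>\<^esub> A) \<one>\<^bsub>\<C>\<^esub> (dual_ev \<C> A)"
| gen_dual_coev: "A \<in> gen_objs \<C> \<Longrightarrow> gen_mor \<C> \<one>\<^bsub>\<C>\<^esub> (A \<boxtimes>\<^bsub>\<C>\<^esub> dual \<C> A) (dual_coev \<C> A)"

text \<open>``Generated by \<open>\<tau>\<close>'' is taken up to equivalence: every object is isomorphic to a generated
  one, and every morphism between generated objects is a generated one. Freeness of rank one on a
  generator is expressed by linear independence and span of a singleton. Since \<open>hom \<one> \<one>\<close> and,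
  by duality, \<open>hom X X\<close> are free on the identity, circle and bigon are identified with scalars.\<close>

locale trivalent_ribbon_category =
  linear_ribbon_category \<C>
  for \<C> :: "('o, 'm::ab_group_add, 'r::comm_ring_1, 'z) trivalent_structure_scheme" (structure) +
  assumes self_dual: "dual_pair \<C> (strand \<C>) (strand \<C>) (ev \<C>) (coev \<C>)"
    and box_1: "box \<C> 1 = {0}"
    and box_0: "independent {\<i>\<d> \<one>}" "span {\<i>\<d> \<one>} = box \<C> 0"
    and box_2: "independent {ev \<C>}" "span {ev \<C>} = box \<C> 2"
    and box_3: "independent {vertex \<C>}" "span {vertex \<C>} = box \<C> 3"
    and generated_objs: "\<exists>B \<in> gen_objs \<C>. \<exists>f. iso \<C> A B f"
    and generated_mors: "A \<in> gen_objs \<C> \<Longrightarrow> B \<in> gen_objs \<C> \<Longrightarrow> f \<in> hom \<C> A B \<Longrightarrow> gen_mor \<C> A B f"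
    and circle_nonzero: "\<exists>d. d \<noteq> 0 \<and> ev \<C> \<cdot> coev \<C> = d \<odot> \<i>\<d> \<one>"
    and bigon_nonzero: "\<exists>b. b \<noteq> 0 \<and> merge \<C> \<cdot> fork \<C> = b \<odot> \<i>\<d> (strand \<C>)"

section \<open>The quantum exceptional Jacobi relation\<close>

definition QEJac ::
    "('o, 'm::ab_group_add, complex, 'z) trivalent_structure_scheme \<Rightarrow>
     complex \<Rightarrow> complex \<Rightarrow> complex \<Rightarrow> complex \<Rightarrow> complex \<Rightarrow> bool"
  where "QEJac \<C> v \<alpha> d b t \<longleftrightarrow> v \<noteq> 0 \<and>
    v powi (-3) \<odot>\<^bsub>\<C>\<^esub> (dgm_H \<C> \<cdot>\<^bsub>\<C>\<^esub> neg_crossing \<C>) + v \<odot>\<^bsub>\<C>\<^esub> dgm_I \<C> - v powi (-1) \<odot>\<^bsub>\<C>\<^esub> dgm_H \<C>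
      + \<alpha> \<odot>\<^bsub>\<C>\<^esub> (neg_crossing \<C> + v ^ 4 \<odot>\<^bsub>\<C>\<^esub> dgm_U \<C> + v powi (-4) \<odot>\<^bsub>\<C>\<^esub> dgm_one \<C>) = 0 \<and>
    ev \<C> \<cdot>\<^bsub>\<C>\<^esub> coev \<C> = d \<odot>\<^bsub>\<C>\<^esub> \<i>\<d>\<^bsub>\<C>\<^esub> \<one>\<^bsub>\<C>\<^esub> \<and>
    merge \<C> \<cdot>\<^bsub>\<C>\<^esub> coev \<C> = 0 \<and>
    merge \<C> \<cdot>\<^bsub>\<C>\<^esub> fork \<C> = b \<odot>\<^bsub>\<C>\<^esub> \<i>\<d>\<^bsub>\<C>\<^esub> (strand \<C>) \<and>
    dgm_H \<C> \<cdot>\<^bsub>\<C>\<^esub> fork \<C> = t \<odot>\<^bsub>\<C>\<^esub> fork \<C> \<and>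
    neg_crossing \<C> \<cdot>\<^bsub>\<C>\<^esub> fork \<C> = (- (v ^ 6)) \<odot>\<^bsub>\<C>\<^esub> fork \<C> \<and>
    neg_crossing \<C> \<cdot>\<^bsub>\<C>\<^esub> coev \<C> = v ^ 12 \<odot>\<^bsub>\<C>\<^esub> coev \<C>"

definition qbracket :: "complex \<Rightarrow> int \<Rightarrow> complex"
  where "qbracket v n = v powi n - v powi (- n)"

definition qbrace :: "complex \<Rightarrow> int \<Rightarrow> complex"
  where "qbrace v n = v powi n + v powi (- n)"

definition Psi1 :: "complex \<Rightarrow> complex" where "Psi1 v = v - v powi (-1)"
definition Psi2 :: "complex \<Rightarrow> complex" where "Psi2 v = v + v powi (-1)"
definition Psi3 :: "complex \<Rightarrow> complex" where "Psi3 v = v ^ 2 + 1 + v powi (-2)"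
definition Psi4 :: "complex \<Rightarrow> complex" where "Psi4 v = v ^ 2 + v powi (-2)"
definition Psi6 :: "complex \<Rightarrow> complex" where "Psi6 v = v ^ 2 - 1 + v powi (-2)"

definition coeff_y1 :: "complex \<Rightarrow> complex \<Rightarrow> complex \<Rightarrow> complex"
  where "coeff_y1 v \<alpha> b = - b +
    (- (v powi (-5)) + v powi (-3) + 2 * v + v ^ 3 + 2 * v ^ 5 + v ^ 7) * \<alpha>"

definition coeff_y2 :: "complex \<Rightarrow> complex \<Rightarrow> complex \<Rightarrow> complex"
  where "coeff_y2 v \<alpha> b = - b +
    (- (v powi (-7)) - 2 * v powi (-5) - v powi (-3) - 2 * v powi (-1) - v ^ 3 + v ^ 5) * \<alpha>"

definition coeff_y3 :: "complex \<Rightarrow> complex \<Rightarrow> complex \<Rightarrow> complex"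
  where "coeff_y3 v \<alpha> b = b +
    (- (v powi (-9)) + v powi (-7) - v powi (-5) + v powi (-3) - v powi (-1) + v) * \<alpha>"

definition coeff_y4 :: "complex \<Rightarrow> complex \<Rightarrow> complex \<Rightarrow> complex"
  where "coeff_y4 v \<alpha> b = b +
    (- (v powi (-1)) + v - v ^ 3 + v ^ 5 - v ^ 7 + v ^ 9) * \<alpha>"

end

theory Submission
  imports Defs
begin

text \<open>
  Associativity and unit constraints are removed by letting an object act on all objects by tensoring
  from the left; diagrams become words of elementary layers, and isotopies become commutation rules
  between layers. The eigenvalues of the crossing on \<open>coev\<close> and \<open>fork\<close> force the vertex to be
  rotationally invariant, so that the quarter turn exchanges \<open>\<one>\<close> with \<open>U\<close>, \<open>I\<close> with \<open>H\<close> and the two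
  crossings, and fixes the square \<open>S\<close>.

  As \<open>dim \<C>(4) \<le> 5\<close>, the six diagrams without square satisfy a linear relation. Composing it with
  \<open>H\<close> or with a crossing, where (QEJac) evaluates \<open>H\<sigma>\<close> and \<open>H\<sigma>\<^sup>-\<^sup>1\<close>, and antisymmetrising under the quarter
  turn produces a relation \<open>\<sigma> - \<sigma>\<^sup>-\<^sup>1 = x (\<one> - U) + y (I - H)\<close>. Composing this relation with \<open>H\<close> and
  antisymmetrising again cancels \<open>S\<close> and determines \<open>x\<close> and \<open>y\<close>, unless \<open>\<one> - U\<close> and \<open>I - H\<close> are
  proportional, in which case \<open>coev\<close> and \<open>fork\<close> determine all scalars. Without antisymmetrising it
  expresses \<open>S\<close>.
\<close>

section \<open>Linear categories\<close>

text \<open>Below [n] = v^n - v^-n and {n} = v^n + v^-n. Rotational invariance of the vertex is not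
  an axiom, so it has to be proved before a quarter turn can be used at all. The dimension bound
  enters only once, and the relation that it supplies is unspecific: it may contain both crossings
  with equal weight, or none, and each of these forms needs its own way to break the symmetry.
  Without S, the combinations that change sign under the quarter turn are spanned by \<one> - U, I -
  H and \<sigma> - \<sigma>^-1. Composing with H and antisymmetrising sends a relation in this span
  to another one, which is why x and y satisfy closed equations. The denominator b + [3]\<alpha>
  arises there: b comes from H U = b U, and [3]\<alpha> from the crossing terms of H\<sigma> and
  H\<sigma>^-1. The hypothesis v^10 \<noteq> 1 yields \<alpha> \<noteq> 0, and v^12 \<noteq> 1 keeps
  [6], hence [3] and {3}, away from 0.\<close>

context linear_category begin

lemma is_inverse_unique:
  assumes "is_inverse \<C> A B f g" "is_inverse \<C> A B f g'"
  shows "g = g'"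
proof -
  have "g = (g' \<cdot> f) \<cdot> g" using assms by (simp add: is_inverse_def ident_comp[of g B A])
  also have "\<dots> = g' \<cdot> (f \<cdot> g)"
    using assms unfolding is_inverse_def by (intro comp_assoc[of g B A f B g' A]) auto
  also have "\<dots> = g'" using assms by (simp add: is_inverse_def comp_ident[of g' B A])
  finally show ?thesis .
qed

lemma is_inverse_inv_mor: "iso \<C> A B f \<Longrightarrow> is_inverse \<C> A B f (inv_mor \<C> A B f)"
  unfolding iso_def inv_mor_def by (rule theI') (blast intro: is_inverse_unique)

lemma is_inverse_cancel:
  assumes "is_inverse \<C> A B f g"
  shows "h \<in> hom \<C> Z A \<Longrightarrow> g \<cdot> f \<cdot> h = h" "h \<in> hom \<C> Z B \<Longrightarrow> f \<cdot> g \<cdot> h = h"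
    "k \<in> hom \<C> A Z \<Longrightarrow> (k \<cdot> g) \<cdot> f = k" "k \<in> hom \<C> B Z \<Longrightarrow> (k \<cdot> f) \<cdot> g = k"
  using assms unfolding is_inverse_def
  using comp_assoc[of h Z A f B g A] comp_assoc[of h Z B g A f B]
      comp_assoc[of f A B g A k Z] comp_assoc[of g B A f B k Z]
  by (auto simp: ident_comp comp_ident)

lemma is_inverse_comp:
  assumes "is_inverse \<C> A B f f'" "is_inverse \<C> B D g g'"
  shows "is_inverse \<C> A D (g \<cdot> f) (f' \<cdot> g')"
proof -
  have t: "f \<in> hom \<C> A B" "f' \<in> hom \<C> B A" "g \<in> hom \<C> B D" "g' \<in> hom \<C> D B"
    using assms by (auto simp: is_inverse_def)
  have "(f' \<cdot> g') \<cdot> g \<cdot> f = f' \<cdot> f"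
    using is_inverse_cancel(1)[OF assms(2) t(1)] comp_assoc[OF comp_in_hom[OF t(1,3)] t(4,2)] by simp
  moreover have "(g \<cdot> f) \<cdot> f' \<cdot> g' = g \<cdot> g'"
    using is_inverse_cancel(2)[OF assms(1) t(4)] comp_assoc[OF comp_in_hom[OF t(4,2)] t(1,3)] by simp
  ultimately show ?thesis
    using assms t by (auto simp: is_inverse_def intro: comp_in_hom)
qed

lemma is_inverse_ident: "is_inverse \<C> A A (\<i>\<d> A) (\<i>\<d> A)"
  by (simp add: is_inverse_def ident_in_hom ident_comp[OF ident_in_hom])

lemma zero_in_hom: "0 \<in> hom \<C> A B"
  using subspace_hom subspace_0 by blast

lemma add_in_hom: "f \<in> hom \<C> A B \<Longrightarrow> g \<in> hom \<C> A B \<Longrightarrow> f + g \<in> hom \<C> A B"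
  using subspace_hom subspace_add by blast

lemma smul_in_hom: "f \<in> hom \<C> A B \<Longrightarrow> r \<odot> f \<in> hom \<C> A B"
  using subspace_hom subspace_scale by blast

lemma comp_zero: "f \<in> hom \<C> B D \<Longrightarrow> f \<cdot> 0 = 0"
  using comp_smul_right[OF zero_in_hom[of B B], of f D 0] by simp

lemma zero_comp: "f \<in> hom \<C> A B \<Longrightarrow> 0 \<cdot> f = 0"
  using comp_smul_left[OF _ zero_in_hom[of B B], of f A 0] by simp

end

section \<open>Invertible constraints of a monoidal category\<close>

context linear_monoidal_category begin

lemmas assoc_inverse = is_inverse_inv_mor[OF assoc_iso, folded assoc_inv_def]
  and lunit_inverse = is_inverse_inv_mor[OF lunit_iso, folded lunit_inv_def]
  and runit_inverse = is_inverse_inv_mor[OF runit_iso, folded runit_inv_def]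

lemma structure_in_hom:
  "assoc \<C> A B D \<in> hom \<C> ((A \<boxtimes> B) \<boxtimes> D) (A \<boxtimes> (B \<boxtimes> D))"
  "assoc_inv \<C> A B D \<in> hom \<C> (A \<boxtimes> (B \<boxtimes> D)) ((A \<boxtimes> B) \<boxtimes> D)"
  "lunit \<C> A \<in> hom \<C> (\<one> \<boxtimes> A) A" "lunit_inv \<C> A \<in> hom \<C> A (\<one> \<boxtimes> A)"
  "runit \<C> A \<in> hom \<C> (A \<boxtimes> \<one>) A" "runit_inv \<C> A \<in> hom \<C> A (A \<boxtimes> \<one>)"
  using assoc_inverse[of A B D] lunit_inverse[of A] runit_inverse[of A]
  by (auto simp: is_inverse_def)

lemmas hom_intros = structure_in_hom ident_in_hom comp_in_hom tens_in_hom

lemma whisker_comp: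
  assumes "f \<in> hom \<C> A B" "g \<in> hom \<C> B D"
  shows "\<i>\<d> E \<otimes> (g \<cdot> f) = (\<i>\<d> E \<otimes> g) \<cdot> (\<i>\<d> E \<otimes> f)"
    "(g \<cdot> f) \<otimes> \<i>\<d> E = (g \<otimes> \<i>\<d> E) \<cdot> (f \<otimes> \<i>\<d> E)"
  using interchange[OF ident_in_hom ident_in_hom assms, of E]
    interchange[OF assms ident_in_hom ident_in_hom, of E]
  by (simp_all add: ident_comp[OF ident_in_hom])

lemma tens_split:
  assumes "f \<in> hom \<C> A B" "g \<in> hom \<C> D E"
  shows "f \<otimes> g = (f \<otimes> \<i>\<d> E) \<cdot> (\<i>\<d> A \<otimes> g)" "f \<otimes> g = (\<i>\<d> B \<otimes> g) \<cdot> (f \<otimes> \<i>\<d> D)"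
  using interchange[OF ident_in_hom assms(1) assms(2) ident_in_hom]
    interchange[OF assms(1) ident_in_hom ident_in_hom assms(2)]
  by (simp_all add: ident_comp[OF assms(1)] ident_comp[OF assms(2)]
      comp_ident[OF assms(1)] comp_ident[OF assms(2)])

lemma is_inverse_tens:
  assumes "is_inverse \<C> A B f f'" "is_inverse \<C> D E g g'"
  shows "is_inverse \<C> (A \<boxtimes> D) (B \<boxtimes> E) (f \<otimes> g) (f' \<otimes> g')"
  using assms unfolding is_inverse_def
  using interchange[of f A B f' A g D E g' D] interchange[of f' B A f B g' E D g E]
  by (auto simp: tens_in_hom tens_ident)

text \<open>Tensoring with the unit on the left is faithful by naturality of the left unitor; applied to
  \<open>\<i>\<d> \<one> \<otimes> _\<close> the claim is the pentagon combined with two triangles.\<close>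

lemma lunit_tens: "lunit \<C> A \<otimes> \<i>\<d> Y = lunit \<C> (A \<boxtimes> Y) \<cdot> assoc \<C> \<one> A Y"
proof -
  let ?a = "assoc \<C>" and ?p = "lunit \<C> A \<otimes> \<i>\<d> Y" and ?q = "lunit \<C> (A \<boxtimes> Y) \<cdot> assoc \<C> \<one> A Y"
  let ?g = "?a \<one> (\<one> \<boxtimes> A) Y \<cdot> (?a \<one> \<one> A \<otimes> \<i>\<d> Y)"
  have p: "?p \<in> hom \<C> ((\<one> \<boxtimes> A) \<boxtimes> Y) (A \<boxtimes> Y)" and q: "?q \<in> hom \<C> ((\<one> \<boxtimes> A) \<boxtimes> Y) (A \<boxtimes> Y)"
    by (rule hom_intros)+
  have g: "?g \<in> hom \<C> (((\<one> \<boxtimes> \<one>) \<boxtimes> A) \<boxtimes> Y) (\<one> \<boxtimes> ((\<one> \<boxtimes> A) \<boxtimes> Y))"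
    by (rule hom_intros)+
  have "(\<i>\<d> \<one> \<otimes> ?q) \<cdot> ?g = ((\<i>\<d> \<one> \<otimes> lunit \<C> (A \<boxtimes> Y)) \<cdot> (\<i>\<d> \<one> \<otimes> ?a \<one> A Y)) \<cdot> ?g"
    by (simp add: whisker_comp(1)[OF structure_in_hom(1,3)])
  also have "\<dots> = (\<i>\<d> \<one> \<otimes> lunit \<C> (A \<boxtimes> Y)) \<cdot> ((\<i>\<d> \<one> \<otimes> ?a \<one> A Y) \<cdot> ?g)"
    by (rule comp_assoc) (rule g hom_intros)+
  also have "(\<i>\<d> \<one> \<otimes> ?a \<one> A Y) \<cdot> ?g = ?a \<one> \<one> (A \<boxtimes> Y) \<cdot> ?a (\<one> \<boxtimes> \<one>) A Y"
    by (simp add: pentagon)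
  also have "(\<i>\<d> \<one> \<otimes> lunit \<C> (A \<boxtimes> Y)) \<cdot> \<dots>
      = ((\<i>\<d> \<one> \<otimes> lunit \<C> (A \<boxtimes> Y)) \<cdot> ?a \<one> \<one> (A \<boxtimes> Y)) \<cdot> ?a (\<one> \<boxtimes> \<one>) A Y"
    by (rule comp_assoc[symmetric]) (rule hom_intros)+
  also have "\<dots> = (runit \<C> \<one> \<otimes> (\<i>\<d> A \<otimes> \<i>\<d> Y)) \<cdot> ?a (\<one> \<boxtimes> \<one>) A Y"
    by (simp add: triangle tens_ident)
  also have "\<dots> = ?a \<one> A Y \<cdot> ((runit \<C> \<one> \<otimes> \<i>\<d> A) \<otimes> \<i>\<d> Y)"
    by (rule assoc_natural[symmetric]) (rule hom_intros)+
  also have "(runit \<C> \<one> \<otimes> \<i>\<d> A) \<otimes> \<i>\<d> Y = ((\<i>\<d> \<one> \<otimes> lunit \<C> A) \<otimes> \<i>\<d> Y) \<cdot> (?a \<one> \<one> A \<otimes> \<i>\<d> Y)"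
    unfolding triangle[symmetric] by (rule whisker_comp) (rule hom_intros)+
  also have "?a \<one> A Y \<cdot> \<dots> = (?a \<one> A Y \<cdot> ((\<i>\<d> \<one> \<otimes> lunit \<C> A) \<otimes> \<i>\<d> Y)) \<cdot> (?a \<one> \<one> A \<otimes> \<i>\<d> Y)"
    by (rule comp_assoc[symmetric]) (rule hom_intros)+
  also have "?a \<one> A Y \<cdot> ((\<i>\<d> \<one> \<otimes> lunit \<C> A) \<otimes> \<i>\<d> Y) = (\<i>\<d> \<one> \<otimes> ?p) \<cdot> ?a \<one> (\<one> \<boxtimes> A) Y"
    by (rule assoc_natural) (rule hom_intros)+
  also have "\<dots> \<cdot> (?a \<one> \<one> A \<otimes> \<i>\<d> Y) = (\<i>\<d> \<one> \<otimes> ?p) \<cdot> ?g"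
    by (rule comp_assoc) (rule hom_intros)+
  finally have eq: "(\<i>\<d> \<one> \<otimes> ?q) \<cdot> ?g = (\<i>\<d> \<one> \<otimes> ?p) \<cdot> ?g" .
  have "is_inverse \<C> (((\<one> \<boxtimes> \<one>) \<boxtimes> A) \<boxtimes> Y) (\<one> \<boxtimes> ((\<one> \<boxtimes> A) \<boxtimes> Y)) ?g
      ((assoc_inv \<C> \<one> \<one> A \<otimes> \<i>\<d> Y) \<cdot> assoc_inv \<C> \<one> (\<one> \<boxtimes> A) Y)"
    by (rule is_inverse_comp is_inverse_tens assoc_inverse is_inverse_ident)+
  from is_inverse_cancel(4)[OF this] eq p q have "\<i>\<d> \<one> \<otimes> ?q = \<i>\<d> \<one> \<otimes> ?p"
    by (metis ident_in_hom tens_in_hom)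
  then have "?q \<cdot> lunit \<C> ((\<one> \<boxtimes> A) \<boxtimes> Y) = ?p \<cdot> lunit \<C> ((\<one> \<boxtimes> A) \<boxtimes> Y)"
    using lunit_natural[OF p] lunit_natural[OF q] by simp
  then show ?thesis
    using is_inverse_cancel(4)[OF lunit_inverse p] is_inverse_cancel(4)[OF lunit_inverse q] by metis
qed

end

section \<open>Strict action of tensor powers\<close>

text \<open>A shape keeps the brackets and units of a tensor word, \<open>width\<close> forgets
  both. Shapes of equal width act through the same iterated tensor product, which is what turns the
  constraints into identities.\<close>

datatype shape = Unit | Strand | Join shape shape

primrec width :: "shape \<Rightarrow> nat" where
  "width Unit = 0"
| "width Strand = 1"
| "width (Join A B) = width A + width B"

context linear_category begin

lemma comp_rewrite:
  assumes "g \<cdot> f = g' \<cdot> f'" "k \<in> hom \<C> Z A" "f \<in> hom \<C> A B" "g \<in> hom \<C> B D"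
    "f' \<in> hom \<C> A B'" "g' \<in> hom \<C> B' D"
  shows "g \<cdot> f \<cdot> k = g' \<cdot> f' \<cdot> k"
  using assms(1) comp_assoc[OF assms(2-4)] comp_assoc[OF assms(2,5,6)] by simp

lemma comp_rewrite1:
  assumes "g \<cdot> f = g'" "k \<in> hom \<C> Z A" "f \<in> hom \<C> A B" "g \<in> hom \<C> B D"
  shows "g \<cdot> f \<cdot> k = g' \<cdot> k"
  using assms(1) comp_assoc[OF assms(2-4)] by simp

end

locale strand_calculus = linear_monoidal_category \<C>
  for \<C> :: "('o, 'm::ab_group_add, 'r::comm_ring_1, 'z) ribbon_structure_scheme" (structure) +
  fixes X :: 'o
begin

text \<open>Nesting to the right makes \<open>pw (m + n)\<close> and \<open>pw m\<close> after
  \<open>pw n\<close> equal as objects, not merely isomorphic; all strictness below rests on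
  this.\<close>

primrec pw :: "nat \<Rightarrow> 'o \<Rightarrow> 'o" where
  "pw 0 Y = Y"
| "pw (Suc n) Y = X \<boxtimes> pw n Y"

primrec wk :: "nat \<Rightarrow> 'm \<Rightarrow> 'm" where
  "wk 0 f = f"
| "wk (Suc n) f = \<i>\<d> X \<otimes> wk n f"

lemma pw_add: "pw (m + n) Y = pw m (pw n Y)"
  by (induction m) auto

lemma wk_add: "wk (m + n) f = wk m (wk n f)"
  by (induction m) auto

lemma wk_in_hom: "f \<in> hom \<C> A B \<Longrightarrow> wk n f \<in> hom \<C> (pw n A) (pw n B)"
  by (induction n) (auto intro: hom_intros)

lemma wk_ident: "wk n (\<i>\<d> A) = \<i>\<d> (pw n A)"
  by (induction n) (auto simp: tens_ident)

lemma wk_comp: "f \<in> hom \<C> A B \<Longrightarrow> g \<in> hom \<C> B D \<Longrightarrow> wk n (g \<cdot> f) = wk n g \<cdot> wk n f"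
  by (induction n) (auto simp: whisker_comp(1)[OF wk_in_hom wk_in_hom])

lemma wk_plus: "f \<in> hom \<C> A B \<Longrightarrow> g \<in> hom \<C> A B \<Longrightarrow> wk n (f + g) = wk n f + wk n g"
  by (induction n) (auto simp: tens_add_right[OF ident_in_hom wk_in_hom wk_in_hom])

lemma wk_smul: "f \<in> hom \<C> A B \<Longrightarrow> wk n (r \<odot> f) = r \<odot> wk n f"
  by (induction n) (auto simp: tens_smul_right[OF ident_in_hom wk_in_hom])

primrec obj :: "shape \<Rightarrow> 'o" where
  "obj Unit = \<one>"
| "obj Strand = X"
| "obj (Join A B) = obj A \<boxtimes> obj B"

text \<open>Coherence is bypassed by letting an object act on all objects \<open>Y\<close> by tensoring from the left:
  composition of these actions is strictly associative and strictly unital.\<close>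

primrec flat :: "shape \<Rightarrow> 'o \<Rightarrow> 'm" where
  "flat Unit Y = lunit \<C> Y"
| "flat Strand Y = \<i>\<d> (X \<boxtimes> Y)"
| "flat (Join A B) Y = flat A (pw (width B) Y) \<cdot> (\<i>\<d> (obj A) \<otimes> flat B Y) \<cdot> assoc \<C> (obj A) (obj B) Y"

primrec unflat :: "shape \<Rightarrow> 'o \<Rightarrow> 'm" where
  "unflat Unit Y = lunit_inv \<C> Y"
| "unflat Strand Y = \<i>\<d> (X \<boxtimes> Y)"
| "unflat (Join A B) Y =
    (assoc_inv \<C> (obj A) (obj B) Y \<cdot> (\<i>\<d> (obj A) \<otimes> unflat B Y)) \<cdot> unflat A (pw (width B) Y)"

lemma flat_inverse: "is_inverse \<C> (obj A \<boxtimes> Y) (pw (width A) Y) (flat A Y) (unflat A Y)"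
proof (induction A arbitrary: Y)
  case (Join A B)
  show ?case unfolding flat.simps unflat.simps obj.simps width.simps pw_add
    by (rule is_inverse_comp is_inverse_tens Join assoc_inverse is_inverse_ident)+
qed (auto simp: lunit_inverse is_inverse_ident)

lemma flat_in_hom: "flat A Y \<in> hom \<C> (obj A \<boxtimes> Y) (pw (width A) Y)"
  "unflat A Y \<in> hom \<C> (pw (width A) Y) (obj A \<boxtimes> Y)"
  using flat_inverse[of A Y] by (auto simp: is_inverse_def)

lemmas ty = hom_intros flat_in_hom wk_in_hom

text \<open>Naturality in the argument is what later allows boxes standing side by side to be
  interchanged. For \<open>Join\<close> the morphism \<open>h\<close> passes the associator, then
  \<open>B\<close>, then \<open>A\<close>.\<close>

lemma flat_natural:
  "h \<in> hom \<C> Y Y' \<Longrightarrow> flat A Y' \<cdot> (\<i>\<d> (obj A) \<otimes> h) = wk (width A) h \<cdot> flat A Y"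
proof (induction A arbitrary: h Y Y')
  case Unit then show ?case by (simp add: lunit_natural)
next
  case Strand
  from tens_in_hom[OF ident_in_hom Strand, of X] show ?case by (simp add: ident_comp comp_ident)
next
  case (Join A B)
  note h = Join.prems
  let ?a = "assoc \<C> (obj A) (obj B)" and ?A = "\<i>\<d> (obj A)" and ?B = "\<i>\<d> (obj B)"
  let ?P = "pw (width B)"
  have "flat (Join A B) Y' \<cdot> (\<i>\<d> (obj (Join A B)) \<otimes> h)
      = (flat A (?P Y') \<cdot> (?A \<otimes> flat B Y') \<cdot> ?a Y') \<cdot> ((?A \<otimes> ?B) \<otimes> h)"
    by (simp add: tens_ident)
  also have "\<dots> = flat A (?P Y') \<cdot> ((?A \<otimes> flat B Y') \<cdot> ?a Y') \<cdot> ((?A \<otimes> ?B) \<otimes> h)"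
    by (rule comp_assoc) (rule h ty)+
  also have "((?A \<otimes> flat B Y') \<cdot> ?a Y') \<cdot> ((?A \<otimes> ?B) \<otimes> h)
      = (?A \<otimes> flat B Y') \<cdot> ?a Y' \<cdot> ((?A \<otimes> ?B) \<otimes> h)"
    by (rule comp_assoc) (rule h ty)+
  also have "?a Y' \<cdot> ((?A \<otimes> ?B) \<otimes> h) = (?A \<otimes> (?B \<otimes> h)) \<cdot> ?a Y"
    by (rule assoc_natural) (rule h ty)+
  also have "(?A \<otimes> flat B Y') \<cdot> (?A \<otimes> (?B \<otimes> h)) \<cdot> ?a Y
      = (?A \<otimes> wk (width B) h) \<cdot> (?A \<otimes> flat B Y) \<cdot> ?a Y"
  proof (rule comp_rewrite)
    have "(?A \<otimes> flat B Y') \<cdot> (?A \<otimes> (?B \<otimes> h)) = ?A \<otimes> (flat B Y' \<cdot> (?B \<otimes> h))"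
      by (rule whisker_comp(1)[symmetric]) (rule h ty)+
    also have "\<dots> = ?A \<otimes> (wk (width B) h \<cdot> flat B Y)" using Join.IH(2)[OF h] by simp
    also have "\<dots> = (?A \<otimes> wk (width B) h) \<cdot> (?A \<otimes> flat B Y)"
      by (rule whisker_comp) (rule h ty)+
    finally show "(?A \<otimes> flat B Y') \<cdot> (?A \<otimes> (?B \<otimes> h)) = \<dots>" .
  qed (rule h ty)+
  also have "flat A (?P Y') \<cdot> (?A \<otimes> wk (width B) h) \<cdot> (?A \<otimes> flat B Y) \<cdot> ?a Y
      = wk (width A) (wk (width B) h) \<cdot> flat A (?P Y) \<cdot> (?A \<otimes> flat B Y) \<cdot> ?a Y"
    by (rule comp_rewrite[OF Join.IH(1)]) (rule h ty)+
  finally show ?case by (simp add: wk_add)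
qed

text \<open>Conjugation by the flattenings turns \<open>f\<close> into a transformation between
  iterated tensor products with \<open>X\<close>.\<close>

definition act :: "shape \<Rightarrow> shape \<Rightarrow> 'm \<Rightarrow> 'o \<Rightarrow> 'm" where
  "act A B f Y = (flat B Y \<cdot> (f \<otimes> \<i>\<d> Y)) \<cdot> unflat A Y"

lemma act_in_hom: "f \<in> hom \<C> (obj A) (obj B) \<Longrightarrow> act A B f Y \<in> hom \<C> (pw (width A) Y) (pw (width B) Y)"
  unfolding act_def by (rule ty | assumption)+

lemma act_flat:
  "f \<in> hom \<C> (obj A) (obj B) \<Longrightarrow> act A B f Y \<cdot> flat A Y = flat B Y \<cdot> (f \<otimes> \<i>\<d> Y)"
  unfolding act_def by (rule is_inverse_cancel(3)[OF flat_inverse]) (rule ty | assumption)+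

text \<open>As \<open>flat A Y\<close> is invertible, the action is the only morphism intertwining
  the two flattenings; the following proofs verify just this equation.\<close>

lemma act_eqI:
  assumes "\<phi> \<in> hom \<C> (pw (width A) Y) (pw (width B) Y)" "\<phi> \<cdot> flat A Y = flat B Y \<cdot> (f \<otimes> \<i>\<d> Y)"
  shows "act A B f Y = \<phi>"
  unfolding act_def assms(2)[symmetric] by (rule is_inverse_cancel(4)[OF flat_inverse assms(1)])

lemma act_eq_identI:
  assumes "width A = width B" "flat A Y = flat B Y \<cdot> (f \<otimes> \<i>\<d> Y)"
  shows "act A B f Y = \<i>\<d> (pw (width A) Y)"
proof (rule act_eqI)
  show "\<i>\<d> (pw (width A) Y) \<in> hom \<C> (pw (width A) Y) (pw (width B) Y)"
    unfolding assms(1) by (rule ty)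
  show "\<i>\<d> (pw (width A) Y) \<cdot> flat A Y = flat B Y \<cdot> (f \<otimes> \<i>\<d> Y)"
    unfolding assms(2)[symmetric] by (rule ident_comp[OF flat_in_hom(1)])
qed

text \<open>It suffices to act on the unit object: the right unitor is natural and invertible, so
  tensoring with the unit on the right loses nothing.\<close>

lemma act_faithful:
  assumes f: "f \<in> hom \<C> (obj A) (obj B)" and g: "g \<in> hom \<C> (obj A) (obj B)"
    and eq: "act A B f \<one> = act A B g \<one>"
  shows "f = g"
proof -
  have "flat B \<one> \<cdot> (f \<otimes> \<i>\<d> \<one>) = flat B \<one> \<cdot> (g \<otimes> \<i>\<d> \<one>)"
    using act_flat[OF f, of \<one>] act_flat[OF g, of \<one>] eq by simp
  then have "f \<otimes> \<i>\<d> \<one> = g \<otimes> \<i>\<d> \<one>"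
    using is_inverse_cancel(1)[OF flat_inverse[of B \<one>] tens_in_hom[OF f ident_in_hom]]
      is_inverse_cancel(1)[OF flat_inverse[of B \<one>] tens_in_hom[OF g ident_in_hom]] by metis
  then have "f \<cdot> runit \<C> (obj A) = g \<cdot> runit \<C> (obj A)"
    using runit_natural[OF f] runit_natural[OF g] by simp
  then show ?thesis
    using is_inverse_cancel(4)[OF runit_inverse f] is_inverse_cancel(4)[OF runit_inverse g] by metis
qed

lemma act_ident: "act A A (\<i>\<d> (obj A)) Y = \<i>\<d> (pw (width A) Y)"
  by (rule act_eq_identI) (simp_all add: tens_ident comp_ident[OF flat_in_hom(1)])

lemma act_comp:
  assumes f: "f \<in> hom \<C> (obj A) (obj B)" and g: "g \<in> hom \<C> (obj B) (obj D)"
  shows "act A D (g \<cdot> f) Y = act B D g Y \<cdot> act A B f Y"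
proof (rule act_eqI)
  show "act B D g Y \<cdot> act A B f Y \<in> hom \<C> (pw (width A) Y) (pw (width D) Y)"
    by (rule ty act_in_hom f g)+
  have "(act B D g Y \<cdot> act A B f Y) \<cdot> flat A Y = act B D g Y \<cdot> act A B f Y \<cdot> flat A Y"
    by (rule comp_assoc) (rule ty act_in_hom f g)+
  also have "\<dots> = act B D g Y \<cdot> flat B Y \<cdot> (f \<otimes> \<i>\<d> Y)" by (simp add: act_flat[OF f])
  also have "\<dots> = flat D Y \<cdot> (g \<otimes> \<i>\<d> Y) \<cdot> (f \<otimes> \<i>\<d> Y)"
    by (rule comp_rewrite[OF act_flat]) (rule ty act_in_hom f g)+
  also have "(g \<otimes> \<i>\<d> Y) \<cdot> (f \<otimes> \<i>\<d> Y) = (g \<cdot> f) \<otimes> \<i>\<d> Y"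
    by (rule whisker_comp(2)[symmetric, OF f g])
  finally show "(act B D g Y \<cdot> act A B f Y) \<cdot> flat A Y = flat D Y \<cdot> ((g \<cdot> f) \<otimes> \<i>\<d> Y)" .
qed

text \<open>This is the interchange law: what happens in \<open>Y\<close> takes place to the right
  of \<open>f\<close>.\<close>

lemma act_natural:
  assumes f: "f \<in> hom \<C> (obj A) (obj B)" and h: "h \<in> hom \<C> Y Y'"
  shows "act A B f Y' \<cdot> wk (width A) h = wk (width B) h \<cdot> act A B f Y"
proof -
  note t = f h ty act_in_hom
  let ?Aw = "wk (width A) h" and ?Bw = "wk (width B) h"
  have "(act A B f Y' \<cdot> ?Aw) \<cdot> flat A Y = act A B f Y' \<cdot> ?Aw \<cdot> flat A Y"
    by (rule comp_assoc) (rule t)+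
  also have "\<dots> = act A B f Y' \<cdot> flat A Y' \<cdot> (\<i>\<d> (obj A) \<otimes> h)" by (simp add: flat_natural[OF h])
  also have "\<dots> = flat B Y' \<cdot> (f \<otimes> \<i>\<d> Y') \<cdot> (\<i>\<d> (obj A) \<otimes> h)"
    by (rule comp_rewrite[OF act_flat]) (rule t)+
  also have "(f \<otimes> \<i>\<d> Y') \<cdot> (\<i>\<d> (obj A) \<otimes> h) = (\<i>\<d> (obj B) \<otimes> h) \<cdot> (f \<otimes> \<i>\<d> Y)"
    using tens_split[OF f h] by simp
  also have "flat B Y' \<cdot> \<dots> = ?Bw \<cdot> flat B Y \<cdot> (f \<otimes> \<i>\<d> Y)"
    by (rule comp_rewrite[OF flat_natural]) (rule t)+
  also have "\<dots> = ?Bw \<cdot> act A B f Y \<cdot> flat A Y" by (simp add: act_flat[OF f])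
  also have "\<dots> = (?Bw \<cdot> act A B f Y) \<cdot> flat A Y"
    by (rule comp_assoc[symmetric]) (rule t)+
  finally have eq: "(act A B f Y' \<cdot> ?Aw) \<cdot> flat A Y = (?Bw \<cdot> act A B f Y) \<cdot> flat A Y" .
  have "act A B f Y' \<cdot> ?Aw \<in> hom \<C> (pw (width A) Y) (pw (width B) Y')"
    "?Bw \<cdot> act A B f Y \<in> hom \<C> (pw (width A) Y) (pw (width B) Y')"
    by (rule t)+
  with eq is_inverse_cancel(4)[OF flat_inverse[of A Y]] show ?thesis by metis
qed

text \<open>Of two boxes side by side the right one is placed below, so that a tensor product
  becomes a composite of two whiskered actions.\<close>

lemma act_tens:
  assumes f: "f \<in> hom \<C> (obj A) (obj A')" and g: "g \<in> hom \<C> (obj B) (obj B')"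
  shows "act (Join A B) (Join A' B') (f \<otimes> g) Y
    = act A A' f (pw (width B') Y) \<cdot> wk (width A) (act B B' g Y)"
proof (rule act_eqI)
  note t = f g ty act_in_hom
  let ?P = "pw (width B) Y" and ?P' = "pw (width B') Y" and ?g = "act B B' g Y"
  let ?a = "assoc \<C> (obj A) (obj B) Y" and ?a' = "assoc \<C> (obj A') (obj B') Y"
  let ?A = "\<i>\<d> (obj A)" and ?A' = "\<i>\<d> (obj A')"
  show "act A A' f ?P' \<cdot> wk (width A) ?g \<in> hom \<C> (pw (width (Join A B)) Y) (pw (width (Join A' B')) Y)"
    unfolding width.simps pw_add by (rule t)+
  have "(act A A' f ?P' \<cdot> wk (width A) ?g) \<cdot> flat (Join A B) Y
      = act A A' f ?P' \<cdot> wk (width A) ?g \<cdot> flat (Join A B) Y"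
    unfolding flat.simps by (rule comp_assoc) (rule t)+
  also have "wk (width A) ?g \<cdot> flat (Join A B) Y = flat A ?P' \<cdot> (?A \<otimes> ?g) \<cdot> (?A \<otimes> flat B Y) \<cdot> ?a"
    unfolding flat.simps by (rule comp_rewrite[OF flat_natural[symmetric]]) (rule t)+
  also have "(?A \<otimes> ?g) \<cdot> (?A \<otimes> flat B Y) \<cdot> ?a
      = (?A \<otimes> flat B' Y) \<cdot> (?A \<otimes> (g \<otimes> \<i>\<d> Y)) \<cdot> ?a"
  proof (rule comp_rewrite)
    show "(?A \<otimes> ?g) \<cdot> (?A \<otimes> flat B Y) = (?A \<otimes> flat B' Y) \<cdot> (?A \<otimes> (g \<otimes> \<i>\<d> Y))"
      using whisker_comp(1)[OF flat_in_hom(1) act_in_hom[OF g], of "obj A" Y]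
        whisker_comp(1)[OF tens_in_hom[OF g ident_in_hom] flat_in_hom(1), of "obj A" Y]
      by (simp add: act_flat[OF g])
  qed (rule t)+
  also have "act A A' f ?P' \<cdot> flat A ?P' \<cdot> (?A \<otimes> flat B' Y) \<cdot> (?A \<otimes> (g \<otimes> \<i>\<d> Y)) \<cdot> ?a
      = flat A' ?P' \<cdot> (f \<otimes> \<i>\<d> ?P') \<cdot> (?A \<otimes> flat B' Y) \<cdot> (?A \<otimes> (g \<otimes> \<i>\<d> Y)) \<cdot> ?a"
    by (rule comp_rewrite[OF act_flat]) (rule t)+
  also have "(f \<otimes> \<i>\<d> ?P') \<cdot> (?A \<otimes> flat B' Y) \<cdot> (?A \<otimes> (g \<otimes> \<i>\<d> Y)) \<cdot> ?a
      = (?A' \<otimes> flat B' Y) \<cdot> (f \<otimes> \<i>\<d> (obj B' \<boxtimes> Y)) \<cdot> (?A \<otimes> (g \<otimes> \<i>\<d> Y)) \<cdot> ?a"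
  proof (rule comp_rewrite)
    show "(f \<otimes> \<i>\<d> ?P') \<cdot> (?A \<otimes> flat B' Y) = (?A' \<otimes> flat B' Y) \<cdot> (f \<otimes> \<i>\<d> (obj B' \<boxtimes> Y))"
      using tens_split[OF f flat_in_hom(1)[of B' Y]] by simp
  qed (rule t)+
  also have "(f \<otimes> \<i>\<d> (obj B' \<boxtimes> Y)) \<cdot> (?A \<otimes> (g \<otimes> \<i>\<d> Y)) \<cdot> ?a = (f \<otimes> (g \<otimes> \<i>\<d> Y)) \<cdot> ?a"
  proof (rule comp_rewrite1)
    show "(f \<otimes> \<i>\<d> (obj B' \<boxtimes> Y)) \<cdot> (?A \<otimes> (g \<otimes> \<i>\<d> Y)) = f \<otimes> (g \<otimes> \<i>\<d> Y)"
      by (rule tens_split(1)[symmetric, OF f]) (rule t)+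
  qed (rule t)+
  also have "(f \<otimes> (g \<otimes> \<i>\<d> Y)) \<cdot> ?a = ?a' \<cdot> ((f \<otimes> g) \<otimes> \<i>\<d> Y)"
    by (rule assoc_natural[symmetric]) (rule t)+
  also have "(?A' \<otimes> flat B' Y) \<cdot> \<dots> = ((?A' \<otimes> flat B' Y) \<cdot> ?a') \<cdot> ((f \<otimes> g) \<otimes> \<i>\<d> Y)"
    by (rule comp_assoc[symmetric]) (rule t)+
  also have "flat A' ?P' \<cdot> \<dots> = flat (Join A' B') Y \<cdot> ((f \<otimes> g) \<otimes> \<i>\<d> Y)"
    unfolding flat.simps by (rule comp_assoc[symmetric]) (rule t)+
  finally show "(act A A' f ?P' \<cdot> wk (width A) ?g) \<cdot> flat (Join A B) Y
    = flat (Join A' B') Y \<cdot> ((f \<otimes> g) \<otimes> \<i>\<d> Y)" .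
qed

text \<open>Comparing the two flattenings of a triple product comes down to the pentagon, after the
  inner flattenings are moved out of the way by naturality.\<close>

lemma act_assoc: "act (Join (Join A B) D) (Join A (Join B D)) (assoc \<C> (obj A) (obj B) (obj D)) Y
  = \<i>\<d> (pw (width A + width B + width D) Y)"
proof -
  let ?A = "\<i>\<d> (obj A)" and ?B = "\<i>\<d> (obj B)" and ?D = "pw (width D) Y"
  let ?a = "assoc \<C>" and ?f = "flat A (pw (width B) ?D)"
  have "flat (Join A (Join B D)) Y \<cdot> (?a (obj A) (obj B) (obj D) \<otimes> \<i>\<d> Y)
    = ?f \<cdot> ((?A \<otimes> flat (Join B D) Y) \<cdot> ?a (obj A) (obj B \<boxtimes> obj D) Y) \<cdot> (?a (obj A) (obj B) (obj D) \<otimes> \<i>\<d> Y)"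
    unfolding flat.simps obj.simps width.simps pw_add by (rule comp_assoc) (rule ty)+
  also have "((?A \<otimes> flat (Join B D) Y) \<cdot> ?a (obj A) (obj B \<boxtimes> obj D) Y) \<cdot> (?a (obj A) (obj B) (obj D) \<otimes> \<i>\<d> Y)
     = (?A \<otimes> flat (Join B D) Y) \<cdot> ?a (obj A) (obj B \<boxtimes> obj D) Y \<cdot> (?a (obj A) (obj B) (obj D) \<otimes> \<i>\<d> Y)"
    unfolding flat.simps by (rule comp_assoc) (rule ty)+
  also have "?A \<otimes> flat (Join B D) Y
    = (?A \<otimes> (flat B ?D \<cdot> (?B \<otimes> flat D Y))) \<cdot> (?A \<otimes> ?a (obj B) (obj D) Y)" 
  proof -
    have "flat (Join B D) Y = (flat B ?D \<cdot> (?B \<otimes> flat D Y)) \<cdot> ?a (obj B) (obj D) Y"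
      unfolding flat.simps by (rule comp_assoc[symmetric]) (rule ty)+
    then show ?thesis by (simp only:) (rule whisker_comp, (rule ty)+)
  qed
  also have "\<dots> \<cdot> ?a (obj A) (obj B \<boxtimes> obj D) Y \<cdot> (?a (obj A) (obj B) (obj D) \<otimes> \<i>\<d> Y)
    = (?A \<otimes> (flat B ?D \<cdot> (?B \<otimes> flat D Y))) \<cdot> (?A \<otimes> ?a (obj B) (obj D) Y)
      \<cdot> ?a (obj A) (obj B \<boxtimes> obj D) Y \<cdot> (?a (obj A) (obj B) (obj D) \<otimes> \<i>\<d> Y)"
    by (rule comp_assoc) (rule ty)+
  also have "(?A \<otimes> ?a (obj B) (obj D) Y)
      \<cdot> ?a (obj A) (obj B \<boxtimes> obj D) Y \<cdot> (?a (obj A) (obj B) (obj D) \<otimes> \<i>\<d> Y)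
    = ?a (obj A) (obj B) (obj D \<boxtimes> Y) \<cdot> ?a (obj A \<boxtimes> obj B) (obj D) Y"
    by (rule pentagon[symmetric])
  also have "?A \<otimes> (flat B ?D \<cdot> (?B \<otimes> flat D Y)) = (?A \<otimes> flat B ?D) \<cdot> (?A \<otimes> (?B \<otimes> flat D Y))"
    by (rule whisker_comp) (rule ty)+
  also have "\<dots> \<cdot> ?a (obj A) (obj B) (obj D \<boxtimes> Y) \<cdot> ?a (obj A \<boxtimes> obj B) (obj D) Y
    = (?A \<otimes> flat B ?D) \<cdot> (?A \<otimes> (?B \<otimes> flat D Y)) \<cdot> ?a (obj A) (obj B) (obj D \<boxtimes> Y)
      \<cdot> ?a (obj A \<boxtimes> obj B) (obj D) Y"
    by (rule comp_assoc) (rule ty)+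
  also have "(?A \<otimes> (?B \<otimes> flat D Y)) \<cdot> ?a (obj A) (obj B) (obj D \<boxtimes> Y) \<cdot> ?a (obj A \<boxtimes> obj B) (obj D) Y
    = ?a (obj A) (obj B) ?D \<cdot> ((?A \<otimes> ?B) \<otimes> flat D Y) \<cdot> ?a (obj A \<boxtimes> obj B) (obj D) Y"
    by (rule comp_rewrite[OF assoc_natural[symmetric]]) (rule ty)+
  also have "(?A \<otimes> flat B ?D) \<cdot> \<dots>
    = ((?A \<otimes> flat B ?D) \<cdot> ?a (obj A) (obj B) ?D) \<cdot> ((?A \<otimes> ?B) \<otimes> flat D Y) \<cdot> ?a (obj A \<boxtimes> obj B) (obj D) Y"
    by (rule comp_assoc[symmetric]) (rule ty)+
  also have "?f \<cdot> \<dots> = (?f \<cdot> (?A \<otimes> flat B ?D) \<cdot> ?a (obj A) (obj B) ?D)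
     \<cdot> ((?A \<otimes> ?B) \<otimes> flat D Y) \<cdot> ?a (obj A \<boxtimes> obj B) (obj D) Y"
    by (rule comp_assoc[symmetric]) (rule ty)+
  also have "\<dots> = flat (Join (Join A B) D) Y" by (simp add: tens_ident)
  finally show ?thesis by (subst act_eq_identI) (simp_all add: add.assoc)
qed

text \<open>Naturality of the left unitor leaves exactly the identity supplied by
  \<open>lunit_tens\<close>.\<close>

lemma act_lunit: "act (Join Unit A) A (lunit \<C> (obj A)) Y = \<i>\<d> (pw (width A) Y)"
proof -
  have "flat (Join Unit A) Y = lunit \<C> (pw (width A) Y) \<cdot> (\<i>\<d> \<one> \<otimes> flat A Y) \<cdot> assoc \<C> \<one> (obj A) Y"
    by simp
  also have "\<dots> = flat A Y \<cdot> lunit \<C> (obj A \<boxtimes> Y) \<cdot> assoc \<C> \<one> (obj A) Y"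
    by (rule comp_rewrite[OF lunit_natural]) (rule ty)+
  finally have "flat (Join Unit A) Y = flat A Y \<cdot> (lunit \<C> (obj A) \<otimes> \<i>\<d> Y)"
    by (simp add: lunit_tens)
  then show ?thesis by (subst act_eq_identI) simp_all
qed

lemma act_runit: "act (Join A Unit) A (runit \<C> (obj A)) Y = \<i>\<d> (pw (width A) Y)"
  by (subst act_eq_identI) (simp_all add: triangle)

lemma act_inverse_eq_ident:
  assumes i: "is_inverse \<C> (obj A) (obj B) f g" and f: "act A B f Y = \<i>\<d> (pw (width A) Y)"
    and w: "width A = width B"
  shows "act B A g Y = \<i>\<d> (pw (width B) Y)"
proof -
  have t: "f \<in> hom \<C> (obj A) (obj B)" "g \<in> hom \<C> (obj B) (obj A)" "f \<cdot> g = \<i>\<d> (obj B)"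
    using i by (auto simp: is_inverse_def)
  have "act A B f Y \<cdot> act B A g Y = \<i>\<d> (pw (width B) Y)"
    using act_comp[OF t(2,1), of Y] by (simp add: t(3) act_ident)
  then show ?thesis using ident_comp[OF act_in_hom[OF t(2)], of Y] by (simp add: f)
qed

lemma act_add: "f \<in> hom \<C> (obj A) (obj B) \<Longrightarrow> g \<in> hom \<C> (obj A) (obj B) \<Longrightarrow>
    act A B (f + g) Y = act A B f Y + act A B g Y"
  unfolding act_def
  by (subst tens_add_left[OF _ _ ident_in_hom], assumption+,
      subst comp_add_right[OF _ _ flat_in_hom(1)], (rule ty | assumption)+,
      subst comp_add_left[OF flat_in_hom(2)], (rule ty refl | assumption)+)

lemma act_smul: "f \<in> hom \<C> (obj A) (obj B) \<Longrightarrow> act A B (r \<odot> f) Y = r \<odot> act A B f Y"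
  unfolding act_def
  by (subst tens_smul_left[OF _ ident_in_hom], assumption+,
      subst comp_smul_right[OF _ flat_in_hom(1)], (rule ty | assumption)+,
      subst comp_smul_left[OF flat_in_hom(2)], (rule ty refl | assumption)+)

text \<open>Think of \<open>h \<in> vec Z k\<close> as a diagram with \<open>k\<close> upper ends; \<open>layer A B f n j h\<close> puts \<open>f\<close> on top of
  it, with \<open>n\<close> strands to the left and \<open>j\<close> strands to the right of \<open>f\<close>.\<close>

definition vec :: "'o \<Rightarrow> nat \<Rightarrow> 'm set" where
  "vec Z k = hom \<C> Z (pw k \<one>)"

definition layer :: "shape \<Rightarrow> shape \<Rightarrow> 'm \<Rightarrow> nat \<Rightarrow> nat \<Rightarrow> 'm \<Rightarrow> 'm" where
  "layer A B f n j h = wk n (act A B f (pw j \<one>)) \<cdot> h"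

lemma wk_act_in_hom:
  assumes "f \<in> hom \<C> (obj A) (obj B)"
  shows "wk n (act A B f (pw j \<one>)) \<in> hom \<C> (pw (n + width A + j) \<one>) (pw (n + width B + j) \<one>)"
  using wk_in_hom[OF act_in_hom[OF assms], of n "pw j \<one>"] by (simp add: pw_add)

lemma layer_in_vec:
  assumes "f \<in> hom \<C> (obj A) (obj B)" "h \<in> vec Z k" "k = n + width A + j" "k' = n + width B + j"
  shows "layer A B f n j h \<in> vec Z k'"
  using comp_in_hom[OF _ wk_act_in_hom[OF assms(1)]] assms(2-) by (auto simp: layer_def vec_def)

lemma layer_comp:
  assumes "f \<in> hom \<C> (obj A) (obj B)" "g \<in> hom \<C> (obj B) (obj D)" "h \<in> vec Z k" "k = n + width A + j"
  shows "layer A D (g \<cdot> f) n j h = layer B D g n j (layer A B f n j h)"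
proof -
  have "wk n (act A D (g \<cdot> f) (pw j \<one>)) = wk n (act B D g (pw j \<one>)) \<cdot> wk n (act A B f (pw j \<one>))"
    unfolding act_comp[OF assms(1,2)] by (rule wk_comp) (rule act_in_hom assms)+
  then show ?thesis
    using comp_assoc[OF _ wk_act_in_hom[OF assms(1)] wk_act_in_hom[OF assms(2)]] assms(3,4)
    by (simp add: layer_def vec_def)
qed

lemma layer_comp3:
  assumes "f1 \<in> hom \<C> (obj A1) (obj A2)" "f2 \<in> hom \<C> (obj A2) (obj A3)" "f3 \<in> hom \<C> (obj A3) (obj A4)"
    "h \<in> vec Z k" "k = n + width A1 + j"
  shows "layer A1 A4 (f3 \<cdot> f2 \<cdot> f1) n j h
    = layer A3 A4 f3 n j (layer A2 A3 f2 n j (layer A1 A2 f1 n j h))"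
  using layer_comp[OF comp_in_hom[OF assms(1,2)] assms(3-5)] layer_comp[OF assms(1,2,4,5)] by simp

lemma layer_comp4:
  assumes "f1 \<in> hom \<C> (obj A1) (obj A2)" "f2 \<in> hom \<C> (obj A2) (obj A3)" "f3 \<in> hom \<C> (obj A3) (obj A4)"
    "f4 \<in> hom \<C> (obj A4) (obj A5)" "h \<in> vec Z k" "k = n + width A1 + j"
  shows "layer A1 A5 (f4 \<cdot> f3 \<cdot> f2 \<cdot> f1) n j h
    = layer A4 A5 f4 n j (layer A3 A4 f3 n j (layer A2 A3 f2 n j (layer A1 A2 f1 n j h)))"
  using layer_comp[OF comp_in_hom[OF comp_in_hom[OF assms(1,2)] assms(3)] assms(4-6)]
    layer_comp3[OF assms(1-3,5,6)] by simp

lemma layer_comp5: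
  assumes "f1 \<in> hom \<C> (obj A1) (obj A2)" "f2 \<in> hom \<C> (obj A2) (obj A3)" "f3 \<in> hom \<C> (obj A3) (obj A4)"
    "f4 \<in> hom \<C> (obj A4) (obj A5)" "f5 \<in> hom \<C> (obj A5) (obj A6)" "h \<in> vec Z k" "k = n + width A1 + j"
  shows "layer A1 A6 (f5 \<cdot> f4 \<cdot> f3 \<cdot> f2 \<cdot> f1) n j h
    = layer A5 A6 f5 n j (layer A4 A5 f4 n j (layer A3 A4 f3 n j (layer A2 A3 f2 n j (layer A1 A2 f1 n j h))))"
  using layer_comp[OF comp_in_hom[OF comp_in_hom[OF comp_in_hom[OF assms(1,2)] assms(3)] assms(4)] assms(5-7)]
    layer_comp4[OF assms(1-4,6,7)] by simp

lemma layer_trivial: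
  assumes "\<And>Y. act A B f Y = \<i>\<d> (pw (width A) Y)" "h \<in> vec Z k" "k = n + width A + j"
  shows "layer A B f n j h = h"
  using assms(2,3) by (simp add: layer_def vec_def assms(1) wk_ident pw_add ident_comp)

lemma layer_ident:
  "h \<in> vec Z k \<Longrightarrow> k = n + width A + j \<Longrightarrow> layer A A (\<i>\<d> (obj A)) n j h = h"
  by (rule layer_trivial) (rule act_ident)

lemma layer_tens:
  assumes f: "f \<in> hom \<C> (obj A) (obj A')" and g: "g \<in> hom \<C> (obj B) (obj B')"
    and h: "h \<in> vec Z k" and k: "k = n + width A + width B + j"
  shows "layer (Join A B) (Join A' B') (f \<otimes> g) n j h
    = layer A A' f n (width B' + j) (layer B B' g (n + width A) j h)"
proof -
  have "wk n (act (Join A B) (Join A' B') (f \<otimes> g) (pw j \<one>))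
    = wk n (act A A' f (pw (width B' + j) \<one>)) \<cdot> wk (n + width A) (act B B' g (pw j \<one>))"
    unfolding act_tens[OF f g] wk_add pw_add by (rule wk_comp) (rule wk_in_hom act_in_hom f g)+
  moreover have "wk n (act A A' f (pw (width B' + j) \<one>))
      \<in> hom \<C> (pw (n + width A + width B' + j) \<one>) (pw (n + width A' + (width B' + j)) \<one>)"
    using wk_act_in_hom[OF f, of n "width B' + j"] by (simp add: add.assoc)
  ultimately show ?thesis
    using comp_assoc[OF _ wk_act_in_hom[OF g, of "n + width A" j]] h k
    by (simp add: layer_def vec_def)
qed

text \<open>The boxes \<open>f\<close> and \<open>g\<close> are separated by \<open>p\<close>
  strands, so one of them acts inside the argument of the other and \<open>act_natural\<close>
  applies. The positions are linked by equations between sums rather than by subtraction; in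
  concrete instances they follow by simplification.\<close>

lemma layer_commute:
  assumes f: "f \<in> hom \<C> (obj A) (obj B)" and g: "g \<in> hom \<C> (obj D) (obj E)" and h: "h \<in> vec Z k"
    and "n + width A \<le> m" "k = m + width D + q" "i + n + width A = m + width E + q"
    "m' + width A = m + width B" "i' + n + width A = k"
  shows "layer A B f n i (layer D E g m q h) = layer D E g m' q (layer A B f n i' h)"
proof -
  obtain p where m: "m = n + width A + p" using assms(4) le_Suc_ex by blast
  have e: "m' = n + width B + p" "i = p + width E + q" "i' = p + width D + q"
    "k = n + width A + (p + width D + q)"
    using assms(5-8) by (simp_all add: m)
  let ?g = "wk p (act D E g (pw q \<one>))"
  note g' = wk_act_in_hom[OF g, of p q]
  have "wk n (act A B f (pw i \<one>)) \<cdot> wk m (act D E g (pw q \<one>))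
    = wk n (act A B f (pw i \<one>) \<cdot> wk (width A) ?g)"
    unfolding m wk_add e by (rule wk_comp[symmetric]) (rule wk_in_hom g' act_in_hom f)+
  also have "\<dots> = wk n (wk (width B) ?g \<cdot> act A B f (pw i' \<one>))"
    unfolding e by (simp add: act_natural[OF f g'])
  also have "\<dots> = wk m' (act D E g (pw q \<one>)) \<cdot> wk n (act A B f (pw i' \<one>))"
    unfolding e wk_add by (rule wk_comp) (rule wk_in_hom g' act_in_hom f)+
  finally have eq: "wk n (act A B f (pw i \<one>)) \<cdot> wk m (act D E g (pw q \<one>))
    = wk m' (act D E g (pw q \<one>)) \<cdot> wk n (act A B f (pw i' \<one>))" .
  have "h \<in> hom \<C> Z (pw (m + width D + q) \<one>)" using h by (simp add: vec_def assms(5))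
  from comp_rewrite[OF eq this wk_act_in_hom[OF g] _]
  show ?thesis unfolding layer_def
    using wk_act_in_hom[OF f, of n i] wk_act_in_hom[OF f, of n i'] wk_act_in_hom[OF g, of m' q]
    by (auto simp: e m add_ac)
qed

lemma layer_add:
  assumes "f \<in> hom \<C> (obj A) (obj B)" "g \<in> hom \<C> (obj A) (obj B)" "h \<in> vec Z k" "k = n + width A + j"
  shows "layer A B (f + g) n j h = layer A B f n j h + layer A B g n j h"
  using comp_add_left[OF _ wk_act_in_hom[OF assms(1)] wk_act_in_hom[OF assms(2)]] assms(3,4)
  by (simp add: layer_def vec_def act_add[OF assms(1,2)]
      wk_plus[OF act_in_hom[OF assms(1)] act_in_hom[OF assms(2)]])

lemma layer_smul:
  assumes "f \<in> hom \<C> (obj A) (obj B)" "h \<in> vec Z k" "k = n + width A + j"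
  shows "layer A B (r \<odot> f) n j h = r \<odot> layer A B f n j h"
  using comp_smul_left[OF _ wk_act_in_hom[OF assms(1)]] assms(2,3)
  by (simp add: layer_def vec_def act_smul[OF assms(1)] wk_smul[OF act_in_hom[OF assms(1)]])

lemma layer_add_vec:
  assumes "f \<in> hom \<C> (obj A) (obj B)" "h \<in> vec Z k" "h' \<in> vec Z k" "k = n + width A + j"
  shows "layer A B f n j (h + h') = layer A B f n j h + layer A B f n j h'"
  using comp_add_right[OF _ _ wk_act_in_hom[OF assms(1)]] assms(2-)
  by (simp add: layer_def vec_def)

lemma layer_smul_vec:
  assumes "f \<in> hom \<C> (obj A) (obj B)" "h \<in> vec Z k" "k = n + width A + j"
  shows "layer A B f n j (r \<odot> h) = r \<odot> layer A B f n j h"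
  using comp_smul_right[OF _ wk_act_in_hom[OF assms(1)]] assms(2-)
  by (simp add: layer_def vec_def)

text \<open>A Yoneda argument: the identity of the source is among the test diagrams
  \<open>h\<close>.\<close>

lemma layer_faithful:
  assumes f: "f \<in> hom \<C> (obj A) (obj B)" and g: "g \<in> hom \<C> (obj A) (obj B)"
    and eq: "\<And>Z h. h \<in> vec Z (width A) \<Longrightarrow> layer A B f 0 0 h = layer A B g 0 0 h"
  shows "f = g"
proof (rule act_faithful[OF f g])
  show "act A B f \<one> = act A B g \<one>"
    using eq[of "\<i>\<d> (pw (width A) \<one>)" "pw (width A) \<one>"]
    by (simp add: layer_def vec_def ident_in_hom comp_ident[OF act_in_hom] f g)
qed

lemma layer_assoc:
  assumes "h \<in> vec Z k" "k = n + width A + width B + width D + j"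
  shows "layer (Join (Join A B) D) (Join A (Join B D)) (assoc \<C> (obj A) (obj B) (obj D)) n j h = h"
    "layer (Join A (Join B D)) (Join (Join A B) D) (assoc_inv \<C> (obj A) (obj B) (obj D)) n j h = h"
proof -
  have "act (Join A (Join B D)) (Join (Join A B) D) (assoc_inv \<C> (obj A) (obj B) (obj D)) Y
    = \<i>\<d> (pw (width (Join A (Join B D))) Y)" for Y
    by (rule act_inverse_eq_ident[where f = "assoc \<C> (obj A) (obj B) (obj D)"])
      (simp_all add: assoc_inverse act_assoc add.assoc)
  then show "layer (Join A (Join B D)) (Join (Join A B) D) (assoc_inv \<C> (obj A) (obj B) (obj D)) n j h = h"
    by (rule layer_trivial) (use assms in \<open>simp_all add: add.assoc\<close>)
  show "layer (Join (Join A B) D) (Join A (Join B D)) (assoc \<C> (obj A) (obj B) (obj D)) n j h = h"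
    by (rule layer_trivial) (use assms in \<open>simp_all add: act_assoc add.assoc\<close>)
qed

lemma layer_unit:
  assumes "h \<in> vec Z k" "k = n + width A + j"
  shows "layer (Join Unit A) A (lunit \<C> (obj A)) n j h = h"
    "layer A (Join Unit A) (lunit_inv \<C> (obj A)) n j h = h"
    "layer (Join A Unit) A (runit \<C> (obj A)) n j h = h"
    "layer A (Join A Unit) (runit_inv \<C> (obj A)) n j h = h"
proof -
  have 1: "act A (Join Unit A) (lunit_inv \<C> (obj A)) Y = \<i>\<d> (pw (width A) Y)" for Y
    using act_inverse_eq_ident[of "Join Unit A" A "lunit \<C> (obj A)" "lunit_inv \<C> (obj A)"]
    by (simp add: lunit_inverse act_lunit)
  have 2: "act A (Join A Unit) (runit_inv \<C> (obj A)) Y = \<i>\<d> (pw (width A) Y)" for Y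
    using act_inverse_eq_ident[of "Join A Unit" A "runit \<C> (obj A)" "runit_inv \<C> (obj A)"]
    by (simp add: runit_inverse act_runit)
  show "layer (Join Unit A) A (lunit \<C> (obj A)) n j h = h"
    "layer A (Join Unit A) (lunit_inv \<C> (obj A)) n j h = h"
    "layer (Join A Unit) A (runit \<C> (obj A)) n j h = h"
    "layer A (Join A Unit) (runit_inv \<C> (obj A)) n j h = h"
    by (rule layer_trivial[OF _ assms(1)], use assms(2) in \<open>simp_all add: act_lunit act_runit 1 2\<close>)+
qed

end

section \<open>Diagrams as layers\<close>

sublocale trivalent_ribbon_category \<subseteq> strand_calculus \<C> "strand \<C>" ..

context trivalent_ribbon_category begin

abbreviation "SS \<equiv> Join Strand Strand"
abbreviation "cup \<equiv> layer Unit SS (coev \<C>)"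
abbreviation "cap \<equiv> layer SS Unit (ev \<C>)"
abbreviation "vtx \<equiv> layer (Join SS Strand) Unit (vertex \<C>)"
abbreviation "mrg \<equiv> layer SS Strand (merge \<C>)"
abbreviation "frk \<equiv> layer Strand SS (fork \<C>)"
abbreviation "rung \<equiv> layer SS SS (dgm_H \<C>)"
abbreviation "pos \<equiv> layer SS SS (pos_crossing \<C>)"
abbreviation "neg \<equiv> layer SS SS (neg_crossing \<C>)"

lemma ev_in_hom: "ev \<C> \<in> hom \<C> (strand \<C> \<boxtimes> strand \<C>) \<one>"
  and coev_in_hom: "coev \<C> \<in> hom \<C> \<one> (strand \<C> \<boxtimes> strand \<C>)"
  using self_dual by (auto simp: dual_pair_def)

lemma vertex_in_hom: "vertex \<C> \<in> hom \<C> (strand \<C> \<boxtimes> strand \<C> \<boxtimes> strand \<C>) \<one>"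
  using box_3(2) span_base[of "vertex \<C>" "{vertex \<C>}"] by (simp add: box_def numeral_3_eq_3)

lemma braid_inverse: "is_inverse \<C> (A \<boxtimes> B) (B \<boxtimes> A) (braid \<C> A B) (braid_inv \<C> A B)"
  unfolding braid_inv_def by (rule is_inverse_inv_mor[OF braid_iso])

lemma braid_in_hom: "braid \<C> A B \<in> hom \<C> (A \<boxtimes> B) (B \<boxtimes> A)"
  using braid_inverse[of A B] by (simp add: is_inverse_def)

lemma crossing_in_hom:
  "pos_crossing \<C> \<in> hom \<C> (strand \<C> \<boxtimes> strand \<C>) (strand \<C> \<boxtimes> strand \<C>)"
  "neg_crossing \<C> \<in> hom \<C> (strand \<C> \<boxtimes> strand \<C>) (strand \<C> \<boxtimes> strand \<C>)"
  using braid_inverse[of "strand \<C>" "strand \<C>"]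
  by (auto simp: pos_crossing_def neg_crossing_def is_inverse_def)

lemma merge_in_hom: "merge \<C> \<in> hom \<C> (strand \<C> \<boxtimes> strand \<C>) (strand \<C>)"
  unfolding merge_def Let_def by (rule hom_intros coev_in_hom vertex_in_hom)+

lemma fork_in_hom: "fork \<C> \<in> hom \<C> (strand \<C>) (strand \<C> \<boxtimes> strand \<C>)"
  unfolding fork_def Let_def by (rule hom_intros coev_in_hom merge_in_hom)+

lemma dgm_H_in_hom: "dgm_H \<C> \<in> hom \<C> (strand \<C> \<boxtimes> strand \<C>) (strand \<C> \<boxtimes> strand \<C>)"
  unfolding dgm_H_def Let_def by (rule hom_intros fork_in_hom merge_in_hom)+

lemmas gen_in_hom = ev_in_hom coev_in_hom vertex_in_hom crossing_in_hom merge_in_hom fork_in_hom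
  dgm_H_in_hom braid_in_hom

lemma gen_in_hom_obj:
  "ev \<C> \<in> hom \<C> (obj SS) (obj Unit)" "coev \<C> \<in> hom \<C> (obj Unit) (obj SS)"
  "vertex \<C> \<in> hom \<C> (obj (Join SS Strand)) (obj Unit)"
  "pos_crossing \<C> \<in> hom \<C> (obj SS) (obj SS)" "neg_crossing \<C> \<in> hom \<C> (obj SS) (obj SS)"
  "merge \<C> \<in> hom \<C> (obj SS) (obj Strand)" "fork \<C> \<in> hom \<C> (obj Strand) (obj SS)"
  "dgm_H \<C> \<in> hom \<C> (obj SS) (obj SS)"
  "\<i>\<d> (strand \<C>) \<in> hom \<C> (obj Strand) (obj Strand)"
  "braid \<C> (obj A) (obj B) \<in> hom \<C> (obj (Join A B)) (obj (Join B A))"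
  by (simp_all add: gen_in_hom ident_in_hom)

lemma layer_gen_in_vec:
  assumes "h \<in> vec Z k"
  shows "k = n + j \<Longrightarrow> k' = n + 2 + j \<Longrightarrow> cup n j h \<in> vec Z k'"
    "k = n + 2 + j \<Longrightarrow> k' = n + j \<Longrightarrow> cap n j h \<in> vec Z k'"
    "k = n + 3 + j \<Longrightarrow> k' = n + j \<Longrightarrow> vtx n j h \<in> vec Z k'"
    "k = n + 2 + j \<Longrightarrow> k' = n + 1 + j \<Longrightarrow> mrg n j h \<in> vec Z k'"
    "k = n + 1 + j \<Longrightarrow> k' = n + 2 + j \<Longrightarrow> frk n j h \<in> vec Z k'"
    "k = n + 2 + j \<Longrightarrow> k' = n + 2 + j \<Longrightarrow> rung n j h \<in> vec Z k'"
    "k = n + 2 + j \<Longrightarrow> k' = n + 2 + j \<Longrightarrow> pos n j h \<in> vec Z k'"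
    "k = n + 2 + j \<Longrightarrow> k' = n + 2 + j \<Longrightarrow> neg n j h \<in> vec Z k'"
  using assms by (auto intro!: layer_in_vec gen_in_hom_obj)

lemma layer_tens_ident:
  assumes f: "f \<in> hom \<C> (obj A) (obj B)" and h: "h \<in> vec Z k" "k = n + width A + width D + j"
  shows "layer (Join A D) (Join B D) (f \<otimes> \<i>\<d> (obj D)) n j h = layer A B f n (width D + j) h"
    "m = n + width D \<Longrightarrow>
      layer (Join D A) (Join D B) (\<i>\<d> (obj D) \<otimes> f) n j h = layer A B f m j h"
proof -
  show "layer (Join A D) (Join B D) (f \<otimes> \<i>\<d> (obj D)) n j h = layer A B f n (width D + j) h"
    using layer_tens[OF f ident_in_hom h] layer_ident[OF h(1), of "n + width A" D j] h(2) by simp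
  show "layer (Join D A) (Join D B) (\<i>\<d> (obj D) \<otimes> f) n j h = layer A B f m j h" if "m = n + width D"
    using layer_tens[OF ident_in_hom f h(1), of n D j] that h(2)
      layer_ident[OF layer_in_vec[OF f h(1)], of m j _ n D] by simp
qed

text \<open>Unitors and associators act trivially, so only the cup and the vertex survive from the
  definition of \<open>merge\<close>.\<close>

lemma mrg_eq:
  assumes h: "h \<in> vec Z k" and k: "k = n + 2 + j"
  shows "mrg n j h = vtx n (Suc j) (cup (n + 2) j h)"
proof -
  let ?X = "strand \<C>"
  have t: "runit_inv \<C> (?X \<boxtimes> ?X) \<in> hom \<C> (obj SS) (obj (Join SS Unit))"
    "\<i>\<d> (?X \<boxtimes> ?X) \<otimes> coev \<C> \<in> hom \<C> (obj (Join SS Unit)) (obj (Join SS SS))"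
    "assoc_inv \<C> (?X \<boxtimes> ?X) ?X ?X \<in> hom \<C> (obj (Join SS SS)) (obj (Join (Join SS Strand) Strand))"
    "vertex \<C> \<otimes> \<i>\<d> ?X \<in> hom \<C> (obj (Join (Join SS Strand) Strand)) (obj (Join Unit Strand))"
    "lunit \<C> ?X \<in> hom \<C> (obj (Join Unit Strand)) (obj Strand)"
    unfolding obj.simps by (rule hom_intros gen_in_hom)+
  have c: "cup (n + 2) j h \<in> vec Z (n + 4 + j)" "vtx n (Suc j) (cup (n + 2) j h) \<in> vec Z (n + 1 + j)"
    using h k by (auto intro!: layer_gen_in_vec)
  have "mrg n j h = layer (Join Unit Strand) Strand (lunit \<C> ?X) n j
      (layer (Join (Join SS Strand) Strand) (Join Unit Strand) (vertex \<C> \<otimes> \<i>\<d> ?X) n j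
      (layer (Join SS SS) (Join (Join SS Strand) Strand) (assoc_inv \<C> (?X \<boxtimes> ?X) ?X ?X) n j
      (layer (Join SS Unit) (Join SS SS) (\<i>\<d> (?X \<boxtimes> ?X) \<otimes> coev \<C>) n j
      (layer SS (Join SS Unit) (runit_inv \<C> (?X \<boxtimes> ?X)) n j h))))"
    unfolding merge_def Let_def by (rule layer_comp5[OF t h]) (simp add: k)
  also have "layer SS (Join SS Unit) (runit_inv \<C> (?X \<boxtimes> ?X)) n j h = h"
    using layer_unit(4)[OF h, of n SS j] k by simp
  also have "layer (Join SS Unit) (Join SS SS) (\<i>\<d> (?X \<boxtimes> ?X) \<otimes> coev \<C>) n j h = cup (n + 2) j h"
    using layer_tens_ident(2)[OF gen_in_hom_obj(2) h, of n SS j] k by simp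
  also have "layer (Join SS SS) (Join (Join SS Strand) Strand) (assoc_inv \<C> (?X \<boxtimes> ?X) ?X ?X) n j
    (cup (n + 2) j h) = cup (n + 2) j h"
    using layer_assoc(2)[OF c(1), of n SS Strand Strand j] by simp
  also have "layer (Join (Join SS Strand) Strand) (Join Unit Strand) (vertex \<C> \<otimes> \<i>\<d> ?X) n j
    (cup (n + 2) j h) = vtx n (Suc j) (cup (n + 2) j h)"
    using layer_tens_ident(1)[OF gen_in_hom_obj(3) c(1), of n Strand j] by simp
  also have "layer (Join Unit Strand) Strand (lunit \<C> ?X) n j \<dots> = \<dots>"
    using layer_unit(1)[OF c(2), of n Strand j] by simp
  finally show ?thesis .
qed

lemma frk_eq:
  assumes h: "h \<in> vec Z k" and k: "k = n + 1 + j"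
  shows "frk n j h = mrg n (Suc j) (cup (Suc n) j h)"
proof -
  let ?X = "strand \<C>"
  have t: "runit_inv \<C> ?X \<in> hom \<C> (obj Strand) (obj (Join Strand Unit))"
    "\<i>\<d> ?X \<otimes> coev \<C> \<in> hom \<C> (obj (Join Strand Unit)) (obj (Join Strand SS))"
    "assoc_inv \<C> ?X ?X ?X \<in> hom \<C> (obj (Join Strand SS)) (obj (Join SS Strand))"
    "merge \<C> \<otimes> \<i>\<d> ?X \<in> hom \<C> (obj (Join SS Strand)) (obj SS)"
    unfolding obj.simps by (rule hom_intros gen_in_hom)+
  have c: "cup (Suc n) j h \<in> vec Z (n + 3 + j)"
    using h k by (auto intro!: layer_gen_in_vec)
  have "frk n j h = layer (Join SS Strand) SS (merge \<C> \<otimes> \<i>\<d> ?X) n j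
      (layer (Join Strand SS) (Join SS Strand) (assoc_inv \<C> ?X ?X ?X) n j
      (layer (Join Strand Unit) (Join Strand SS) (\<i>\<d> ?X \<otimes> coev \<C>) n j
      (layer Strand (Join Strand Unit) (runit_inv \<C> ?X) n j h)))"
    unfolding fork_def Let_def by (rule layer_comp4[OF t h]) (simp add: k)
  also have "layer Strand (Join Strand Unit) (runit_inv \<C> ?X) n j h = h"
    using layer_unit(4)[OF h, of n Strand j] k by simp
  also have "layer (Join Strand Unit) (Join Strand SS) (\<i>\<d> ?X \<otimes> coev \<C>) n j h = cup (Suc n) j h"
    using layer_tens_ident(2)[OF gen_in_hom_obj(2) h, of n Strand j] k by simp
  also have "layer (Join Strand SS) (Join SS Strand) (assoc_inv \<C> ?X ?X ?X) n j
    (cup (Suc n) j h) = cup (Suc n) j h"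
    using layer_assoc(2)[OF c(1), of n Strand Strand Strand j] by simp
  also have "layer (Join SS Strand) SS (merge \<C> \<otimes> \<i>\<d> ?X) n j
    (cup (Suc n) j h) = mrg n (Suc j) (cup (Suc n) j h)"
    using layer_tens_ident(1)[OF gen_in_hom_obj(6) c(1), of n Strand j] by simp
  finally show ?thesis .
qed

lemma rung_eq:
  assumes h: "h \<in> vec Z k" and k: "k = n + 2 + j"
  shows "rung n j h = mrg (Suc n) j (frk n (Suc j) h)"
proof -
  let ?X = "strand \<C>"
  have t: "fork \<C> \<otimes> \<i>\<d> ?X \<in> hom \<C> (obj SS) (obj (Join SS Strand))"
    "assoc \<C> ?X ?X ?X \<in> hom \<C> (obj (Join SS Strand)) (obj (Join Strand SS))"
    "\<i>\<d> ?X \<otimes> merge \<C> \<in> hom \<C> (obj (Join Strand SS)) (obj SS)"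
    unfolding obj.simps by (rule hom_intros gen_in_hom)+
  have c: "frk n (Suc j) h \<in> vec Z (n + 3 + j)"
    using h k by (auto intro!: layer_gen_in_vec)
  have "rung n j h = layer (Join Strand SS) SS (\<i>\<d> ?X \<otimes> merge \<C>) n j
      (layer (Join SS Strand) (Join Strand SS) (assoc \<C> ?X ?X ?X) n j
      (layer SS (Join SS Strand) (fork \<C> \<otimes> \<i>\<d> ?X) n j h))"
    unfolding dgm_H_def Let_def by (rule layer_comp3[OF t h]) (simp add: k)
  also have "layer SS (Join SS Strand) (fork \<C> \<otimes> \<i>\<d> ?X) n j h = frk n (Suc j) h"
    using layer_tens_ident(1)[OF gen_in_hom_obj(7) h, of n Strand j] k by simp
  also have "layer (Join SS Strand) (Join Strand SS) (assoc \<C> ?X ?X ?X) n j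
    (frk n (Suc j) h) = frk n (Suc j) h"
    using layer_assoc(1)[OF c(1), of n Strand Strand Strand j] by simp
  also have "layer (Join Strand SS) SS (\<i>\<d> ?X \<otimes> merge \<C>) n j
    (frk n (Suc j) h) = mrg (Suc n) j (frk n (Suc j) h)"
    using layer_tens_ident(2)[OF gen_in_hom_obj(6) c(1), of n Strand j] by simp
  finally show ?thesis .
qed

lemma zigzag:
  assumes h: "h \<in> vec Z k" and k: "k = n + 1 + j"
  shows "cap (Suc n) j (cup n (Suc j) h) = h" "cap n (Suc j) (cup (Suc n) j h) = h"
proof -
  let ?X = "strand \<C>"
  have t: "lunit_inv \<C> ?X \<in> hom \<C> (obj Strand) (obj (Join Unit Strand))"
    "coev \<C> \<otimes> \<i>\<d> ?X \<in> hom \<C> (obj (Join Unit Strand)) (obj (Join SS Strand))"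
    "assoc \<C> ?X ?X ?X \<in> hom \<C> (obj (Join SS Strand)) (obj (Join Strand SS))"
    "\<i>\<d> ?X \<otimes> ev \<C> \<in> hom \<C> (obj (Join Strand SS)) (obj (Join Strand Unit))"
    "runit \<C> ?X \<in> hom \<C> (obj (Join Strand Unit)) (obj Strand)"
    unfolding obj.simps by (rule hom_intros gen_in_hom)+
  have t': "runit_inv \<C> ?X \<in> hom \<C> (obj Strand) (obj (Join Strand Unit))"
    "\<i>\<d> ?X \<otimes> coev \<C> \<in> hom \<C> (obj (Join Strand Unit)) (obj (Join Strand SS))"
    "assoc_inv \<C> ?X ?X ?X \<in> hom \<C> (obj (Join Strand SS)) (obj (Join SS Strand))"
    "ev \<C> \<otimes> \<i>\<d> ?X \<in> hom \<C> (obj (Join SS Strand)) (obj (Join Unit Strand))"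
    "lunit \<C> ?X \<in> hom \<C> (obj (Join Unit Strand)) (obj Strand)"
    unfolding obj.simps by (rule hom_intros gen_in_hom)+
  have c: "cup n (Suc j) h \<in> vec Z (n + 3 + j)" "cap (Suc n) j (cup n (Suc j) h) \<in> vec Z (n + 1 + j)"
    "cup (Suc n) j h \<in> vec Z (n + 3 + j)" "cap n (Suc j) (cup (Suc n) j h) \<in> vec Z (n + 1 + j)"
    using h k by (auto intro!: layer_gen_in_vec)
  have "h = layer Strand Strand (\<i>\<d> ?X) n j h" using layer_ident[OF h, of n Strand j] k by simp
  also have "\<dots> = layer (Join Strand Unit) Strand (runit \<C> ?X) n j
      (layer (Join Strand SS) (Join Strand Unit) (\<i>\<d> ?X \<otimes> ev \<C>) n j
      (layer (Join SS Strand) (Join Strand SS) (assoc \<C> ?X ?X ?X) n j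
      (layer (Join Unit Strand) (Join SS Strand) (coev \<C> \<otimes> \<i>\<d> ?X) n j
      (layer Strand (Join Unit Strand) (lunit_inv \<C> ?X) n j h))))"
    using self_dual k unfolding dual_pair_def by (subst layer_comp5[OF t h, symmetric]) simp_all
  also have "layer Strand (Join Unit Strand) (lunit_inv \<C> ?X) n j h = h"
    using layer_unit(2)[OF h, of n Strand j] k by simp
  also have "layer (Join Unit Strand) (Join SS Strand) (coev \<C> \<otimes> \<i>\<d> ?X) n j h = cup n (Suc j) h"
    using layer_tens_ident(1)[OF gen_in_hom_obj(2) h, of n Strand j] k by simp
  also have "layer (Join SS Strand) (Join Strand SS) (assoc \<C> ?X ?X ?X) n j \<dots> = \<dots>"
    using layer_assoc(1)[OF c(1), of n Strand Strand Strand j] by simp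
  also have "layer (Join Strand SS) (Join Strand Unit) (\<i>\<d> ?X \<otimes> ev \<C>) n j \<dots>
      = cap (Suc n) j (cup n (Suc j) h)"
    using layer_tens_ident(2)[OF gen_in_hom_obj(1) c(1), of n Strand j] by simp
  also have "layer (Join Strand Unit) Strand (runit \<C> ?X) n j \<dots> = \<dots>"
    using layer_unit(3)[OF c(2), of n Strand j] by simp
  finally show "cap (Suc n) j (cup n (Suc j) h) = h" by simp
  have "h = layer Strand Strand (\<i>\<d> ?X) n j h" using layer_ident[OF h, of n Strand j] k by simp
  also have "\<dots> = layer (Join Unit Strand) Strand (lunit \<C> ?X) n j
      (layer (Join SS Strand) (Join Unit Strand) (ev \<C> \<otimes> \<i>\<d> ?X) n j
      (layer (Join Strand SS) (Join SS Strand) (assoc_inv \<C> ?X ?X ?X) n j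
      (layer (Join Strand Unit) (Join Strand SS) (\<i>\<d> ?X \<otimes> coev \<C>) n j
      (layer Strand (Join Strand Unit) (runit_inv \<C> ?X) n j h))))"
    using self_dual k unfolding dual_pair_def by (subst layer_comp5[OF t' h, symmetric]) simp_all
  also have "layer Strand (Join Strand Unit) (runit_inv \<C> ?X) n j h = h"
    using layer_unit(4)[OF h, of n Strand j] k by simp
  also have "layer (Join Strand Unit) (Join Strand SS) (\<i>\<d> ?X \<otimes> coev \<C>) n j h = cup (Suc n) j h"
    using layer_tens_ident(2)[OF gen_in_hom_obj(2) h, of n Strand j] k by simp
  also have "layer (Join Strand SS) (Join SS Strand) (assoc_inv \<C> ?X ?X ?X) n j \<dots> = \<dots>"
    using layer_assoc(2)[OF c(3), of n Strand Strand Strand j] by simp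
  also have "layer (Join SS Strand) (Join Unit Strand) (ev \<C> \<otimes> \<i>\<d> ?X) n j \<dots>
      = cap n (Suc j) (cup (Suc n) j h)"
    using layer_tens_ident(1)[OF gen_in_hom_obj(1) c(3), of n Strand j] by simp
  also have "layer (Join Unit Strand) Strand (lunit \<C> ?X) n j \<dots> = \<dots>"
    using layer_unit(1)[OF c(4), of n Strand j] by simp
  finally show "cap n (Suc j) (cup (Suc n) j h) = h" by simp
qed

section \<open>The braiding of blocks of strands\<close>

abbreviation "swap A B \<equiv> layer (Join A B) (Join B A) (braid \<C> (obj A) (obj B))"

lemma swap_strands: "swap Strand Strand = pos"
  by (simp add: pos_crossing_def)

lemma swap_in_vec:
  "h \<in> vec Z k \<Longrightarrow> k = n + width A + width B + j \<Longrightarrow> k' = n + width A + width B + j \<Longrightarrow>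
    swap A B n j h \<in> vec Z k'"
  by (rule layer_in_vec[OF gen_in_hom_obj(10)]) (simp_all add: add.assoc)

text \<open>Once the associators act as identities, the hexagon splits a crossing over a block into
  successive crossings.\<close>

lemma swap_Join_right:
  assumes h: "h \<in> vec Z k" and k: "k = n + width A + width B + width D + j"
  shows "swap A (Join B D) n j h = swap A D (n + width B) j (swap A B n (width D + j) h)"
proof -
  let ?A = "obj A" and ?B = "obj B" and ?D = "obj D"
  have t: "assoc \<C> ?A ?B ?D \<in> hom \<C> (obj (Join (Join A B) D)) (obj (Join A (Join B D)))"
    "braid \<C> ?A (?B \<boxtimes> ?D) \<in> hom \<C> (obj (Join A (Join B D))) (obj (Join (Join B D) A))"
    "assoc \<C> ?B ?D ?A \<in> hom \<C> (obj (Join (Join B D) A)) (obj (Join B (Join D A)))"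
    "braid \<C> ?A ?B \<otimes> \<i>\<d> ?D \<in> hom \<C> (obj (Join (Join A B) D)) (obj (Join (Join B A) D))"
    "assoc \<C> ?B ?A ?D \<in> hom \<C> (obj (Join (Join B A) D)) (obj (Join B (Join A D)))"
    "\<i>\<d> ?B \<otimes> braid \<C> ?A ?D \<in> hom \<C> (obj (Join B (Join A D))) (obj (Join B (Join D A)))"
    unfolding obj.simps by (rule hom_intros braid_in_hom)+
  let ?l = "swap A (Join B D) n j h" and ?r = "swap A B n (width D + j) h"
  have c: "?l \<in> vec Z k" "?r \<in> vec Z k" by (rule swap_in_vec[OF h], simp_all add: k)+
  have "?l = layer (Join (Join B D) A) (Join B (Join D A)) (assoc \<C> ?B ?D ?A) n j
      (layer (Join A (Join B D)) (Join (Join B D) A) (braid \<C> ?A (?B \<boxtimes> ?D)) n j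
      (layer (Join (Join A B) D) (Join A (Join B D)) (assoc \<C> ?A ?B ?D) n j h))"
    using layer_assoc(1)[OF h, of n A B D j] layer_assoc(1)[OF c(1), of n B D A j] k by simp
  also have "\<dots> = layer (Join (Join A B) D) (Join B (Join D A))
      (assoc \<C> ?B ?D ?A \<cdot> braid \<C> ?A (?B \<boxtimes> ?D) \<cdot> assoc \<C> ?A ?B ?D) n j h"
    by (rule layer_comp3[symmetric, OF t(1-3) h]) (simp add: k)
  also have "\<dots> = layer (Join B (Join A D)) (Join B (Join D A)) (\<i>\<d> ?B \<otimes> braid \<C> ?A ?D) n j
      (layer (Join (Join B A) D) (Join B (Join A D)) (assoc \<C> ?B ?A ?D) n j
      (layer (Join (Join A B) D) (Join (Join B A) D) (braid \<C> ?A ?B \<otimes> \<i>\<d> ?D) n j h))"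
    unfolding hexagon1 by (rule layer_comp3[OF t(4-6) h]) (simp add: k)
  also have "layer (Join (Join A B) D) (Join (Join B A) D) (braid \<C> ?A ?B \<otimes> \<i>\<d> ?D) n j h = ?r"
    using layer_tens_ident(1)[OF gen_in_hom_obj(10) h] k by simp
  also have "layer (Join (Join B A) D) (Join B (Join A D)) (assoc \<C> ?B ?A ?D) n j \<dots> = \<dots>"
    using layer_assoc(1)[OF c(2), of n B A D j] k by simp
  also have "layer (Join B (Join A D)) (Join B (Join D A)) (\<i>\<d> ?B \<otimes> braid \<C> ?A ?D) n j \<dots>
      = swap A D (n + width B) j \<dots>"
    by (rule layer_tens_ident(2)[OF gen_in_hom_obj(10) c(2)]) (simp_all add: k)
  finally show ?thesis .
qed

lemma swap_Join_left:
  assumes h: "h \<in> vec Z k" and k: "k = n + width A + width B + width D + j"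
  shows "swap (Join A B) D n j h = swap A D n (width B + j) (swap B D (n + width A) j h)"
proof -
  let ?A = "obj A" and ?B = "obj B" and ?D = "obj D"
  have t: "assoc_inv \<C> ?A ?B ?D \<in> hom \<C> (obj (Join A (Join B D))) (obj (Join (Join A B) D))"
    "braid \<C> (?A \<boxtimes> ?B) ?D \<in> hom \<C> (obj (Join (Join A B) D)) (obj (Join D (Join A B)))"
    "assoc_inv \<C> ?D ?A ?B \<in> hom \<C> (obj (Join D (Join A B))) (obj (Join (Join D A) B))"
    "\<i>\<d> ?A \<otimes> braid \<C> ?B ?D \<in> hom \<C> (obj (Join A (Join B D))) (obj (Join A (Join D B)))"
    "assoc_inv \<C> ?A ?D ?B \<in> hom \<C> (obj (Join A (Join D B))) (obj (Join (Join A D) B))"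
    "braid \<C> ?A ?D \<otimes> \<i>\<d> ?B \<in> hom \<C> (obj (Join (Join A D) B)) (obj (Join (Join D A) B))"
    unfolding obj.simps by (rule hom_intros braid_in_hom)+
  let ?l = "swap (Join A B) D n j h" and ?r = "swap B D (n + width A) j h"
  have c: "?l \<in> vec Z k" "?r \<in> vec Z k" by (rule swap_in_vec[OF h], simp_all add: k)+
  have "?l = layer (Join D (Join A B)) (Join (Join D A) B) (assoc_inv \<C> ?D ?A ?B) n j
      (layer (Join (Join A B) D) (Join D (Join A B)) (braid \<C> (?A \<boxtimes> ?B) ?D) n j
      (layer (Join A (Join B D)) (Join (Join A B) D) (assoc_inv \<C> ?A ?B ?D) n j h))"
    using layer_assoc(2)[OF h, of n A B D j] layer_assoc(2)[OF c(1), of n D A B j] k by simp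
  also have "\<dots> = layer (Join A (Join B D)) (Join (Join D A) B)
      (assoc_inv \<C> ?D ?A ?B \<cdot> braid \<C> (?A \<boxtimes> ?B) ?D \<cdot> assoc_inv \<C> ?A ?B ?D) n j h"
    by (rule layer_comp3[symmetric, OF t(1-3) h]) (simp add: k)
  also have "\<dots> = layer (Join (Join A D) B) (Join (Join D A) B) (braid \<C> ?A ?D \<otimes> \<i>\<d> ?B) n j
      (layer (Join A (Join D B)) (Join (Join A D) B) (assoc_inv \<C> ?A ?D ?B) n j
      (layer (Join A (Join B D)) (Join A (Join D B)) (\<i>\<d> ?A \<otimes> braid \<C> ?B ?D) n j h))"
    unfolding hexagon2 by (rule layer_comp3[OF t(4-6) h]) (simp add: k)
  also have "layer (Join A (Join B D)) (Join A (Join D B)) (\<i>\<d> ?A \<otimes> braid \<C> ?B ?D) n j h = ?r"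
    by (rule layer_tens_ident(2)[OF gen_in_hom_obj(10) h]) (simp_all add: k)
  also have "layer (Join A (Join D B)) (Join (Join A D) B) (assoc_inv \<C> ?A ?D ?B) n j \<dots> = \<dots>"
    using layer_assoc(2)[OF c(2), of n A D B j] k by simp
  also have "layer (Join (Join A D) B) (Join (Join D A) B) (braid \<C> ?A ?D \<otimes> \<i>\<d> ?B) n j \<dots>
      = swap A D n (width B + j) \<dots>"
    by (rule layer_tens_ident(1)[OF gen_in_hom_obj(10) c(2)]) (simp_all add: k)
  finally show ?thesis .
qed

lemma swap_natural_right:
  assumes g: "g \<in> hom \<C> (obj B) (obj B')" and h: "h \<in> vec Z k"
    and k: "k = n + width A + width B + j" "m = n + width A" "i = width A + j"
  shows "swap A B' n j (layer B B' g m j h) = layer B B' g n i (swap A B n j h)"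
proof -
  have t: "\<i>\<d> (obj A) \<otimes> g \<in> hom \<C> (obj (Join A B)) (obj (Join A B'))"
    "g \<otimes> \<i>\<d> (obj A) \<in> hom \<C> (obj (Join B A)) (obj (Join B' A))"
    unfolding obj.simps by (rule hom_intros g)+
  have c: "swap A B n j h \<in> vec Z k" by (rule swap_in_vec[OF h]) (simp_all add: k)
  have "swap A B' n j (layer B B' g m j h)
      = swap A B' n j (layer (Join A B) (Join A B') (\<i>\<d> (obj A) \<otimes> g) n j h)"
    using layer_tens_ident(2)[OF g h] k by simp
  also have "\<dots> = layer (Join A B) (Join B' A) (braid \<C> (obj A) (obj B') \<cdot> (\<i>\<d> (obj A) \<otimes> g)) n j h"
    by (rule layer_comp[symmetric, OF t(1) gen_in_hom_obj(10) h]) (simp add: k)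
  also have "\<dots> = layer (Join A B) (Join B' A) ((g \<otimes> \<i>\<d> (obj A)) \<cdot> braid \<C> (obj A) (obj B)) n j h"
    by (simp add: braid_natural[OF ident_in_hom g])
  also have "\<dots> = layer (Join B A) (Join B' A) (g \<otimes> \<i>\<d> (obj A)) n j (swap A B n j h)"
    by (rule layer_comp[OF gen_in_hom_obj(10) t(2) h]) (simp add: k)
  also have "\<dots> = layer B B' g n i (swap A B n j h)"
    using layer_tens_ident(1)[OF g c] k by simp
  finally show ?thesis .
qed

lemma swap_natural_left:
  assumes f: "f \<in> hom \<C> (obj A) (obj A')" and h: "h \<in> vec Z k"
    and k: "k = n + width A + width B + j" "i = width B + j" "m = n + width B"
  shows "swap A' B n j (layer A A' f n i h) = layer A A' f m j (swap A B n j h)"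
proof -
  have t: "f \<otimes> \<i>\<d> (obj B) \<in> hom \<C> (obj (Join A B)) (obj (Join A' B))"
    "\<i>\<d> (obj B) \<otimes> f \<in> hom \<C> (obj (Join B A)) (obj (Join B A'))"
    unfolding obj.simps by (rule hom_intros f)+
  have c: "swap A B n j h \<in> vec Z k" by (rule swap_in_vec[OF h]) (simp_all add: k)
  have "swap A' B n j (layer A A' f n i h)
      = swap A' B n j (layer (Join A B) (Join A' B) (f \<otimes> \<i>\<d> (obj B)) n j h)"
    using layer_tens_ident(1)[OF f h] k by simp
  also have "\<dots> = layer (Join A B) (Join B A') (braid \<C> (obj A') (obj B) \<cdot> (f \<otimes> \<i>\<d> (obj B))) n j h"
    by (rule layer_comp[symmetric, OF t(1) gen_in_hom_obj(10) h]) (simp add: k)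
  also have "\<dots> = layer (Join A B) (Join B A') ((\<i>\<d> (obj B) \<otimes> f) \<cdot> braid \<C> (obj A) (obj B)) n j h"
    by (simp add: braid_natural[OF f ident_in_hom])
  also have "\<dots> = layer (Join B A) (Join B A') (\<i>\<d> (obj B) \<otimes> f) n j (swap A B n j h)"
    by (rule layer_comp[OF gen_in_hom_obj(10) t(2) h]) (simp add: k)
  also have "\<dots> = layer A A' f m j (swap A B n j h)"
    by (rule layer_tens_ident(2)[OF f c]) (simp_all add: k)
  finally show ?thesis .
qed

lemma swap_inverse:
  assumes h: "h \<in> vec Z k" and k: "k = n + width A + width B + j"
  shows "layer (Join B A) (Join A B) (braid_inv \<C> (obj A) (obj B)) n j (swap A B n j h) = h"
    "swap A B n j (layer (Join B A) (Join A B) (braid_inv \<C> (obj A) (obj B)) n j h) = h"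
proof -
  have t: "braid_inv \<C> (obj A) (obj B) \<in> hom \<C> (obj (Join B A)) (obj (Join A B))"
    and e: "braid_inv \<C> (obj A) (obj B) \<cdot> braid \<C> (obj A) (obj B) = \<i>\<d> (obj (Join A B))"
    "braid \<C> (obj A) (obj B) \<cdot> braid_inv \<C> (obj A) (obj B) = \<i>\<d> (obj (Join B A))"
    using braid_inverse[of "obj A" "obj B"] by (auto simp: is_inverse_def)
  show "layer (Join B A) (Join A B) (braid_inv \<C> (obj A) (obj B)) n j (swap A B n j h) = h"
    using layer_comp[OF gen_in_hom_obj(10) t h, of n j] layer_ident[OF h, of n "Join A B" j] k e
    by simp
  show "swap A B n j (layer (Join B A) (Join A B) (braid_inv \<C> (obj A) (obj B)) n j h) = h"
    using layer_comp[OF t gen_in_hom_obj(10) h, of n j] layer_ident[OF h, of n "Join B A" j] k e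
    by simp
qed

text \<open>Naturality along \<open>lunit \<one>\<close> and a hexagon make the braiding with the unit idempotent; being
  invertible, it is trivial.\<close>

lemma swap_Unit:
  assumes h: "h \<in> vec Z k" and k: "k = n + width A + j"
  shows "swap A Unit n j h = h" "swap Unit A n j h = h"
proof -
  let ?U = "Join Unit Unit"
  have l: "lunit \<C> \<one> \<in> hom \<C> (obj ?U) (obj Unit)" by (simp add: structure_in_hom)
  have trivial: "layer ?U Unit (lunit \<C> \<one>) m i x = x" if "x \<in> vec Z k" "k = m + i" for m i x
    using layer_unit(1)[OF that(1), of m Unit i] that(2) by simp
  have c: "swap A Unit n j h \<in> vec Z k" "swap A ?U n j h \<in> vec Z k"
    "swap Unit A n j h \<in> vec Z k" "swap ?U A n j h \<in> vec Z k"
    using swap_in_vec[OF h, of n A Unit j k] swap_in_vec[OF h, of n A ?U j k]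
      swap_in_vec[OF h, of n Unit A j k] swap_in_vec[OF h, of n ?U A j k] k by simp_all
  have "swap A Unit n j h = swap A Unit n j (layer ?U Unit (lunit \<C> \<one>) (n + width A) j h)"
    by (subst trivial[OF h]) (simp_all add: k)
  also have "\<dots> = layer ?U Unit (lunit \<C> \<one>) n (width A + j) (swap A ?U n j h)"
    by (rule swap_natural_right[OF l h]) (simp_all add: k)
  also have "\<dots> = swap A ?U n j h" by (rule trivial[OF c(2)]) (simp add: k)
  also have "\<dots> = swap A Unit n j (swap A Unit n j h)"
    by (subst swap_Join_right[OF h]) (simp_all add: k)
  finally show "swap A Unit n j h = h"
    using swap_inverse(1)[OF h, of n A Unit j] swap_inverse(1)[OF c(1), of n A Unit j] k by simp
  have "swap Unit A n j h = swap Unit A n j (layer ?U Unit (lunit \<C> \<one>) n (width A + j) h)"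
    by (subst trivial[OF h]) (simp_all add: k)
  also have "\<dots> = layer ?U Unit (lunit \<C> \<one>) (n + width A) j (swap ?U A n j h)"
    by (rule swap_natural_left[OF l h]) (simp_all add: k)
  also have "\<dots> = swap ?U A n j h" by (rule trivial[OF c(4)]) (simp add: k)
  also have "\<dots> = swap Unit A n j (swap Unit A n j h)"
    by (subst swap_Join_left[OF h]) (simp_all add: k)
  finally show "swap Unit A n j h = h"
    using swap_inverse(1)[OF h, of n Unit A j] swap_inverse(1)[OF c(3), of n Unit A j] k by simp
qed

lemma crossing_inverse:
  assumes "h \<in> vec Z k" "k = n + 2 + j"
  shows "neg n j (pos n j h) = h" "pos n j (neg n j h) = h"
  using swap_inverse[OF assms(1), of n Strand Strand j] assms(2)
  by (simp_all add: pos_crossing_def neg_crossing_def)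

text \<open>Carrying a strand across both legs of a cup equals, by naturality, carrying it across
  nothing, which is trivial by \<open>swap_Unit\<close>. Moving one of the two crossings to the
  other side of the equation inverts it.\<close>

lemma crossing_cup:
  assumes h: "h \<in> vec Z k" and k: "k = n + 1 + j"
  shows "neg (Suc n) j (cup n (Suc j) h) = pos n (Suc j) (cup (Suc n) j h)"
    "pos (Suc n) j (cup n (Suc j) h) = neg n (Suc j) (cup (Suc n) j h)"
proof -
  have c: "cup (Suc n) j h \<in> vec Z (n + 3 + j)" "cup n (Suc j) h \<in> vec Z (n + 3 + j)"
    using h k by (auto intro!: layer_gen_in_vec)
  have p: "pos n (Suc j) (cup (Suc n) j h) \<in> vec Z (n + 3 + j)"
    "pos (Suc n) j (cup n (Suc j) h) \<in> vec Z (n + 3 + j)"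
    using h k by (auto intro!: layer_gen_in_vec)
  have "pos (Suc n) j (pos n (Suc j) (cup (Suc n) j h)) = swap Strand SS n j (cup (Suc n) j h)"
    by (subst swap_Join_right[OF c(1)]) (simp_all add: pos_crossing_def)
  also have "\<dots> = cup n (Suc j) (swap Strand Unit n j h)"
    by (rule swap_natural_right[OF gen_in_hom_obj(2) h]) (simp_all add: k)
  also have "\<dots> = cup n (Suc j) h" using swap_Unit(1)[OF h, of n Strand j] k by simp
  finally show "neg (Suc n) j (cup n (Suc j) h) = pos n (Suc j) (cup (Suc n) j h)"
    using crossing_inverse(1)[OF p(1), of "Suc n" j] by simp
  have "pos n (Suc j) (pos (Suc n) j (cup n (Suc j) h)) = swap SS Strand n j (cup n (Suc j) h)"
    by (subst swap_Join_left[OF c(2)]) (simp_all add: pos_crossing_def)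
  also have "\<dots> = cup (Suc n) j (swap Unit Strand n j h)"
    by (rule swap_natural_left[OF gen_in_hom_obj(2) h]) (simp_all add: k)
  also have "\<dots> = cup (Suc n) j h" using swap_Unit(2)[OF h, of n Strand j] k by simp
  finally show "pos (Suc n) j (cup n (Suc j) h) = neg n (Suc j) (cup (Suc n) j h)"
    using crossing_inverse(1)[OF p(2), of n "Suc j"] by simp
qed

text \<open>A strand slides past a vertex: naturality moves the crossing below the merge, where the
  hexagon splits it over the two legs.\<close>

lemma pos_mrg:
  assumes h: "h \<in> vec Z k" and k: "k = n + 3 + j"
  shows "pos n j (mrg (Suc n) j h) = mrg n (Suc j) (pos (Suc n) j (pos n (Suc j) h))"
proof -
  have "swap Strand Strand n j (mrg (Suc n) j h) = mrg n (Suc j) (swap Strand SS n j h)"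
    by (rule swap_natural_right[OF gen_in_hom_obj(6) h]) (simp_all add: k)
  also have "swap Strand SS n j h = swap Strand Strand (Suc n) j (swap Strand Strand n (Suc j) h)"
    by (subst swap_Join_right[OF h]) (simp_all add: k)
  finally show ?thesis by (simp only: swap_strands)
qed

text \<open>Bending the output down with \<open>ev\<close> lands in the rank-one module spanned by
  the vertex. A cup and a zigzag undo the bending and turn the vertex into
  \<open>merge\<close>.\<close>

lemma hom_strands_strand:
  assumes f: "f \<in> hom \<C> (strand \<C> \<boxtimes> strand \<C>) (strand \<C>)"
  shows "\<exists>r. f = r \<odot> merge \<C>"
proof -
  let ?X = "strand \<C>" and ?g = "ev \<C> \<cdot> (f \<otimes> \<i>\<d> (strand \<C>))"
  have f': "f \<in> hom \<C> (obj SS) (obj Strand)" using f by simp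
  have t: "f \<otimes> \<i>\<d> ?X \<in> hom \<C> (obj (Join SS Strand)) (obj SS)"
    unfolding obj.simps by (rule hom_intros f)+
  have "?g \<in> span {vertex \<C>}"
    using comp_in_hom[OF t gen_in_hom_obj(1)] box_3(2) by (simp add: box_def numeral_3_eq_3)
  then obtain r where r: "?g = r \<odot> vertex \<C>" using span_breakdown_eq[of ?g "vertex \<C>" "{}"] by auto
  have "f = r \<odot> merge \<C>"
  proof (rule layer_faithful)
    fix Z h assume h: "h \<in> vec Z (width SS)"
    let ?h = "layer SS Strand f 0 0 h"
    have c: "?h \<in> vec Z 1" "cup 2 0 h \<in> vec Z 4"
      using h by (auto intro!: layer_in_vec[OF f'] layer_gen_in_vec)
    have "?h = cap 0 (Suc 0) (cup (Suc 0) 0 ?h)" by (rule zigzag(2)[symmetric, OF c(1)]) simp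
    also have "cup (Suc 0) 0 ?h = layer SS Strand f 0 2 (cup 2 0 h)"
      by (rule layer_commute[symmetric, OF f' gen_in_hom_obj(2) h]) simp_all
    also have "\<dots> = layer (Join SS Strand) SS (f \<otimes> \<i>\<d> ?X) 0 (Suc 0) (cup 2 0 h)"
      using layer_tens_ident(1)[OF f' c(2), of 0 Strand "Suc 0"] by (simp add: numeral_2_eq_2)
    also have "cap 0 (Suc 0) \<dots> = layer (Join SS Strand) Unit ?g 0 (Suc 0) (cup 2 0 h)"
      by (rule layer_comp[symmetric, OF t gen_in_hom_obj(1) c(2)]) simp
    also have "\<dots> = r \<odot> vtx 0 (Suc 0) (cup 2 0 h)"
      unfolding r by (rule layer_smul[OF gen_in_hom_obj(3) c(2)]) simp
    also have "\<dots> = r \<odot> mrg 0 0 h" by (subst mrg_eq[OF h]) (simp_all add: numeral_2_eq_2)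
    also have "\<dots> = layer SS Strand (r \<odot> merge \<C>) 0 0 h"
      by (rule layer_smul[symmetric, OF gen_in_hom_obj(6) h]) simp
    finally show "?h = layer SS Strand (r \<odot> merge \<C>) 0 0 h" .
  qed (use f' smul_in_hom[OF gen_in_hom_obj(6)] in auto)
  then show ?thesis ..
qed

lemma hom_strands_unit:
  assumes "f \<in> hom \<C> (strand \<C> \<boxtimes> strand \<C>) \<one>"
  shows "\<exists>r. f = r \<odot> ev \<C>"
  using assms box_2(2) span_breakdown_eq[of f "ev \<C>" "{}"] by (auto simp: box_def numeral_2_eq_2)

text \<open>Bending the two upper strands down identifies endomorphisms of two strands with 4-boxes.\<close>

definition bend :: "'m \<Rightarrow> 'm" where
  "bend f = (let X = strand \<C> in
    (ev \<C> \<cdot> ((runit \<C> X \<cdot> (\<i>\<d> X \<otimes> ev \<C>) \<cdot> assoc \<C> X X X) \<otimes> \<i>\<d> X)) \<cdot> ((f \<otimes> \<i>\<d> X) \<otimes> \<i>\<d> X))"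

lemma bend_in_box:
  assumes "f \<in> hom \<C> (strand \<C> \<boxtimes> strand \<C>) (strand \<C> \<boxtimes> strand \<C>)"
  shows "bend f \<in> box \<C> 4"
  unfolding bend_def Let_def box_def by (simp add: eval_nat_numeral) (rule hom_intros gen_in_hom assms)+

lemma bend_add:
  assumes f: "f \<in> hom \<C> (strand \<C> \<boxtimes> strand \<C>) (strand \<C> \<boxtimes> strand \<C>)"
    and g: "g \<in> hom \<C> (strand \<C> \<boxtimes> strand \<C>) (strand \<C> \<boxtimes> strand \<C>)"
  shows "bend (f + g) = bend f + bend g"
  unfolding bend_def Let_def
  by (subst tens_add_left[OF f g ident_in_hom],
      subst tens_add_left[OF _ _ ident_in_hom], (rule tens_in_hom[OF f ident_in_hom] tens_in_hom[OF g ident_in_hom])+,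
      subst comp_add_right, (rule hom_intros gen_in_hom f g refl)+)

lemma bend_smul:
  assumes f: "f \<in> hom \<C> (strand \<C> \<boxtimes> strand \<C>) (strand \<C> \<boxtimes> strand \<C>)"
  shows "bend (r \<odot> f) = r \<odot> bend f"
  unfolding bend_def Let_def
  by (subst tens_smul_left[OF f ident_in_hom],
      subst tens_smul_left[OF _ ident_in_hom], (rule tens_in_hom[OF f ident_in_hom])+,
      subst comp_smul_right, (rule hom_intros gen_in_hom f refl)+)

text \<open>Injectivity of the bending: two cups on the right bring the bent ends back up, and
  zigzags recover \<open>f\<close>.\<close>

lemma bend_eq_0:
  assumes f: "f \<in> hom \<C> (strand \<C> \<boxtimes> strand \<C>) (strand \<C> \<boxtimes> strand \<C>)" and 0: "bend f = 0"
  shows "f = 0"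
proof -
  let ?X = "strand \<C>"
  let ?e = "runit \<C> ?X \<cdot> (\<i>\<d> ?X \<otimes> ev \<C>) \<cdot> assoc \<C> ?X ?X ?X"
  have f': "f \<in> hom \<C> (obj SS) (obj SS)" using f by simp
  have a: "assoc \<C> ?X ?X ?X \<in> hom \<C> (obj (Join SS Strand)) (obj (Join Strand SS))"
    "\<i>\<d> ?X \<otimes> ev \<C> \<in> hom \<C> (obj (Join Strand SS)) (obj (Join Strand Unit))"
    "runit \<C> ?X \<in> hom \<C> (obj (Join Strand Unit)) (obj Strand)"
    unfolding obj.simps by (rule hom_intros gen_in_hom)+
  have e: "?e \<in> hom \<C> (obj (Join SS Strand)) (obj Strand)"
    unfolding obj.simps by (rule hom_intros gen_in_hom)+
  have t: "?e \<otimes> \<i>\<d> ?X \<in> hom \<C> (obj (Join (Join SS Strand) Strand)) (obj SS)"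
    "f \<otimes> \<i>\<d> ?X \<in> hom \<C> (obj (Join SS Strand)) (obj (Join SS Strand))"
    "(f \<otimes> \<i>\<d> ?X) \<otimes> \<i>\<d> ?X
      \<in> hom \<C> (obj (Join (Join SS Strand) Strand)) (obj (Join (Join SS Strand) Strand))"
    unfolding obj.simps by (rule hom_intros gen_in_hom f)+
  have e_eq: "layer (Join SS Strand) Strand ?e 0 j h = cap 1 j h" if h: "h \<in> vec Z k" "k = 3 + j" for Z h k j
  proof -
    have c: "cap 1 j h \<in> vec Z (1 + j)" using h by (auto intro!: layer_gen_in_vec)
    have "layer (Join SS Strand) Strand ?e 0 j h = layer (Join Strand Unit) Strand (runit \<C> ?X) 0 j
      (layer (Join Strand SS) (Join Strand Unit) (\<i>\<d> ?X \<otimes> ev \<C>) 0 j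
      (layer (Join SS Strand) (Join Strand SS) (assoc \<C> ?X ?X ?X) 0 j h))"
      by (rule layer_comp3[OF a h(1)]) (simp add: h(2))
    also have "layer (Join SS Strand) (Join Strand SS) (assoc \<C> ?X ?X ?X) 0 j h = h"
      using layer_assoc(1)[OF h(1), of 0 Strand Strand Strand j] h(2) by simp
    also have "layer (Join Strand SS) (Join Strand Unit) (\<i>\<d> ?X \<otimes> ev \<C>) 0 j h = cap 1 j h"
      using layer_tens_ident(2)[OF gen_in_hom_obj(1) h(1), of 0 Strand j] h(2) by simp
    also have "layer (Join Strand Unit) Strand (runit \<C> ?X) 0 j \<dots> = \<dots>"
      using layer_unit(3)[OF c, of 0 Strand j] by simp
    finally show ?thesis .
  qed
  show ?thesis
  proof (rule layer_faithful)
    fix Z h assume h: "h \<in> vec Z (width SS)"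
    let ?y = "layer SS SS f 0 0 h" and ?F = "Join (Join SS Strand) Strand"
    \<comment> \<open>The cups are nested: the cap on the second strand of \<open>f\<close> meets
      the outer cup and the cap on the first strand meets the inner one, so the order of the two
      upper ends is preserved.\<close>
    let ?x = "cup 3 1 (cup 2 0 h)"
    have c: "?y \<in> vec Z 2" "cup 2 0 h \<in> vec Z 4" "?x \<in> vec Z 6" "cup 2 0 ?y \<in> vec Z 4"
      using h by (auto intro!: layer_in_vec[OF f'] layer_gen_in_vec)
    have l: "layer SS SS f 0 4 ?x \<in> vec Z 6"
      "layer ?F ?F ((f \<otimes> \<i>\<d> ?X) \<otimes> \<i>\<d> ?X) 0 2 ?x \<in> vec Z 6"
      using c by (auto intro!: layer_in_vec[OF f'] layer_in_vec[OF t(3)])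
    have "0 = layer ?F Unit (bend f) 0 2 ?x"
      using zero_comp[OF c(3)[unfolded vec_def]] layer_smul[OF _ c(3), of 0 ?F Unit 0 2 0]
      by (simp add: 0 zero_in_hom)
    also have "\<dots> = layer ?F Unit (ev \<C> \<cdot> (?e \<otimes> \<i>\<d> ?X)) 0 2
        (layer ?F ?F ((f \<otimes> \<i>\<d> ?X) \<otimes> \<i>\<d> ?X) 0 2 ?x)"
      unfolding bend_def Let_def by (rule layer_comp[OF t(3) comp_in_hom[OF t(1) gen_in_hom_obj(1)] c(3)]) simp
    also have "\<dots> = cap 0 2 (layer ?F SS (?e \<otimes> \<i>\<d> ?X) 0 2 (layer ?F ?F ((f \<otimes> \<i>\<d> ?X) \<otimes> \<i>\<d> ?X) 0 2 ?x))"
      by (rule layer_comp[OF t(1) gen_in_hom_obj(1) l(2)]) simp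
    also have "layer ?F ?F ((f \<otimes> \<i>\<d> ?X) \<otimes> \<i>\<d> ?X) 0 2 ?x = layer SS SS f 0 4 ?x"
      using layer_tens_ident(1)[OF t(2) c(3), of 0 Strand 2]
        layer_tens_ident(1)[OF f' c(3), of 0 Strand 3] by (simp add: eval_nat_numeral)
    also have "layer ?F SS (?e \<otimes> \<i>\<d> ?X) 0 2 (layer SS SS f 0 4 ?x) = cap 1 3 (layer SS SS f 0 4 ?x)"
      using layer_tens_ident(1)[OF e l(1), of 0 Strand 2] e_eq[OF l(1), of 3] by (simp add: eval_nat_numeral)
    also have "layer SS SS f 0 4 ?x = cup 3 1 (layer SS SS f 0 2 (cup 2 0 h))"
      by (rule layer_commute[OF f' gen_in_hom_obj(2) c(2)]) simp_all
    also have "layer SS SS f 0 2 (cup 2 0 h) = cup 2 0 ?y"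
      by (rule layer_commute[OF f' gen_in_hom_obj(2) h]) simp_all
    also have "cap 1 3 (cup 3 1 (cup 2 0 ?y)) = cup 1 1 (cap 1 1 (cup 2 0 ?y))"
      by (rule layer_commute[OF gen_in_hom_obj(1,2) c(4)]) simp_all
    also have "cap 1 1 (cup 2 0 ?y) = ?y"
      using zigzag(2)[OF c(1), of 1 0] by (simp add: eval_nat_numeral)
    also have "cap 0 2 (cup 1 1 ?y) = ?y"
      using zigzag(2)[OF c(1), of 0 1] by (simp add: eval_nat_numeral)
    finally have "?y = 0" by simp
    moreover have "layer SS SS 0 0 0 h = 0"
      using layer_smul[OF f' h, of 0 0 0] by simp
    ultimately show "?y = layer SS SS 0 0 0 h" by simp
  qed (use f' zero_in_hom in auto)
qed

end

section \<open>Rotation\<close>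

locale exceptional_category = trivalent_ribbon_category \<C>
  for \<C> :: "('o, 'm::ab_group_add, complex, 'z) trivalent_structure_scheme" (structure) +
  fixes v \<alpha> d b t :: complex
  assumes QEJac: "QEJac \<C> v \<alpha> d b t"
begin

section \<open>Nonzero scalars and eigenvalues of the crossings\<close>

lemma vector_space: "vector_space (smul \<C>)"
  using module_axioms by (simp add: module_iff_vector_space)

lemma v_nonzero: "v \<noteq> 0"
  using QEJac by (simp add: QEJac_def)

lemma relations:
  "ev \<C> \<cdot> coev \<C> = d \<odot> \<i>\<d> \<one>" "merge \<C> \<cdot> coev \<C> = 0"
  "merge \<C> \<cdot> fork \<C> = b \<odot> \<i>\<d> (strand \<C>)" "dgm_H \<C> \<cdot> fork \<C> = t \<odot> fork \<C>"
  "neg_crossing \<C> \<cdot> fork \<C> = (- (v ^ 6)) \<odot> fork \<C>"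
  "neg_crossing \<C> \<cdot> coev \<C> = v ^ 12 \<odot> coev \<C>"
  using QEJac by (simp_all add: QEJac_def)

lemma smul_eq_0_iff: "r \<odot> f = 0 \<longleftrightarrow> r = 0 \<or> f = 0"
  by (rule vector_space.scale_eq_0_iff[OF vector_space])

lemma ident_unit_nonzero: "\<i>\<d> \<one> \<noteq> 0"
  using box_0(1) dependent_zero by auto

lemma ident_strand_nonzero: "\<i>\<d> (strand \<C>) \<noteq> 0"
proof
  assume "\<i>\<d> (strand \<C>) = 0"
  then have "\<i>\<d> (strand \<C> \<boxtimes> strand \<C>) = 0"
    using tens_smul_left[OF ident_in_hom ident_in_hom, of 0 "strand \<C>" "strand \<C>"]
    by (simp add: tens_ident[symmetric])
  then have "ev \<C> = 0"
    using comp_ident[OF ev_in_hom] comp_zero[OF ev_in_hom] by simp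
  then show False using box_2(1) dependent_zero by auto
qed

text \<open>If \<open>d\<close> or \<open>b\<close> vanished, a nonzero multiple of a nonzero
  identity morphism would vanish as well.\<close>

lemma d_nonzero: "d \<noteq> 0" and b_nonzero: "b \<noteq> 0"
  using circle_nonzero bigon_nonzero ident_unit_nonzero ident_strand_nonzero
  by (auto simp: relations smul_eq_0_iff)

lemma coev_nonzero: "coev \<C> \<noteq> 0"
  using relations(1) comp_zero[OF ev_in_hom] d_nonzero ident_unit_nonzero smul_eq_0_iff by metis

lemma fork_nonzero: "fork \<C> \<noteq> 0"
  using relations(3) comp_zero[OF merge_in_hom] b_nonzero ident_strand_nonzero smul_eq_0_iff by metis

lemma crossing_comp:
  "pos_crossing \<C> \<cdot> neg_crossing \<C> = dgm_one \<C>" "neg_crossing \<C> \<cdot> pos_crossing \<C> = dgm_one \<C>"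
  using braid_inverse[of "strand \<C>" "strand \<C>"]
  by (simp_all add: is_inverse_def pos_crossing_def neg_crossing_def dgm_one_def)

lemma pos_eigen:
  assumes f: "f \<in> hom \<C> A (strand \<C> \<boxtimes> strand \<C>)" and e: "neg_crossing \<C> \<cdot> f = r \<odot> f" "r \<noteq> 0"
  shows "pos_crossing \<C> \<cdot> f = inverse r \<odot> f"
proof -
  have "f = pos_crossing \<C> \<cdot> neg_crossing \<C> \<cdot> f"
    using comp_assoc[OF f crossing_in_hom(2) crossing_in_hom(1)] crossing_comp(1) ident_comp[OF f]
    by (simp add: dgm_one_def)
  also have "\<dots> = r \<odot> (pos_crossing \<C> \<cdot> f)"
    unfolding e(1) by (rule comp_smul_right[OF f crossing_in_hom(1)])
  finally show ?thesis using e(2) by (metis left_inverse scale_one scale_scale)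
qed

lemma pos_fork: "pos_crossing \<C> \<cdot> fork \<C> = (- (inverse v ^ 6)) \<odot> fork \<C>"
  using pos_eigen[OF fork_in_hom relations(5)] v_nonzero by (simp add: power_inverse)

lemma pos_coev: "pos_crossing \<C> \<cdot> coev \<C> = inverse v ^ 12 \<odot> coev \<C>"
  using pos_eigen[OF coev_in_hom relations(6)] v_nonzero by (simp add: power_inverse)

text \<open>Rank one makes the composite a multiple of \<open>merge\<close>. The factor is read off
  by composing with \<open>fork\<close>, an eigenvector of the crossing, because the bigon is
  nonzero. The circle plays this part for \<open>ev\<close>.\<close>

lemma merge_pos: "merge \<C> \<cdot> pos_crossing \<C> = (- (inverse v ^ 6)) \<odot> merge \<C>"
proof -
  obtain r where r: "merge \<C> \<cdot> pos_crossing \<C> = r \<odot> merge \<C>"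
    using hom_strands_strand[OF comp_in_hom[OF crossing_in_hom(1) merge_in_hom]] by blast
  have "(r * b) \<odot> \<i>\<d> (strand \<C>) = (merge \<C> \<cdot> pos_crossing \<C>) \<cdot> fork \<C>"
    unfolding r comp_smul_left[OF fork_in_hom merge_in_hom] by (simp add: relations)
  also have "\<dots> = merge \<C> \<cdot> pos_crossing \<C> \<cdot> fork \<C>"
    by (rule comp_assoc[OF fork_in_hom crossing_in_hom(1) merge_in_hom])
  also have "\<dots> = (- (inverse v ^ 6) * b) \<odot> \<i>\<d> (strand \<C>)"
    unfolding pos_fork comp_smul_right[OF fork_in_hom merge_in_hom] by (simp add: relations)
  finally have "r * b = - (inverse v ^ 6) * b"
    using vector_space.scale_cancel_right[OF vector_space] ident_strand_nonzero by blast
  then show ?thesis using r b_nonzero mult_right_cancel by metis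
qed

lemma ev_pos: "ev \<C> \<cdot> pos_crossing \<C> = inverse v ^ 12 \<odot> ev \<C>"
proof -
  obtain r where r: "ev \<C> \<cdot> pos_crossing \<C> = r \<odot> ev \<C>"
    using hom_strands_unit[OF comp_in_hom[OF crossing_in_hom(1) ev_in_hom]] by blast
  have "(r * d) \<odot> \<i>\<d> \<one> = (ev \<C> \<cdot> pos_crossing \<C>) \<cdot> coev \<C>"
    unfolding r comp_smul_left[OF coev_in_hom ev_in_hom] by (simp add: relations)
  also have "\<dots> = ev \<C> \<cdot> pos_crossing \<C> \<cdot> coev \<C>"
    by (rule comp_assoc[OF coev_in_hom crossing_in_hom(1) ev_in_hom])
  also have "\<dots> = (inverse v ^ 12 * d) \<odot> \<i>\<d> \<one>"
    unfolding pos_coev comp_smul_right[OF coev_in_hom ev_in_hom] by (simp add: relations)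
  finally have "r * d = inverse v ^ 12 * d"
    using vector_space.scale_cancel_right[OF vector_space] ident_unit_nonzero by blast
  then show ?thesis using r d_nonzero mult_right_cancel by metis
qed

lemma neg_coeigen:
  assumes f: "f \<in> hom \<C> (strand \<C> \<boxtimes> strand \<C>) A" and e: "f \<cdot> pos_crossing \<C> = r \<odot> f" "r \<noteq> 0"
  shows "f \<cdot> neg_crossing \<C> = inverse r \<odot> f"
proof -
  have "f = (f \<cdot> pos_crossing \<C>) \<cdot> neg_crossing \<C>"
    using comp_assoc[OF crossing_in_hom(2) crossing_in_hom(1) f] crossing_comp(1) comp_ident[OF f]
    by (simp add: dgm_one_def)
  also have "\<dots> = r \<odot> (f \<cdot> neg_crossing \<C>)"
    unfolding e(1) by (rule comp_smul_left[OF crossing_in_hom(2) f])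
  finally show ?thesis using e(2) by (metis left_inverse scale_one scale_scale)
qed

lemma merge_neg: "merge \<C> \<cdot> neg_crossing \<C> = (- (v ^ 6)) \<odot> merge \<C>"
  using neg_coeigen[OF merge_in_hom merge_pos] v_nonzero by (simp add: power_inverse)

lemma ev_neg: "ev \<C> \<cdot> neg_crossing \<C> = v ^ 12 \<odot> ev \<C>"
  using neg_coeigen[OF ev_in_hom ev_pos] v_nonzero by (simp add: power_inverse)

lemma layer_relations:
  assumes h: "h \<in> vec Z k"
  shows "k = n + 1 + j \<Longrightarrow> pos n j (frk n j h) = (- (inverse v ^ 6)) \<odot> frk n j h"
    "k = n + j \<Longrightarrow> pos n j (cup n j h) = inverse v ^ 12 \<odot> cup n j h"
    "k = n + 2 + j \<Longrightarrow> mrg n j (neg n j h) = (- (v ^ 6)) \<odot> mrg n j h"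
    "k = n + 1 + j \<Longrightarrow> mrg n j (frk n j h) = b \<odot> h"
proof -
  show "pos n j (frk n j h) = (- (inverse v ^ 6)) \<odot> frk n j h" if k: "k = n + 1 + j"
  proof -
    have "pos n j (frk n j h) = layer Strand SS (pos_crossing \<C> \<cdot> fork \<C>) n j h"
      by (rule layer_comp[symmetric, OF gen_in_hom_obj(7,4) h]) (simp add: k)
    also have "\<dots> = (- (inverse v ^ 6)) \<odot> frk n j h"
      unfolding pos_fork by (rule layer_smul[OF gen_in_hom_obj(7) h]) (simp add: k)
    finally show ?thesis .
  qed
  show "pos n j (cup n j h) = inverse v ^ 12 \<odot> cup n j h" if k: "k = n + j"
  proof -
    have "pos n j (cup n j h) = layer Unit SS (pos_crossing \<C> \<cdot> coev \<C>) n j h"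
      by (rule layer_comp[symmetric, OF gen_in_hom_obj(2,4) h]) (simp add: k)
    also have "\<dots> = inverse v ^ 12 \<odot> cup n j h"
      unfolding pos_coev by (rule layer_smul[OF gen_in_hom_obj(2) h]) (simp add: k)
    finally show ?thesis .
  qed
  show "mrg n j (neg n j h) = (- (v ^ 6)) \<odot> mrg n j h" if k: "k = n + 2 + j"
  proof -
    have "mrg n j (neg n j h) = layer SS Strand (merge \<C> \<cdot> neg_crossing \<C>) n j h"
      by (rule layer_comp[symmetric, OF gen_in_hom_obj(5,6) h]) (simp add: k)
    also have "\<dots> = (- (v ^ 6)) \<odot> mrg n j h"
      unfolding merge_neg by (rule layer_smul[OF gen_in_hom_obj(6) h]) (simp add: k)
    finally show ?thesis .
  qed
  show "mrg n j (frk n j h) = b \<odot> h" if k: "k = n + 1 + j"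
  proof -
    have "mrg n j (frk n j h) = layer Strand Strand (merge \<C> \<cdot> fork \<C>) n j h"
      by (rule layer_comp[symmetric, OF gen_in_hom_obj(7,6) h]) (simp add: k)
    also have "\<dots> = b \<odot> layer Strand Strand (\<i>\<d> (obj Strand)) n j h"
      unfolding relations obj.simps by (rule layer_smul[OF gen_in_hom_obj(9) h]) (simp add: k)
    also have "layer Strand Strand (\<i>\<d> (obj Strand)) n j h = h"
      by (rule layer_ident[OF h]) (simp add: k)
    finally show ?thesis .
  qed
qed

text \<open>Rotational invariance of the vertex. The crossing acts by scalars on \<open>coev\<close>, \<open>fork\<close> and
  \<open>merge\<close>, so a strand can be swung around the vertex and the resulting scalars cancel.\<close>

lemma frk_rotate:
  assumes h: "h \<in> vec Z k" and k: "k = n + 1 + j"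
  shows "mrg (Suc n) j (cup n (Suc j) h) = frk n j h"
proof -
  let ?w = "mrg (Suc n) j (cup n (Suc j) h)"
  have c: "cup n (Suc j) h \<in> vec Z (n + 3 + j)" "cup (Suc n) j h \<in> vec Z (n + 3 + j)"
    "?w \<in> vec Z (n + 2 + j)" "frk n j h \<in> vec Z (n + 2 + j)"
    "pos (Suc n) j (cup n (Suc j) h) \<in> vec Z (n + 3 + j)"
    using h k by (auto intro!: layer_gen_in_vec)
  have "pos n j ?w = mrg n (Suc j) (pos (Suc n) j (pos n (Suc j) (cup n (Suc j) h)))"
    by (rule pos_mrg[OF c(1)]) simp
  also have "pos n (Suc j) (cup n (Suc j) h) = inverse v ^ 12 \<odot> cup n (Suc j) h"
    by (rule layer_relations(2)[OF h]) (simp add: k)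
  also have "pos (Suc n) j \<dots> = inverse v ^ 12 \<odot> pos (Suc n) j (cup n (Suc j) h)"
    by (rule layer_smul_vec[OF gen_in_hom_obj(4) c(1)]) simp
  also have "mrg n (Suc j) \<dots> = inverse v ^ 12 \<odot> mrg n (Suc j) (pos (Suc n) j (cup n (Suc j) h))"
    by (rule layer_smul_vec[OF gen_in_hom_obj(6) c(5)]) simp
  also have "pos (Suc n) j (cup n (Suc j) h) = neg n (Suc j) (cup (Suc n) j h)"
    by (rule crossing_cup(2)[OF h k])
  also have "mrg n (Suc j) \<dots> = (- (v ^ 6)) \<odot> mrg n (Suc j) (cup (Suc n) j h)"
    by (rule layer_relations(3)[OF c(2)]) simp
  \<comment> \<open>The eigenvalues fit: v^-12 times -v^6 is -v^-6, the eigenvalue of the positive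
    crossing on \<open>fork\<close>. Hence both forks agree after a crossing, which is
    invertible.\<close>
  also have "inverse v ^ 12 \<odot> \<dots> = (- (inverse v ^ 6)) \<odot> mrg n (Suc j) (cup (Suc n) j h)"
  proof -
    have "inverse v ^ 12 * v ^ 6 = inverse v ^ 6"
      using v_nonzero by (simp add: field_simps flip: power_add)
    then show ?thesis by simp
  qed
  also have "mrg n (Suc j) (cup (Suc n) j h) = frk n j h"
    by (rule frk_eq[symmetric, OF h k])
  also have "(- (inverse v ^ 6)) \<odot> frk n j h = pos n j (frk n j h)"
    by (rule layer_relations(1)[symmetric, OF h k])
  finally show ?thesis
    using crossing_inverse(1)[OF c(3)] crossing_inverse(1)[OF c(4)] by metis
qed

text \<open>Capping the right end uses the definition of \<open>fork\<close> and a zigzag; capping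
  the left end uses its mirrored form \<open>frk_rotate\<close>.\<close>

lemma cap_frk:
  assumes h: "h \<in> vec Z k" and k: "k = n + 2 + j"
  shows "cap (Suc n) j (frk n (Suc j) h) = mrg n j h" "cap n (Suc j) (frk (Suc n) j h) = mrg n j h"
proof -
  have c: "cup (Suc n) (Suc j) h \<in> vec Z (n + 4 + j)"
    using h k by (auto intro!: layer_gen_in_vec)
  have "cap (Suc n) j (frk n (Suc j) h) = cap (Suc n) j (mrg n (Suc (Suc j)) (cup (Suc n) (Suc j) h))"
    by (subst frk_eq[OF h]) (simp_all add: k)
  also have "\<dots> = mrg n j (cap (Suc (Suc n)) j (cup (Suc n) (Suc j) h))"
    by (rule layer_commute[symmetric, OF gen_in_hom_obj(6,1) c]) simp_all
  also have "cap (Suc (Suc n)) j (cup (Suc n) (Suc j) h) = h"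
    by (rule zigzag(1)[OF h]) (simp add: k)
  finally show "cap (Suc n) j (frk n (Suc j) h) = mrg n j h" .
  have "cap n (Suc j) (frk (Suc n) j h) = cap n (Suc j) (mrg (Suc (Suc n)) j (cup (Suc n) (Suc j) h))"
    by (subst frk_rotate[OF h]) (simp_all add: k)
  also have "\<dots> = mrg n j (cap n (Suc (Suc j)) (cup (Suc n) (Suc j) h))"
    by (rule layer_commute[OF gen_in_hom_obj(1,6) c]) simp_all
  also have "cap n (Suc (Suc j)) (cup (Suc n) (Suc j) h) = h"
    by (rule zigzag(2)[OF h]) (simp add: k)
  finally show "cap n (Suc j) (frk (Suc n) j h) = mrg n j h" .
qed

text \<open>Both sides arise by forking the middle one of three strands and capping the two new ends
  with the neighbours; the two caps may be taken in either order.\<close>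

lemma cap_mrg:
  assumes h: "h \<in> vec Z k" and k: "k = n + 3 + j"
  shows "cap n j (mrg n (Suc j) h) = cap n j (mrg (Suc n) j h)"
proof -
  have c: "frk (Suc n) (Suc j) h \<in> vec Z (n + 4 + j)"
    using h k by (auto intro!: layer_gen_in_vec)
  have "mrg n (Suc j) h = cap n (Suc (Suc j)) (frk (Suc n) (Suc j) h)"
    by (rule cap_frk(2)[symmetric, OF h]) (simp add: k)
  also have "cap n j \<dots> = cap n j (cap (Suc (Suc n)) j (frk (Suc n) (Suc j) h))"
    by (rule layer_commute[symmetric, OF gen_in_hom_obj(1,1) c]) simp_all
  also have "cap (Suc (Suc n)) j (frk (Suc n) (Suc j) h) = mrg (Suc n) j h"
    by (rule cap_frk(1)[OF h]) (simp add: k)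
  finally show ?thesis .
qed

lemma frk_cup:
  assumes h: "h \<in> vec Z k" and k: "k = n + j"
  shows "frk n (Suc j) (cup n j h) = frk (Suc n) j (cup n j h)"
proof -
  have c: "cup n j h \<in> vec Z (n + 2 + j)"
    using h k by (auto intro!: layer_gen_in_vec)
  have "frk n (Suc j) (cup n j h) = mrg (Suc n) (Suc j) (cup n (Suc (Suc j)) (cup n j h))"
    by (rule frk_rotate[symmetric, OF c]) simp
  also have "cup n (Suc (Suc j)) (cup n j h) = cup (Suc (Suc n)) j (cup n j h)"
    by (rule layer_commute[OF gen_in_hom_obj(2,2) h]) (simp_all add: k)
  also have "mrg (Suc n) (Suc j) \<dots> = frk (Suc n) j (cup n j h)"
    by (rule frk_eq[symmetric, OF c]) simp
  finally show ?thesis .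
qed

text \<open>The end of the rung on the right leg of the cup slides to the left leg. The right leg
  then merges with the next strand, which is a fork by \<open>frk_rotate\<close>.\<close>

lemma rung_cup:
  assumes h: "h \<in> vec Z k" and k: "k = n + 1 + j"
  shows "rung (Suc n) j (cup n (Suc j) h) = frk n (Suc j) (frk n j h)"
proof -
  have c: "cup n (Suc j) h \<in> vec Z (n + 3 + j)"
    using h k by (auto intro!: layer_gen_in_vec)
  have "rung (Suc n) j (cup n (Suc j) h) = mrg (Suc (Suc n)) j (frk (Suc n) (Suc j) (cup n (Suc j) h))"
    by (rule rung_eq[OF c]) simp
  also have "frk (Suc n) (Suc j) (cup n (Suc j) h) = frk n (Suc (Suc j)) (cup n (Suc j) h)"
    by (rule frk_cup[symmetric, OF h]) (simp add: k)
  also have "mrg (Suc (Suc n)) j \<dots> = frk n (Suc j) (mrg (Suc n) j (cup n (Suc j) h))"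
    by (rule layer_commute[symmetric, OF gen_in_hom_obj(7,6) c]) simp_all
  also have "mrg (Suc n) j (cup n (Suc j) h) = frk n j h" by (rule frk_rotate[OF h k])
  finally show ?thesis .
qed

lemma cap_rung:
  assumes h: "h \<in> vec Z k" and k: "k = n + 3 + j"
  shows "cap (Suc n) j (rung n (Suc j) h) = mrg n j (mrg (Suc n) j h)"
proof -
  have c: "frk n (Suc (Suc j)) h \<in> vec Z (n + 4 + j)" "mrg (Suc n) j h \<in> vec Z (n + 2 + j)"
    using h k by (auto intro!: layer_gen_in_vec)
  have "rung n (Suc j) h = mrg (Suc n) (Suc j) (frk n (Suc (Suc j)) h)"
    by (rule rung_eq[OF h]) (simp add: k)
  also have "cap (Suc n) j \<dots> = cap (Suc n) j (mrg (Suc (Suc n)) j (frk n (Suc (Suc j)) h))"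
    by (rule cap_mrg[OF c(1)]) simp
  also have "mrg (Suc (Suc n)) j (frk n (Suc (Suc j)) h) = frk n (Suc j) (mrg (Suc n) j h)"
    by (rule layer_commute[symmetric, OF gen_in_hom_obj(7,6) h]) (simp_all add: k)
  also have "cap (Suc n) j \<dots> = mrg n j (mrg (Suc n) j h)" by (rule cap_frk(1)[OF c(2)]) simp
  finally show ?thesis .
qed

text \<open>Sliding one end of the rung along the cup creates a bigon, whence the value
  \<open>b\<close>.\<close>

lemma dgm_H_coev: "dgm_H \<C> \<cdot> coev \<C> = b \<odot> coev \<C>"
proof (rule layer_faithful)
  fix Z h assume h: "h \<in> vec Z (width Unit)"
  have c: "cup 0 0 h \<in> vec Z 2" using h by (auto intro!: layer_gen_in_vec)
  have "layer Unit SS (dgm_H \<C> \<cdot> coev \<C>) 0 0 h = rung 0 0 (cup 0 0 h)"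
    by (rule layer_comp[OF gen_in_hom_obj(2,8) h]) simp
  also have "\<dots> = mrg (Suc 0) 0 (frk 0 (Suc 0) (cup 0 0 h))" by (rule rung_eq[OF c]) simp
  also have "frk 0 (Suc 0) (cup 0 0 h) = frk (Suc 0) 0 (cup 0 0 h)" by (rule frk_cup[OF h]) simp
  also have "mrg (Suc 0) 0 \<dots> = b \<odot> cup 0 0 h" by (rule layer_relations(4)[OF c]) simp
  also have "\<dots> = layer Unit SS (b \<odot> coev \<C>) 0 0 h"
    by (rule layer_smul[symmetric, OF gen_in_hom_obj(2) h]) simp
  finally show "layer Unit SS (dgm_H \<C> \<cdot> coev \<C>) 0 0 h = layer Unit SS (b \<odot> coev \<C>) 0 0 h" .
qed (use comp_in_hom[OF gen_in_hom_obj(2,8)] smul_in_hom[OF gen_in_hom_obj(2)] in auto)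

text \<open>\<open>rotates f g\<close>: turning the diagram \<open>f\<close> by a quarter gives \<open>g\<close>.\<close>

definition rotates :: "'m \<Rightarrow> 'm \<Rightarrow> bool" where
  "rotates f g \<longleftrightarrow> f \<in> hom \<C> (obj SS) (obj SS) \<and> g \<in> hom \<C> (obj SS) (obj SS) \<and>
    (\<forall>Z. \<forall>h \<in> vec Z 2. cap 2 0 (layer SS SS f 1 1 (cup 0 2 h)) = layer SS SS g 0 0 h)"

lemma rotates_unique: "rotates f g \<Longrightarrow> rotates f g' \<Longrightarrow> g = g'"
  unfolding rotates_def by (rule layer_faithful[where A = SS and B = SS]) (auto simp: numeral_2_eq_2)

lemma rotates_add:
  assumes "rotates f g" "rotates f' g'" shows "rotates (f + f') (g + g')"
proof -
  have t: "f \<in> hom \<C> (obj SS) (obj SS)" "g \<in> hom \<C> (obj SS) (obj SS)"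
    "f' \<in> hom \<C> (obj SS) (obj SS)" "g' \<in> hom \<C> (obj SS) (obj SS)"
    using assms by (auto simp: rotates_def)
  have "cap 2 0 (layer SS SS (f + f') 1 1 (cup 0 2 h)) = layer SS SS (g + g') 0 0 h"
    if h: "h \<in> vec Z 2" for Z h
  proof -
    have c: "cup 0 2 h \<in> vec Z 4" "layer SS SS f 1 1 (cup 0 2 h) \<in> vec Z 4"
      "layer SS SS f' 1 1 (cup 0 2 h) \<in> vec Z 4"
      using h by (auto intro!: layer_gen_in_vec layer_in_vec[OF t(1)] layer_in_vec[OF t(3)])
    show ?thesis
      using assms h layer_add[OF t(1,3) c(1), of 1 1] layer_add[OF t(2,4) h, of 0 0]
        layer_add_vec[OF gen_in_hom_obj(1) c(2,3), of 2 0] by (simp add: rotates_def)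
  qed
  then show ?thesis using t unfolding rotates_def by (blast intro: add_in_hom)
qed

lemma rotates_smul:
  assumes "rotates f g" shows "rotates (r \<odot> f) (r \<odot> g)"
proof -
  have t: "f \<in> hom \<C> (obj SS) (obj SS)" "g \<in> hom \<C> (obj SS) (obj SS)"
    using assms by (auto simp: rotates_def)
  have "cap 2 0 (layer SS SS (r \<odot> f) 1 1 (cup 0 2 h)) = layer SS SS (r \<odot> g) 0 0 h"
    if h: "h \<in> vec Z 2" for Z h
  proof -
    have c: "cup 0 2 h \<in> vec Z 4" "layer SS SS f 1 1 (cup 0 2 h) \<in> vec Z 4"
      using h by (auto intro!: layer_gen_in_vec layer_in_vec[OF t(1)])
    show ?thesis
      using assms h layer_smul[OF t(1) c(1), of 1 1] layer_smul[OF t(2) h, of 0 0]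
        layer_smul_vec[OF gen_in_hom_obj(1) c(2), of 2 0] by (simp add: rotates_def)
  qed
  then show ?thesis using t unfolding rotates_def by (blast intro: smul_in_hom)
qed

lemma dgm_in_hom:
  "dgm_one \<C> \<in> hom \<C> (obj SS) (obj SS)" "dgm_U \<C> \<in> hom \<C> (obj SS) (obj SS)"
  "dgm_I \<C> \<in> hom \<C> (obj SS) (obj SS)" "dgm_S \<C> \<in> hom \<C> (obj SS) (obj SS)"
  unfolding dgm_one_def dgm_U_def dgm_I_def dgm_S_def obj.simps by (rule hom_intros gen_in_hom)+

lemma layer_dgm:
  assumes h: "h \<in> vec Z k" and k: "k = n + 2 + j"
  shows "layer SS SS (dgm_one \<C>) n j h = h"
    "layer SS SS (dgm_U \<C>) n j h = cup n j (cap n j h)"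
    "layer SS SS (dgm_I \<C>) n j h = frk n j (mrg n j h)"
    "layer SS SS (dgm_S \<C>) n j h = rung n j (rung n j h)"
  unfolding dgm_one_def dgm_U_def dgm_I_def dgm_S_def
  using layer_ident[OF h, of n SS j] layer_comp[OF gen_in_hom_obj(1,2) h, of n j]
    layer_comp[OF gen_in_hom_obj(6,7) h, of n j] layer_comp[OF gen_in_hom_obj(8,8) h, of n j]
  by (simp_all add: k)

text \<open>The diagram stands between a cup opening on its left and a cap closing on its right.
  Zigzags settle \<one> and U, the fork and rung identities settle I and H, and a crossing is moved
  to the other leg of the cup, which inverts it.\<close>

lemma rotates_dgm:
  "rotates (dgm_one \<C>) (dgm_U \<C>)" "rotates (dgm_U \<C>) (dgm_one \<C>)"
  "rotates (dgm_I \<C>) (dgm_H \<C>)" "rotates (dgm_H \<C>) (dgm_I \<C>)"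
  "rotates (neg_crossing \<C>) (pos_crossing \<C>)" "rotates (pos_crossing \<C>) (neg_crossing \<C>)"
  "rotates (dgm_S \<C>) (dgm_S \<C>)"
proof -
  note num = eval_nat_numeral
  have "cap 2 0 (layer SS SS (dgm_one \<C>) 1 1 (cup 0 2 h)) = layer SS SS (dgm_U \<C>) 0 0 h \<and>
    cap 2 0 (layer SS SS (dgm_U \<C>) 1 1 (cup 0 2 h)) = layer SS SS (dgm_one \<C>) 0 0 h \<and>
    cap 2 0 (layer SS SS (dgm_I \<C>) 1 1 (cup 0 2 h)) = rung 0 0 h \<and>
    cap 2 0 (rung 1 1 (cup 0 2 h)) = layer SS SS (dgm_I \<C>) 0 0 h \<and>
    cap 2 0 (neg 1 1 (cup 0 2 h)) = pos 0 0 h \<and>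
    cap 2 0 (pos 1 1 (cup 0 2 h)) = neg 0 0 h \<and>
    cap 2 0 (layer SS SS (dgm_S \<C>) 1 1 (cup 0 2 h)) = layer SS SS (dgm_S \<C>) 0 0 h"
    if h: "h \<in> vec Z 2" for Z h
  proof (intro conjI)
    have c: "cup 0 2 h \<in> vec Z 4" "cup 1 1 h \<in> vec Z 4" "frk 0 1 h \<in> vec Z 3" "rung 0 0 h \<in> vec Z 2"
      using h by (auto intro!: layer_gen_in_vec)
    have c': "frk 0 2 (frk 0 1 h) \<in> vec Z 4" "mrg 1 0 (frk 0 1 h) \<in> vec Z 2"
      using h by (auto intro!: layer_gen_in_vec)
    have zz: "cap 2 0 (cup 1 1 h) = h" "cap 1 1 (cup 0 2 h) = h"
      using zigzag(1)[OF h, of 1 0] zigzag(1)[OF h, of 0 1] by (simp_all add: num)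
    have rung: "rung 0 0 h = mrg 1 0 (frk 0 1 h)" if "h \<in> vec Z 2" for h
      using rung_eq[OF that, of 0 0] by simp
    have rung_c: "rung 1 1 (cup 0 2 h) = frk 0 2 (frk 0 1 h)"
      using rung_cup[OF h, of 0 1] by (simp add: num)
    have "cap 2 0 (cup 0 2 h) = cup 0 0 (cap 0 0 h)"
      by (rule layer_commute[symmetric, OF gen_in_hom_obj(2,1) h]) simp_all
    then show "cap 2 0 (layer SS SS (dgm_one \<C>) 1 1 (cup 0 2 h)) = layer SS SS (dgm_U \<C>) 0 0 h"
      using layer_dgm(1)[OF c(1), of 1 1] layer_dgm(2)[OF h, of 0 0] by simp
    show "cap 2 0 (layer SS SS (dgm_U \<C>) 1 1 (cup 0 2 h)) = layer SS SS (dgm_one \<C>) 0 0 h"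
      using layer_dgm(2)[OF c(1), of 1 1] layer_dgm(1)[OF h, of 0 0] zz by simp
    show "cap 2 0 (layer SS SS (dgm_I \<C>) 1 1 (cup 0 2 h)) = rung 0 0 h"
      using layer_dgm(3)[OF c(1), of 1 1] frk_rotate[OF h, of 0 1] cap_frk(1)[OF c(3), of 1 0] rung[OF h]
      by (simp add: num)
    have "cap 2 0 (frk 0 2 (frk 0 1 h)) = frk 0 0 (cap 1 0 (frk 0 1 h))"
      by (rule layer_commute[symmetric, OF gen_in_hom_obj(7,1) c(3)]) simp_all
    then show "cap 2 0 (rung 1 1 (cup 0 2 h)) = layer SS SS (dgm_I \<C>) 0 0 h"
      using layer_dgm(3)[OF h, of 0 0] cap_frk(1)[OF h, of 0 0] by (simp add: rung_c[unfolded One_nat_def])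
    have "cap 2 0 (pos 0 2 (cup 1 1 h)) = pos 0 0 (cap 2 0 (cup 1 1 h))"
      by (rule layer_commute[symmetric, OF gen_in_hom_obj(4,1) c(2)]) simp_all
    then show "cap 2 0 (neg 1 1 (cup 0 2 h)) = pos 0 0 h"
      using crossing_cup(1)[OF h, of 0 1] zz by (simp add: num)
    have "cap 2 0 (neg 0 2 (cup 1 1 h)) = neg 0 0 (cap 2 0 (cup 1 1 h))"
      by (rule layer_commute[symmetric, OF gen_in_hom_obj(5,1) c(2)]) simp_all
    then show "cap 2 0 (pos 1 1 (cup 0 2 h)) = neg 0 0 h"
      using crossing_cup(2)[OF h, of 0 1] zz by (simp add: num)
    \<comment> \<open>For the square, the lower rung has become two forks and the upper one becomes
      two merges. Exchanging the middle merge and fork regroups these four vertices into two rungs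
      again.\<close>
    have "cap 2 0 (rung 1 1 (frk 0 2 (frk 0 1 h))) = mrg 1 0 (mrg 2 0 (frk 0 2 (frk 0 1 h)))"
      using cap_rung[OF c'(1), of 1 0] by (simp add: num)
    also have "mrg 2 0 (frk 0 2 (frk 0 1 h)) = frk 0 1 (mrg 1 0 (frk 0 1 h))"
      by (rule layer_commute[symmetric, OF gen_in_hom_obj(7,6) c(3)]) simp_all
    also have "mrg 1 0 \<dots> = rung 0 0 (rung 0 0 h)" using rung[OF h] rung[OF c(4)] by simp
    finally show "cap 2 0 (layer SS SS (dgm_S \<C>) 1 1 (cup 0 2 h)) = layer SS SS (dgm_S \<C>) 0 0 h"
      using layer_dgm(4)[OF c(1), of 1 1] layer_dgm(4)[OF h, of 0 0] by (simp add: rung_c[unfolded One_nat_def])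
  qed
  then show "rotates (dgm_one \<C>) (dgm_U \<C>)" "rotates (dgm_U \<C>) (dgm_one \<C>)"
    "rotates (dgm_I \<C>) (dgm_H \<C>)" "rotates (dgm_H \<C>) (dgm_I \<C>)"
    "rotates (neg_crossing \<C>) (pos_crossing \<C>)" "rotates (pos_crossing \<C>) (neg_crossing \<C>)"
    "rotates (dgm_S \<C>) (dgm_S \<C>)"
    unfolding rotates_def using dgm_in_hom gen_in_hom_obj by blast+
qed

end

section \<open>Relations among diagrams\<close>

text \<open>Stated for families rather than sets because different diagrams may coincide as
  morphisms; a repetition is related by the coefficients 1 and -1.\<close>

lemma (in vector_space) dependent_family:
  assumes fin: "finite T" "V \<subseteq> span T" and f: "\<And>i. i < n \<Longrightarrow> f i \<in> V" and dim: "dim V < n"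
  obtains c where "\<exists>i<n. c i \<noteq> 0" "(\<Sum>i<n. scale (c i) (f i)) = 0"
proof (cases "inj_on f {..<n}")
  case True
  obtain B where B: "B \<subseteq> V" "independent B" "V \<subseteq> span B" "card B = dim V"
    using basis_exists by blast
  \<comment> \<open>An infinite basis would have cardinality 0 and make the bound on
    \<open>dim\<close> meaningless; the finite spanning set excludes it.\<close>
  have "finite B" using independent_span_bound[OF fin(1) B(2)] B(1) fin(2) by auto
  have "dependent (f ` {..<n})"
  proof (rule ccontr)
    assume "independent (f ` {..<n})"
    moreover have "f ` {..<n} \<subseteq> span B" using f B(3) by auto
    ultimately have "card (f ` {..<n}) \<le> card B"
      using independent_span_bound[OF \<open>finite B\<close>] by blast
    then show False using dim B(4) card_image[OF True] by simp
  qed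
  then obtain u where "\<exists>x \<in> f ` {..<n}. u x \<noteq> 0" "(\<Sum>x\<in>f ` {..<n}. scale (u x) x) = 0"
    by (auto simp: dependent_finite)
  then show ?thesis
    by (intro that[of "\<lambda>i. u (f i)"]) (auto simp: sum.reindex[OF True])
next
  case False
  then obtain i j where ij: "i < n" "j < n" "i \<noteq> j" "f i = f j" by (auto simp: inj_on_def)
  define c where "c k = (if k = i then 1 else 0) - (if k = j then 1 else 0 :: 'a)" for k
  have "scale (c k) (f k) = (if k = i then f i else 0) - (if k = j then f j else 0)" for k
    by (simp add: c_def scale_left_diff_distrib)
  then have "(\<Sum>k<n. scale (c k) (f k)) = 0"
    using ij by (simp add: sum_subtractf)
  moreover have "c i \<noteq> 0" using ij(3) by (simp add: c_def)
  ultimately show ?thesis using ij(1) by (intro that[of c]) auto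
qed

section \<open>Linear combinations of the seven diagrams and their products\<close>

context exceptional_category begin

text \<open>The order is chosen so that the quarter turn exchanges the coefficients within the pairs
  (1,2), (3,4), (5,6) and fixes the last one.\<close>

definition comb :: "complex \<Rightarrow> complex \<Rightarrow> complex \<Rightarrow> complex \<Rightarrow> complex \<Rightarrow> complex \<Rightarrow> complex \<Rightarrow> 'm" where
  "comb a1 a2 a3 a4 a5 a6 a7 = a1 \<odot> dgm_one \<C> + a2 \<odot> dgm_U \<C> + a3 \<odot> dgm_I \<C> + a4 \<odot> dgm_H \<C>
    + a5 \<odot> neg_crossing \<C> + a6 \<odot> pos_crossing \<C> + a7 \<odot> dgm_S \<C>"

lemmas end_in_hom = dgm_in_hom[unfolded obj.simps] crossing_in_hom dgm_H_in_hom

lemma comb_in_hom: "comb a1 a2 a3 a4 a5 a6 a7 \<in> hom \<C> (strand \<C> \<boxtimes> strand \<C>) (strand \<C> \<boxtimes> strand \<C>)"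
  unfolding comb_def by (intro add_in_hom smul_in_hom end_in_hom)

lemma comb_add: "comb a1 a2 a3 a4 a5 a6 a7 + comb b1 b2 b3 b4 b5 b6 b7
    = comb (a1 + b1) (a2 + b2) (a3 + b3) (a4 + b4) (a5 + b5) (a6 + b6) (a7 + b7)"
  by (simp add: comb_def scale_left_distrib)

lemma comb_smul: "r \<odot> comb a1 a2 a3 a4 a5 a6 a7
    = comb (r * a1) (r * a2) (r * a3) (r * a4) (r * a5) (r * a6) (r * a7)"
  by (simp add: comb_def scale_right_distrib)

lemma comb_axpy:
  assumes "comb a1 a2 a3 a4 a5 a6 a7 = 0" "comb b1 b2 b3 b4 b5 b6 b7 = 0"
  shows "comb (a1 + r * b1) (a2 + r * b2) (a3 + r * b3) (a4 + r * b4) (a5 + r * b5) (a6 + r * b6)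
    (a7 + r * b7) = 0"
  using assms by (simp flip: comb_add comb_smul)

lemma comb_scale:
  assumes "comb a1 a2 a3 a4 a5 a6 a7 = 0"
  shows "comb (r * a1) (r * a2) (r * a3) (r * a4) (r * a5) (r * a6) (r * a7) = 0"
  using assms by (simp flip: comb_smul)

text \<open>The turn is linear and single-valued, so it sends 0 to 0.\<close>

lemma comb_rotate:
  assumes "comb a1 a2 a3 a4 a5 a6 a7 = 0"
  shows "comb a2 a1 a4 a3 a6 a5 a7 = 0"
proof -
  have "rotates (comb a1 a2 a3 a4 a5 a6 a7) (a1 \<odot> dgm_U \<C> + a2 \<odot> dgm_one \<C> + a3 \<odot> dgm_H \<C> + a4 \<odot> dgm_I \<C>
    + a5 \<odot> pos_crossing \<C> + a6 \<odot> neg_crossing \<C> + a7 \<odot> dgm_S \<C>)"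
    unfolding comb_def by (intro rotates_add rotates_smul rotates_dgm)
  also have "a1 \<odot> dgm_U \<C> + a2 \<odot> dgm_one \<C> + a3 \<odot> dgm_H \<C> + a4 \<odot> dgm_I \<C>
    + a5 \<odot> pos_crossing \<C> + a6 \<odot> neg_crossing \<C> + a7 \<odot> dgm_S \<C> = comb a2 a1 a4 a3 a6 a5 a7"
    by (simp add: comb_def add_ac)
  finally have "rotates 0 (comb a2 a1 a4 a3 a6 a5 a7)" by (simp add: assms)
  moreover have "rotates 0 0" using rotates_smul[OF rotates_dgm(1), of 0] by simp
  ultimately show ?thesis by (rule rotates_unique)
qed

lemma comb_comp:
  assumes "k \<in> hom \<C> Z (strand \<C> \<boxtimes> strand \<C>)"
  shows "comb a1 a2 a3 a4 a5 a6 a7 \<cdot> k = a1 \<odot> k + a2 \<odot> (coev \<C> \<cdot> ev \<C> \<cdot> k) + a3 \<odot> (fork \<C> \<cdot> merge \<C> \<cdot> k)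
    + a4 \<odot> (dgm_H \<C> \<cdot> k) + a5 \<odot> (neg_crossing \<C> \<cdot> k) + a6 \<odot> (pos_crossing \<C> \<cdot> k)
    + a7 \<odot> (dgm_H \<C> \<cdot> dgm_H \<C> \<cdot> k)"
proof -
  have "dgm_one \<C> \<cdot> k = k" "dgm_U \<C> \<cdot> k = coev \<C> \<cdot> ev \<C> \<cdot> k" "dgm_I \<C> \<cdot> k = fork \<C> \<cdot> merge \<C> \<cdot> k"
    "dgm_S \<C> \<cdot> k = dgm_H \<C> \<cdot> dgm_H \<C> \<cdot> k"
    using ident_comp[OF assms] comp_assoc[OF assms ev_in_hom coev_in_hom]
      comp_assoc[OF assms merge_in_hom fork_in_hom] comp_assoc[OF assms dgm_H_in_hom dgm_H_in_hom]
    by (simp_all add: dgm_one_def dgm_U_def dgm_I_def dgm_S_def)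
  then show ?thesis
    by (simp add: comb_def comp_add_left[OF assms, where D = "strand \<C> \<boxtimes> strand \<C>"]
        comp_smul_left[OF assms, where D = "strand \<C> \<boxtimes> strand \<C>"] end_in_hom
        smul_in_hom add_in_hom)
qed

lemma comp_comb:
  assumes "k \<in> hom \<C> (strand \<C> \<boxtimes> strand \<C>) Z"
  shows "k \<cdot> comb a1 a2 a3 a4 a5 a6 a7 = a1 \<odot> k + a2 \<odot> ((k \<cdot> coev \<C>) \<cdot> ev \<C>) + a3 \<odot> ((k \<cdot> fork \<C>) \<cdot> merge \<C>)
    + a4 \<odot> (k \<cdot> dgm_H \<C>) + a5 \<odot> (k \<cdot> neg_crossing \<C>) + a6 \<odot> (k \<cdot> pos_crossing \<C>)
    + a7 \<odot> (k \<cdot> dgm_S \<C>)"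
proof -
  have "k \<cdot> dgm_one \<C> = k" "k \<cdot> dgm_U \<C> = (k \<cdot> coev \<C>) \<cdot> ev \<C>" "k \<cdot> dgm_I \<C> = (k \<cdot> fork \<C>) \<cdot> merge \<C>"
    using comp_ident[OF assms] comp_assoc[OF ev_in_hom coev_in_hom assms]
      comp_assoc[OF merge_in_hom fork_in_hom assms]
    by (simp_all add: dgm_one_def dgm_U_def dgm_I_def)
  then show ?thesis
    by (simp add: comb_def comp_add_right[OF _ _ assms, where A = "strand \<C> \<boxtimes> strand \<C>"]
        comp_smul_right[OF _ assms, where A = "strand \<C> \<boxtimes> strand \<C>"] end_in_hom
        smul_in_hom add_in_hom)
qed

text \<open>The composite lies in \<C>(1), which is zero.\<close>

lemma ev_fork: "ev \<C> \<cdot> fork \<C> = 0"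
  using comp_in_hom[OF fork_in_hom ev_in_hom] box_1 by (auto simp: box_def)

lemma comb_coev: "comb a1 a2 a3 a4 a5 a6 0 \<cdot> coev \<C>
    = (a1 + a2 * d + a4 * b + a5 * v ^ 12 + a6 * inverse v ^ 12) \<odot> coev \<C>"
proof -
  have "coev \<C> \<cdot> ev \<C> \<cdot> coev \<C> = d \<odot> coev \<C>"
    by (simp add: relations comp_smul_right[OF ident_in_hom coev_in_hom] comp_ident[OF coev_in_hom])
  then show ?thesis
    unfolding comb_comp[OF coev_in_hom]
    by (simp add: relations dgm_H_coev pos_coev comp_zero[OF fork_in_hom] scale_left_distrib)
qed

lemma comb_fork: "comb a1 a2 a3 a4 a5 a6 0 \<cdot> fork \<C>
    = (a1 + a3 * b + a4 * t - a5 * v ^ 6 - a6 * inverse v ^ 6) \<odot> fork \<C>"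
proof -
  have "fork \<C> \<cdot> merge \<C> \<cdot> fork \<C> = b \<odot> fork \<C>"
    by (simp add: relations comp_smul_right[OF ident_in_hom fork_in_hom] comp_ident[OF fork_in_hom])
  then show ?thesis
    unfolding comb_comp[OF fork_in_hom]
    by (simp add: relations ev_fork pos_fork comp_zero[OF coev_in_hom] scale_left_distrib
        scale_left_diff_distrib)
qed

text \<open>The nonzero morphisms \<open>coev\<close> and \<open>fork\<close> are common
  eigenvectors of the six diagrams under composition, so every relation yields two scalar
  equations.\<close>

lemma comb_scalars:
  assumes "comb a1 a2 a3 a4 a5 a6 0 = 0"
  shows "a1 + a2 * d + a4 * b + a5 * v ^ 12 + a6 * inverse v ^ 12 = 0"
    "a1 + a3 * b + a4 * t - a5 * v ^ 6 - a6 * inverse v ^ 6 = 0"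
  using comb_coev[of a1 a2 a3 a4 a5 a6] comb_fork[of a1 a2 a3 a4 a5 a6] coev_nonzero fork_nonzero
  by (simp_all add: assms zero_comp[OF coev_in_hom] zero_comp[OF fork_in_hom] smul_eq_0_iff)

lemma H_neg: "dgm_H \<C> \<cdot> neg_crossing \<C>
    = comb (- (\<alpha> * inverse v)) (- (\<alpha> * v ^ 7)) (- (v ^ 4)) (v ^ 2) (- (\<alpha> * v ^ 3)) 0 0"
proof -
  let ?E = "inverse v ^ 3 \<odot> (dgm_H \<C> \<cdot> neg_crossing \<C>)"
  have "0 = v ^ 3 \<odot> (?E + v \<odot> dgm_I \<C> - inverse v \<odot> dgm_H \<C>
      + \<alpha> \<odot> (neg_crossing \<C> + v ^ 4 \<odot> dgm_U \<C> + inverse v ^ 4 \<odot> dgm_one \<C>))"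
    using QEJac by (simp add: QEJac_def power_int_minus power_inverse)
  also have "\<dots> = dgm_H \<C> \<cdot> neg_crossing \<C> + v ^ 4 \<odot> dgm_I \<C> - v ^ 2 \<odot> dgm_H \<C>
      + (\<alpha> * v ^ 3) \<odot> neg_crossing \<C> + (\<alpha> * v ^ 7) \<odot> dgm_U \<C> + (\<alpha> * inverse v) \<odot> dgm_one \<C>"
  proof -
    have c: "v ^ 3 * inverse v ^ 3 = 1" "v ^ 3 * v = v ^ 4" "v ^ 3 * inverse v = v ^ 2"
      "v ^ 3 * (\<alpha> * v ^ 4) = \<alpha> * v ^ 7" "v ^ 3 * (\<alpha> * inverse v ^ 4) = \<alpha> * inverse v" "v ^ 3 * \<alpha> = \<alpha> * v ^ 3"
      using v_nonzero by (simp_all add: field_simps eval_nat_numeral)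
    show ?thesis
      by (simp only: scale_right_distrib scale_right_diff_distrib scale_scale scale_one c) (simp add: add_ac)
  qed
  finally have "dgm_H \<C> \<cdot> neg_crossing \<C> = v ^ 2 \<odot> dgm_H \<C> - v ^ 4 \<odot> dgm_I \<C>
      - (\<alpha> * v ^ 3) \<odot> neg_crossing \<C> - (\<alpha> * v ^ 7) \<odot> dgm_U \<C> - (\<alpha> * inverse v) \<odot> dgm_one \<C>"
    by (simp add: algebra_simps eq_neg_iff_add_eq_0)
  then show ?thesis by (simp add: comb_def)
qed

text \<open>Composing the formula for H\<sigma> with \<sigma>^-1 gives H on one side and v^2
  H\<sigma>^-1 among the terms of the other, so that it can be solved for H\<sigma>^-1.\<close>

lemma H_pos: "dgm_H \<C> \<cdot> pos_crossing \<C>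
    = comb (\<alpha> * v) (\<alpha> * inverse v ^ 7) (- (inverse v ^ 4)) (inverse v ^ 2) 0 (\<alpha> * inverse v ^ 3) 0"
proof -
  have "dgm_H \<C> = (dgm_H \<C> \<cdot> neg_crossing \<C>) \<cdot> pos_crossing \<C>"
    using comp_assoc[OF crossing_in_hom(1) crossing_in_hom(2) dgm_H_in_hom] crossing_comp(2)
      comp_ident[OF dgm_H_in_hom] by (simp add: dgm_one_def)
  also have "\<dots> = - (\<alpha> * inverse v) \<odot> pos_crossing \<C> - (\<alpha> * v ^ 7 * inverse v ^ 12) \<odot> dgm_U \<C>
      + (v ^ 4 * inverse v ^ 6) \<odot> dgm_I \<C> + v ^ 2 \<odot> (dgm_H \<C> \<cdot> pos_crossing \<C>) - (\<alpha> * v ^ 3) \<odot> dgm_one \<C>"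
  proof -
    have "coev \<C> \<cdot> ev \<C> \<cdot> pos_crossing \<C> = inverse v ^ 12 \<odot> dgm_U \<C>"
      "fork \<C> \<cdot> merge \<C> \<cdot> pos_crossing \<C> = (- (inverse v ^ 6)) \<odot> dgm_I \<C>"
      unfolding ev_pos merge_pos dgm_U_def dgm_I_def
      by (rule comp_smul_right[OF ev_in_hom coev_in_hom] comp_smul_right[OF merge_in_hom fork_in_hom])+
    then show ?thesis
      unfolding H_neg comb_comp[OF crossing_in_hom(1)] by (simp add: crossing_comp(2))
  qed
  finally have eq: "v ^ 2 \<odot> (dgm_H \<C> \<cdot> pos_crossing \<C>) = dgm_H \<C> + (\<alpha> * inverse v) \<odot> pos_crossing \<C>
      + (\<alpha> * v ^ 7 * inverse v ^ 12) \<odot> dgm_U \<C> - (v ^ 4 * inverse v ^ 6) \<odot> dgm_I \<C> + (\<alpha> * v ^ 3) \<odot> dgm_one \<C>"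
    by (simp add: algebra_simps)
  have c: "inverse v ^ 2 * v ^ 2 = 1" "inverse v ^ 2 * (\<alpha> * inverse v) = \<alpha> * inverse v ^ 3"
    "inverse v ^ 2 * (\<alpha> * v ^ 7 * inverse v ^ 12) = \<alpha> * inverse v ^ 7"
    "inverse v ^ 2 * (v ^ 4 * inverse v ^ 6) = inverse v ^ 4" "inverse v ^ 2 * (\<alpha> * v ^ 3) = \<alpha> * v"
    using v_nonzero by (simp_all add: field_simps eval_nat_numeral)
  have "dgm_H \<C> \<cdot> pos_crossing \<C> = inverse v ^ 2 \<odot> v ^ 2 \<odot> (dgm_H \<C> \<cdot> pos_crossing \<C>)"
    by (simp only: scale_scale c scale_one)
  also have "\<dots> = inverse v ^ 2 \<odot> dgm_H \<C> + (\<alpha> * inverse v ^ 3) \<odot> pos_crossing \<C>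
      + (\<alpha> * inverse v ^ 7) \<odot> dgm_U \<C> - inverse v ^ 4 \<odot> dgm_I \<C> + (\<alpha> * v) \<odot> dgm_one \<C>"
    unfolding eq by (simp only: scale_right_distrib scale_right_diff_distrib scale_scale c)
  finally show ?thesis by (simp add: comb_def)
qed

text \<open>Only H itself produces the square; U and I are reproduced with the eigenvalues
  \<open>b\<close> and \<open>t\<close>, and the crossings are handled by the Jacobi
  relation.\<close>

lemma H_comb: "dgm_H \<C> \<cdot> comb a1 a2 a3 a4 a5 a6 0
    = comb (- (a5 * \<alpha> * inverse v) + a6 * \<alpha> * v)
        (a2 * b - a5 * \<alpha> * v ^ 7 + a6 * \<alpha> * inverse v ^ 7)
        (a3 * t - a5 * v ^ 4 - a6 * inverse v ^ 4)
        (a1 + a5 * v ^ 2 + a6 * inverse v ^ 2) (- (a5 * \<alpha> * v ^ 3)) (a6 * \<alpha> * inverse v ^ 3) a4"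
proof -
  have "(dgm_H \<C> \<cdot> coev \<C>) \<cdot> ev \<C> = b \<odot> dgm_U \<C>" "(dgm_H \<C> \<cdot> fork \<C>) \<cdot> merge \<C> = t \<odot> dgm_I \<C>"
    unfolding dgm_H_coev relations dgm_U_def dgm_I_def
    by (rule comp_smul_left[OF ev_in_hom coev_in_hom] comp_smul_left[OF merge_in_hom fork_in_hom])+
  then show ?thesis
    unfolding comp_comb[OF dgm_H_in_hom] H_neg H_pos
    by (simp add: comb_def dgm_S_def[symmetric] scale_right_distrib scale_left_distrib
        scale_right_diff_distrib scale_left_diff_distrib algebra_simps)
qed

lemma comb_neg: "comb a1 a2 a3 a4 0 0 0 \<cdot> neg_crossing \<C>
    = comb (- (a4 * \<alpha> * inverse v)) (a2 * v ^ 12 - a4 * \<alpha> * v ^ 7)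
        (- (a3 * v ^ 6) - a4 * v ^ 4) (a4 * v ^ 2) (a1 - a4 * \<alpha> * v ^ 3) 0 0"
proof -
  have "coev \<C> \<cdot> ev \<C> \<cdot> neg_crossing \<C> = v ^ 12 \<odot> dgm_U \<C>"
    "fork \<C> \<cdot> merge \<C> \<cdot> neg_crossing \<C> = (- (v ^ 6)) \<odot> dgm_I \<C>"
    unfolding ev_neg merge_neg dgm_U_def dgm_I_def
    by (rule comp_smul_right[OF ev_in_hom coev_in_hom] comp_smul_right[OF merge_in_hom fork_in_hom])+
  then show ?thesis
    unfolding comb_comp[OF crossing_in_hom(2)] H_neg
    by (simp add: comb_def scale_right_distrib scale_left_distrib
        scale_right_diff_distrib scale_left_diff_distrib algebra_simps)
qed

lemma comb_pos: "comb a1 a2 a3 a4 0 0 0 \<cdot> pos_crossing \<C>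
    = comb (a4 * \<alpha> * v) (a2 * inverse v ^ 12 + a4 * \<alpha> * inverse v ^ 7)
        (- (a3 * inverse v ^ 6) - a4 * inverse v ^ 4) (a4 * inverse v ^ 2)
        0 (a1 + a4 * \<alpha> * inverse v ^ 3) 0"
proof -
  have "coev \<C> \<cdot> ev \<C> \<cdot> pos_crossing \<C> = inverse v ^ 12 \<odot> dgm_U \<C>"
    "fork \<C> \<cdot> merge \<C> \<cdot> pos_crossing \<C> = (- (inverse v ^ 6)) \<odot> dgm_I \<C>"
    unfolding ev_pos merge_pos dgm_U_def dgm_I_def
    by (rule comp_smul_right[OF ev_in_hom coev_in_hom] comp_smul_right[OF merge_in_hom fork_in_hom])+
  then show ?thesis
    unfolding comb_comp[OF crossing_in_hom(1)] H_pos
    by (simp add: comb_def scale_right_distrib scale_left_distrib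
        scale_right_diff_distrib scale_left_diff_distrib algebra_simps)
qed

text \<open>Composing a relation with \<open>dgm_H\<close> and subtracting the quarter turn of the result cancels
  the square, which is invariant under the turn.\<close>

lemma comb_H_skew:
  assumes "comb a1 a2 a3 a4 a5 a6 0 = 0"
  defines "p \<equiv> - (a5 * \<alpha> * inverse v) + a6 * \<alpha> * v - (a2 * b - a5 * \<alpha> * v ^ 7 + a6 * \<alpha> * inverse v ^ 7)"
    and "q \<equiv> a3 * t - a5 * v ^ 4 - a6 * inverse v ^ 4 - (a1 + a5 * v ^ 2 + a6 * inverse v ^ 2)"
    and "r \<equiv> - (a5 * \<alpha> * v ^ 3) - a6 * \<alpha> * inverse v ^ 3"
  shows "comb p (- p) q (- q) r (- r) 0 = 0"
proof -
  have H: "comb (- (a5 * \<alpha> * inverse v) + a6 * \<alpha> * v)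
        (a2 * b - a5 * \<alpha> * v ^ 7 + a6 * \<alpha> * inverse v ^ 7)
        (a3 * t - a5 * v ^ 4 - a6 * inverse v ^ 4)
        (a1 + a5 * v ^ 2 + a6 * inverse v ^ 2) (- (a5 * \<alpha> * v ^ 3)) (a6 * \<alpha> * inverse v ^ 3) a4 = 0"
    using H_comb[of a1 a2 a3 a4 a5 a6] comp_zero[OF dgm_H_in_hom] by (simp add: assms(1))
  show ?thesis
    using comb_axpy[OF H comb_rotate[OF H], of "- 1"] unfolding p_def q_def r_def by (simp add: algebra_simps)
qed

section \<open>Relations forced by the dimension bound, and the scalars d and t\<close>

lemma exists_relation:
  assumes "\<exists>B. finite B \<and> box \<C> 4 \<subseteq> span B" "vector_space.dim (smul \<C>) (box \<C> 4) \<le> 5"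
  shows "\<exists>a1 a2 a3 a4 a5 a6. \<not> (a1 = 0 \<and> a2 = 0 \<and> a3 = 0 \<and> a4 = 0 \<and> a5 = 0 \<and> a6 = 0) \<and>
    comb a1 a2 a3 a4 a5 a6 0 = 0"
proof -
  let ?D = "[dgm_one \<C>, dgm_U \<C>, dgm_I \<C>, dgm_H \<C>, neg_crossing \<C>, pos_crossing \<C>]"
  obtain B where B: "finite B" "box \<C> 4 \<subseteq> span B" using assms(1) by blast
  have D: "?D ! i \<in> hom \<C> (strand \<C> \<boxtimes> strand \<C>) (strand \<C> \<boxtimes> strand \<C>)" if "i < 6" for i
    using nth_mem[of i ?D] that end_in_hom by auto
  \<comment> \<open>The bent diagrams are six vectors in a space of dimension at most five. Bending
    is linear and injective, so their dependence descends to the diagrams themselves.\<close>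
  obtain c where c: "\<exists>i<6. c i \<noteq> 0" "(\<Sum>i<6. c i \<odot> bend (?D ! i)) = 0"
  proof (rule vector_space.dependent_family[OF vector_space B])
    show "bend (?D ! i) \<in> box \<C> 4" if "i < 6" for i by (rule bend_in_box[OF D[OF that]])
    show "vector_space.dim (smul \<C>) (box \<C> 4) < 6" using assms(2) by simp
  qed
  let ?c = "comb (c 0) (c 1) (c 2) (c 3) (c 4) (c 5) 0"
  have "bend ?c = (\<Sum>i<6. c i \<odot> bend (?D ! i))"
    unfolding comb_def
    by (simp add: bend_add bend_smul end_in_hom add_in_hom smul_in_hom zero_in_hom eval_nat_numeral)
  then have "?c = 0" using c(2) bend_eq_0[OF comb_in_hom] by simp
  moreover have "\<not> (c 0 = 0 \<and> c 1 = 0 \<and> c 2 = 0 \<and> c 3 = 0 \<and> c 4 = 0 \<and> c 5 = 0)"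
    using c(1) by (auto simp: eval_nat_numeral less_Suc_eq)
  ultimately show ?thesis by blast
qed

text \<open>H\<sigma> is evaluated on \<open>coev\<close> and on \<open>fork\<close> in two ways: by
  the eigenvalues of its factors, and by the Jacobi relation. Powers of v are cleared at the
  end.\<close>

lemma scalar_relations:
  "b * (v ^ 5 - inverse v ^ 5) + \<alpha> * (d + v ^ 8 + inverse v ^ 8) = 0"
  "(v ^ 2 + inverse v ^ 2) * t = b - (v ^ 5 - inverse v ^ 5) * \<alpha>"
proof -
  let ?c = "comb (- (\<alpha> * inverse v)) (- (\<alpha> * v ^ 7)) (- (v ^ 4)) (v ^ 2) (- (\<alpha> * v ^ 3)) 0 0"
  have "?c \<cdot> coev \<C> = (v ^ 12 * b) \<odot> coev \<C>"
    using comp_assoc[OF coev_in_hom crossing_in_hom(2) dgm_H_in_hom]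
    by (simp add: H_neg relations dgm_H_coev comp_smul_right[OF coev_in_hom dgm_H_in_hom])
  then have "v ^ 12 * b = - (\<alpha> * inverse v) - \<alpha> * v ^ 7 * d + v ^ 2 * b - \<alpha> * v ^ 3 * v ^ 12"
    using vector_space.scale_cancel_right[OF vector_space] coev_nonzero comb_coev by fastforce
  moreover have "v ^ 7 * (b * (v ^ 5 - inverse v ^ 5) + \<alpha> * (d + v ^ 8 + inverse v ^ 8))
    = v ^ 12 * b - (- (\<alpha> * inverse v) - \<alpha> * v ^ 7 * d + v ^ 2 * b - \<alpha> * v ^ 3 * v ^ 12)"
    using v_nonzero by (simp add: field_simps eval_nat_numeral)
  ultimately show "b * (v ^ 5 - inverse v ^ 5) + \<alpha> * (d + v ^ 8 + inverse v ^ 8) = 0"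
    using v_nonzero by simp
  have "?c \<cdot> fork \<C> = (- (v ^ 6 * t)) \<odot> fork \<C>"
    using comp_assoc[OF fork_in_hom crossing_in_hom(2) dgm_H_in_hom]
    by (simp add: H_neg relations comp_smul_right[OF fork_in_hom dgm_H_in_hom, of "- (v ^ 6)", simplified])
  then have "- (v ^ 6 * t) = - (\<alpha> * inverse v) - v ^ 4 * b + v ^ 2 * t + \<alpha> * v ^ 3 * v ^ 6"
    using vector_space.scale_cancel_right[OF vector_space] fork_nonzero comb_fork by fastforce
  moreover have "v ^ 4 * ((v ^ 2 + inverse v ^ 2) * t - (b - (v ^ 5 - inverse v ^ 5) * \<alpha>))
    = - (\<alpha> * inverse v) - v ^ 4 * b + v ^ 2 * t + \<alpha> * v ^ 3 * v ^ 6 - (- (v ^ 6 * t))"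
    using v_nonzero by (simp add: field_simps eval_nat_numeral)
  ultimately show "(v ^ 2 + inverse v ^ 2) * t = b - (v ^ 5 - inverse v ^ 5) * \<alpha>"
    using v_nonzero by simp
qed

lemma v_inverse: "v * inverse v = 1"
  using v_nonzero by simp

text \<open>Subtracting the quarter turn leaves \<sigma> - \<sigma>^-1 with the coefficient
  \<open>a5 - a6\<close>, by which one divides.\<close>

lemma skew_if_unequal:
  assumes "comb a1 a2 a3 a4 a5 a6 0 = 0" "a5 \<noteq> a6"
  shows "\<exists>x y. comb (- x) x (- y) y 1 (- 1) 0 = 0"
proof -
  define r where "r = 1 / (a5 - a6)"
  have "r * (a5 + - 1 * a6) = 1" "r * (a6 + - 1 * a5) = - 1"
    using assms(2) by (simp_all add: r_def field_simps)
  moreover have "r * (a1 + - 1 * a2) = - (r * (a2 + - 1 * a1))" "r * (a3 + - 1 * a4) = - (r * (a4 + - 1 * a3))"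
    by (simp_all add: algebra_simps)
  ultimately show ?thesis
    using comb_scale[OF comb_axpy[OF assms(1) comb_rotate[OF assms(1)], of "- 1"], of r] by auto
qed

lemma exists_skew:
  assumes dim: "\<exists>B. finite B \<and> box \<C> 4 \<subseteq> span B" "vector_space.dim (smul \<C>) (box \<C> 4) \<le> 5"
    and "\<alpha> \<noteq> 0" "v ^ 12 \<noteq> 1"
  shows "\<exists>x y. comb (- x) x (- y) y 1 (- 1) 0 = 0"
proof -
  have s3: "v ^ 3 + inverse v ^ 3 \<noteq> 0"
  proof
    assume "v ^ 3 + inverse v ^ 3 = 0"
    with v_inverse have "v ^ 12 = 1" by algebra
    with assms(4) show False ..
  qed
  obtain a1 a2 a3 a4 a5 a6 where nz: "\<not> (a1 = 0 \<and> a2 = 0 \<and> a3 = 0 \<and> a4 = 0 \<and> a5 = 0 \<and> a6 = 0)"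
    and rel: "comb a1 a2 a3 a4 a5 a6 0 = 0"
    using exists_relation[OF dim] by blast
  consider "a5 \<noteq> a6" | "a5 = a6" "a6 \<noteq> 0" | "a5 = 0" "a6 = 0" by metis
  then show ?thesis
  proof cases
    case 1 then show ?thesis using skew_if_unequal[OF rel] by blast
  next
    case 2
    \<comment> \<open>Composition with H weights \<sigma> by -\<alpha> v^3 and \<sigma>^-1 by
      \<alpha> v^-3. Equal crossing coefficients therefore become unequal after the skew step, since
      \<alpha> {3} is nonzero.\<close>
    let ?r = "- (a5 * \<alpha> * v ^ 3) - a6 * \<alpha> * inverse v ^ 3"
    have "?r = - (a6 * \<alpha> * (v ^ 3 + inverse v ^ 3))" using 2(1) by (simp add: algebra_simps)
    then have "?r \<noteq> - ?r" using 2(2) s3 assms(3) by simp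
    then show ?thesis by (rule skew_if_unequal[OF comb_H_skew[OF rel]])
  next
    case 3
    \<comment> \<open>A relation without crossings, composed with a crossing, contains crossings of
      one sign only. Antisymmetrisation applies unless their coefficient is 0; if it is 0 for both
      signs, the difference c4 \<alpha> {3} vanishes and forces c4 = c1 = 0.\<close>
    have neg: "comb (- (c4 * \<alpha> * inverse v)) (c2 * v ^ 12 - c4 * \<alpha> * v ^ 7)
        (- (c3 * v ^ 6) - c4 * v ^ 4) (c4 * v ^ 2) (c1 - c4 * \<alpha> * v ^ 3) 0 0 = 0"
      and pos: "comb (c4 * \<alpha> * v) (c2 * inverse v ^ 12 + c4 * \<alpha> * inverse v ^ 7)
        (- (c3 * inverse v ^ 6) - c4 * inverse v ^ 4) (c4 * inverse v ^ 2)
        0 (c1 + c4 * \<alpha> * inverse v ^ 3) 0 = 0"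
      if "comb c1 c2 c3 c4 0 0 0 = 0" for c1 c2 c3 c4
      using comb_neg[of c1 c2 c3 c4] comb_pos[of c1 c2 c3 c4] zero_comp crossing_in_hom that by metis+
    have key: "c1 = 0 \<and> c4 = 0 \<or> (\<exists>x y. comb (- x) x (- y) y 1 (- 1) 0 = 0)"
      if c: "comb c1 c2 c3 c4 0 0 0 = 0" for c1 c2 c3 c4
    proof (cases "c1 - c4 * \<alpha> * v ^ 3 = 0 \<and> c1 + c4 * \<alpha> * inverse v ^ 3 = 0")
      case True
      then have "c4 * \<alpha> * (v ^ 3 + inverse v ^ 3) = 0" by algebra
      then show ?thesis using True s3 assms(3) by auto
    next
      case False
      then show ?thesis using skew_if_unequal[OF neg[OF c]] skew_if_unequal[OF pos[OF c]] by metis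
    qed
    \<comment> \<open>The relation itself controls \<open>a1\<close> and \<open>a4\<close>, its
      quarter turn \<open>a2\<close> and \<open>a3\<close>; not all four are zero.\<close>
    from rel have c: "comb a1 a2 a3 a4 0 0 0 = 0" by (simp add: 3)
    show ?thesis using key[OF c] key[OF comb_rotate[OF c]] nz 3 by blast
  qed
qed

text \<open>For \<alpha> = 0 the first scalar relation reads b [5] = 0.\<close>

lemma alpha_nonzero:
  assumes "v ^ 10 \<noteq> 1"
  shows "\<alpha> \<noteq> 0"
proof
  assume "\<alpha> = 0"
  then have "v ^ 5 - inverse v ^ 5 = 0" using scalar_relations(1) b_nonzero by simp
  with v_inverse have "v ^ 10 = 1" by algebra
  with assms show False ..
qed

text \<open>If v^4 = -1, the second scalar relation gives b = [5]\<alpha>, and the first one becomes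
  d + [5]^2 + {8} = 0. But then [5]^2 = -2 and {8} = 2, so the circle would vanish.\<close>

lemma v2_nonzero: "v ^ 2 + inverse v ^ 2 \<noteq> 0" if "\<alpha> \<noteq> 0"
proof
  assume z: "v ^ 2 + inverse v ^ 2 = 0"
  then have "b = (v ^ 5 - inverse v ^ 5) * \<alpha>" using scalar_relations(2) by simp
  with scalar_relations(1) have "\<alpha> * ((v ^ 5 - inverse v ^ 5) ^ 2 + d + v ^ 8 + inverse v ^ 8) = 0" by algebra
  then have "(v ^ 5 - inverse v ^ 5) ^ 2 + d + v ^ 8 + inverse v ^ 8 = 0" using that by simp
  with z v_inverse have "d = 0" by algebra
  with d_nonzero show False ..
qed

text \<open>Applying \<open>comb_H_skew\<close> to the given relation leaves \<open>P (\<one> - U) + Q (I - H) = 0\<close>. If \<open>P\<close> and \<open>Q\<close>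
  vanish, this determines \<open>x\<close> and \<open>y\<close>; otherwise \<open>b\<close>, \<open>d\<close> and \<open>t\<close> are functions of \<open>v\<close> and \<open>\<alpha>\<close>
  (for example for the vector representation of SO(3)).\<close>

lemma skew_solution:
  assumes skew: "comb (- x) x (- y) y 1 (- 1) 0 = 0" and \<alpha>: "\<alpha> \<noteq> 0" and v10: "v ^ 10 \<noteq> 1" and v12: "v ^ 12 \<noteq> 1"
  defines "K \<equiv> b + (v ^ 3 - inverse v ^ 3) * \<alpha>"
    and "c \<equiv> (v + inverse v) * (v ^ 2 + inverse v ^ 2)"
  shows "K \<noteq> 0 \<and> comb (- (\<alpha> * (v ^ 3 - inverse v ^ 3) * (v - inverse v) * c / K))
    (\<alpha> * (v ^ 3 - inverse v ^ 3) * (v - inverse v) * c / K)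
    ((v ^ 3 - inverse v ^ 3) * c / K) (- ((v ^ 3 - inverse v ^ 3) * c / K)) 1 (- 1) 0 = 0"
proof -
  define u where "u = inverse v"
  have uv: "v * u = 1" unfolding u_def by (rule v_inverse)
  note e1 = scalar_relations(1)[folded u_def] and e2 = scalar_relations(2)[folded u_def]
  have z2: "v ^ 2 + u ^ 2 \<noteq> 0" using v2_nonzero[OF \<alpha>] by (simp add: u_def)
  have b6: "v ^ 6 - u ^ 6 \<noteq> 0"
  proof
    assume "v ^ 6 - u ^ 6 = 0"
    with uv have "v ^ 12 = 1" by algebra
    with v12 show False ..
  qed
  have b3: "v ^ 3 - u ^ 3 \<noteq> 0" and b1: "v - u \<noteq> 0" and z1: "v + u \<noteq> 0" using b6 by algebra+
  have Kdef: "K = b + (v ^ 3 - u ^ 3) * \<alpha>" and cdef: "c = (v + u) * (v ^ 2 + u ^ 2)"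
    by (simp_all add: K_def c_def u_def)
  note s = comb_scalars[OF skew, folded u_def]
  \<comment> \<open>The skew step yields the crossing coefficient -\<alpha>[3]; adding \<alpha>[3]
    times the given relation removes both crossings. P and Q are what remains at \<one> - U and I -
    H.\<close>
  define P where "P = \<alpha> * (v ^ 7 + u ^ 7 - v - u) - x * b - \<alpha> * (v ^ 3 - u ^ 3) * x"
  define Q where "Q = x - y * t - (v ^ 4 - u ^ 4) - (v ^ 2 - u ^ 2) - \<alpha> * (v ^ 3 - u ^ 3) * y"
  have PQ: "comb P (- P) Q (- Q) 0 0 0 = 0"
    using comb_axpy[OF comb_H_skew[OF skew, folded u_def] skew, of "\<alpha> * (v ^ 3 - u ^ 3)"]
    unfolding P_def Q_def by (simp add: algebra_simps)
  note s' = comb_scalars[OF PQ]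
  show ?thesis
  proof (cases "Q = 0")
    case True
    then have P0: "P = 0" using s'(2) by simp
    have xK: "x * K = \<alpha> * (v ^ 3 - u ^ 3) * (v - u) * c"
      using P0 uv unfolding P_def Kdef cdef by algebra
    have K: "K \<noteq> 0" using xK \<alpha> b3 b1 z1 z2 by (auto simp: cdef)
    \<comment> \<open>Since {2}[3] = [5] + [1], the second factor equals {2}(t + [3]\<alpha>); up to
      sign and {2} it is the coefficient of y in Q.\<close>
    have "(y * K + (v ^ 3 - u ^ 3) * c) * (b + (v - u) * \<alpha>) = 0"
      using True xK e2 uv unfolding Q_def Kdef cdef by algebra
    \<comment> \<open>When y drops out of Q = 0, the eigenvalues on \<open>fork\<close> determine it
      instead, because t - b = -\<alpha>[1]{2} is nonzero there.\<close>
    moreover have "y * K + (v ^ 3 - u ^ 3) * c = 0" if "b + (v - u) * \<alpha> = 0"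
    proof -
      have "(v ^ 2 + u ^ 2) * (t + (v ^ 3 - u ^ 3) * \<alpha>) = 0" using e2 that uv by algebra
      then have "t + (v ^ 3 - u ^ 3) * \<alpha> = 0" using z2 by simp
      moreover have "\<alpha> * (v ^ 2 + u ^ 2) * (v - u) * (x - (v ^ 3 - u ^ 3) * (v + u)) = 0"
        using xK that uv unfolding Kdef cdef by algebra
      then have "x = (v ^ 3 - u ^ 3) * (v + u)" using \<alpha> z2 b1 by simp
      ultimately show ?thesis using s(2) that uv unfolding Kdef cdef by algebra
    qed
    ultimately have yK: "y * K + (v ^ 3 - u ^ 3) * c = 0" by auto
    have "x = \<alpha> * (v ^ 3 - u ^ 3) * (v - u) * c / K" "y = - ((v ^ 3 - u ^ 3) * c / K)"
      using xK yK K by (simp_all add: field_simps eq_neg_iff_add_eq_0)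
    then show ?thesis using skew K by (simp add: u_def)
  next
    case False
    \<comment> \<open>Now I - H = -a (\<one> - U), and I - H can be eliminated from the skew
      relation.\<close>
    define a where "a = P / Q"
    have P: "P = a * Q" using False by (simp add: a_def)
    have a: "a = t - b" using s'(2) False unfolding P by algebra
    have "Q * ((t - b) * (1 - d) - b) = 0" using s'(1) unfolding P a by algebra
    then have tb: "(t - b) * (1 - d) = b" using False by simp
    have rel1: "comb a (- a) 1 (- 1) 0 0 0 = 0"
      using comb_scale[OF PQ, of "1 / Q"] False by (simp add: P)
    have rel2: "comb (- (x - a * y)) (x - a * y) 0 0 1 (- 1) 0 = 0"
      using comb_axpy[OF skew rel1, of y] by (simp add: algebra_simps)
    \<comment> \<open>What is left makes \<sigma> - \<sigma>^-1 a multiple of \<one> - U. On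
      \<open>fork\<close> these two act by -[6] and 1, on \<open>coev\<close> by [12] and 1 - d; the
      comparison fixes the multiple and then d.\<close>
    have x': "x - a * y = - (v ^ 6 - u ^ 6)"
      using comb_scalars(2)[OF rel2, folded u_def] by algebra
    have "(v ^ 6 - u ^ 6) * (1 - d + v ^ 6 + u ^ 6) = 0"
      using comb_scalars(1)[OF rel2, folded u_def] x' by algebra
    then have d: "d = 1 + v ^ 6 + u ^ 6" using b6 by simp algebra
    \<comment> \<open>K = 0 would reduce the first scalar relation to \<alpha>({6} + {2} + 1) = 0.
      The two polynomial factors of the bracket vanish only if v^12 = 1 or v^10 = 1.\<close>
    have K: "K \<noteq> 0"
    proof
      assume "K = 0"
      then have "b = - (v ^ 3 - u ^ 3) * \<alpha>" unfolding Kdef by algebra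
      with e1 uv d have "\<alpha> * (v ^ 2 + u ^ 2 - 1) * (v ^ 4 + v ^ 2 + 1 + u ^ 2 + u ^ 4) = 0" by algebra
      then consider "v ^ 2 + u ^ 2 - 1 = 0" | "v ^ 4 + v ^ 2 + 1 + u ^ 2 + u ^ 4 = 0" using \<alpha> by auto
      then show False
      proof cases
        case 1
        with uv have "v ^ 12 = 1" by algebra
        with v12 show False ..
      next
        case 2
        with uv have "v ^ 10 = 1" by algebra
        with v10 show False ..
      qed
    qed
    \<comment> \<open>The relations fix only the combination x - a y, since multiples of
      \<open>rel1\<close> may be added. For the required coefficients X, Y it therefore suffices
      that X - a Y has the same value.\<close>
    define X where "X = \<alpha> * (v ^ 3 - u ^ 3) * (v - u) * c / K"
    define Y where "Y = - ((v ^ 3 - u ^ 3) * c / K)"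
    have p: "\<alpha> * (1 + v ^ 6 + u ^ 6 + v ^ 8 + u ^ 8) = - ((v ^ 5 - u ^ 5) * b)" using e1 d by algebra
    have p0: "1 + v ^ 6 + u ^ 6 + v ^ 8 + u ^ 8 \<noteq> 0"
    proof
      assume "1 + v ^ 6 + u ^ 6 + v ^ 8 + u ^ 8 = 0"
      with p have "v ^ 5 - u ^ 5 = 0" using b_nonzero by simp
      with uv have "v ^ 10 = 1" by algebra
      with v10 show False ..
    qed
    have "(t - b) * (1 - d) = - ((v ^ 6 + u ^ 6) * a)" by (simp add: a d algebra_simps)
    then have ab: "(v ^ 6 + u ^ 6) * a = - b" using tb by simp
    then have b6': "v ^ 6 + u ^ 6 \<noteq> 0" using b_nonzero by auto
    \<comment> \<open>With a eliminated by {6} a = -b, the equation X - a Y = -[6], multiplied by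
      {6} K, reads b E + \<alpha> F = 0. As \<alpha> D = -[5] b, it follows from D E = [5] F, an
      identity in v alone.\<close>
    define D where "D = 1 + v ^ 6 + u ^ 6 + v ^ 8 + u ^ 8"
    define E where "E = (v ^ 6 - u ^ 6) * (v ^ 6 + u ^ 6) - (v ^ 3 - u ^ 3) * c"
    define F where "F = (v ^ 6 + u ^ 6) * (v ^ 3 - u ^ 3) * ((v - u) * c + (v ^ 6 - u ^ 6))"
    have DE: "D * E = (v ^ 5 - u ^ 5) * F" using uv unfolding D_def E_def F_def cdef by algebra
    have "(v ^ 6 + u ^ 6) * (\<alpha> * (v ^ 3 - u ^ 3) * (v - u) * c + a * (v ^ 3 - u ^ 3) * c + (v ^ 6 - u ^ 6) * K)
        = b * E + \<alpha> * F"
      using ab unfolding Kdef E_def F_def by algebra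
    moreover have "D * (b * E + \<alpha> * F) = 0" using DE p[folded D_def] by algebra
    ultimately have "D * ((v ^ 6 + u ^ 6)
        * (\<alpha> * (v ^ 3 - u ^ 3) * (v - u) * c + a * (v ^ 3 - u ^ 3) * c + (v ^ 6 - u ^ 6) * K)) = 0" by simp
    then have "\<alpha> * (v ^ 3 - u ^ 3) * (v - u) * c + a * (v ^ 3 - u ^ 3) * c + (v ^ 6 - u ^ 6) * K = 0"
      using b6' p0[folded D_def] by simp
    moreover have "X * K = \<alpha> * (v ^ 3 - u ^ 3) * (v - u) * c" "Y * K = - ((v ^ 3 - u ^ 3) * c)"
      using K by (simp_all add: X_def Y_def)
    ultimately have "K * (X - a * Y - (x - a * y)) = 0" unfolding x' by algebra
    then have XY: "X - a * Y = x - a * y" using K by simp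
    have "comb (- (x - a * y) + - Y * a) (x - a * y + - Y * - a) (- Y) Y 1 (- 1) 0 = 0"
      using comb_axpy[OF rel2 rel1, of "- Y"] by simp
    moreover have "- (x - a * y) + - Y * a = - X" "x - a * y + - Y * - a = X"
      using XY by algebra+
    ultimately show ?thesis using K by (simp add: X_def Y_def u_def)
  qed
qed

text \<open>Composing the crossing relation with H produces S with the coefficient Y. Keeping the
  non-skew form and dividing by Y solves for S.\<close>

lemma square_relation:
  fixes K c X Y u :: complex
  defines "K \<equiv> b + (v ^ 3 - inverse v ^ 3) * \<alpha>" and "u \<equiv> inverse v"
    and "c \<equiv> (v + inverse v) * (v ^ 2 + inverse v ^ 2)"
  assumes skew: "comb (- X) X (- Y) Y 1 (- 1) 0 = 0" and K: "K \<noteq> 0" and Y: "Y \<noteq> 0"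
    and XK: "X * K = \<alpha> * (v ^ 3 - u ^ 3) * (v - u) * c" and YK: "Y * K = - ((v ^ 3 - u ^ 3) * c)"
  shows "comb (\<alpha> * coeff_y3 v \<alpha> b / (Psi1 v * Psi3 v * Psi4 v)) (\<alpha> * coeff_y4 v \<alpha> b / (Psi1 v * Psi3 v * Psi4 v))
    (coeff_y1 v \<alpha> b / (Psi3 v * Psi4 v)) (coeff_y2 v \<alpha> b / (Psi3 v * Psi4 v))
    (\<alpha> * Psi6 v * K / (Psi1 v * Psi3 v * Psi4 v)) 0 1 = 0"
proof -
  have uv: "v * u = 1" unfolding u_def by (rule v_inverse)
  note e2 = scalar_relations(2)[folded u_def] and c = c_def[folded u_def] and Kdef = K_def[folded u_def]
  have powi: "v powi (-1) = u" "v powi (-2) = u ^ 2" "v powi (-3) = u ^ 3" "v powi (-5) = u ^ 5"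
    "v powi (-7) = u ^ 7" "v powi (-9) = u ^ 9"
    by (simp_all add: u_def power_int_minus power_inverse)
  note Psi = Psi1_def Psi2_def Psi3_def Psi4_def Psi6_def powi
  note y = coeff_y1_def coeff_y2_def coeff_y3_def coeff_y4_def powi
  have P13: "Psi1 v * Psi3 v = v ^ 3 - u ^ 3"
    using uv unfolding Psi by algebra
  have P24: "Psi2 v * Psi4 v = c"
    unfolding Psi c by (rule refl)
  have nz: "Psi1 v \<noteq> 0" "Psi2 v \<noteq> 0" "Psi3 v \<noteq> 0" "Psi4 v \<noteq> 0"
    using YK Y K P13 P24 by auto
  have YP: "Y / (Psi3 v * Psi4 v) = - (Psi1 v * Psi2 v / K)"
    using YK K nz unfolding P13[symmetric] P24[symmetric] by (simp add: field_simps)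
  then have YP1: "Y / (Psi1 v * Psi3 v * Psi4 v) = - (Psi2 v / K)"
    using nz by (simp add: field_simps)
  \<comment> \<open>Because Y K = -Psi1 Psi2 Psi3 Psi4, every coefficient can be checked after
    multiplication by K, where only polynomial identities in v and its inverse remain.\<close>
  have scale: "1 / Y * e = g / D" if "e * K = - (g * r)" "Y / D = - (r / K)" for e g r D
  proof -
    have "e = - (g * r) / K" using that(1) nonzero_eq_divide_eq[OF K] by blast
    also have "\<dots> = g * (Y / D)" unfolding that(2) by simp
    finally show ?thesis using Y by simp
  qed
  have H: "comb (- (1 * \<alpha> * u) + - 1 * \<alpha> * v) (X * b - 1 * \<alpha> * v ^ 7 + - 1 * \<alpha> * u ^ 7)
     (- Y * t - 1 * v ^ 4 - - 1 * u ^ 4) (- X + 1 * v ^ 2 + - 1 * u ^ 2) (- (1 * \<alpha> * v ^ 3)) (- 1 * \<alpha> * u ^ 3) Y = 0"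
    using H_comb[of "- X" X "- Y" Y 1 "- 1", folded u_def] comp_zero[OF dgm_H_in_hom] by (simp add: skew)
  \<comment> \<open>The multiple -\<alpha> v^-3 of the crossing relation is the one that cancels the
    positive crossing.\<close>
  note rel = comb_scale[OF comb_axpy[OF H skew, of "- (\<alpha> * u ^ 3)"], of "1 / Y"]
  have "1 / Y * (- (1 * \<alpha> * u) + - 1 * \<alpha> * v + - (\<alpha> * u ^ 3) * - X)
    = \<alpha> * coeff_y3 v \<alpha> b / (Psi1 v * Psi3 v * Psi4 v)"
  proof -
    have "(- (1 * \<alpha> * u) + - 1 * \<alpha> * v + - (\<alpha> * u ^ 3) * - X) * K = - (\<alpha> * coeff_y3 v \<alpha> b * Psi2 v)"
      using XK uv unfolding y Psi Kdef c by algebra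
    then show ?thesis using YP1 by (rule scale)
  qed
  moreover have "1 / Y * (X * b - 1 * \<alpha> * v ^ 7 + - 1 * \<alpha> * u ^ 7 + - (\<alpha> * u ^ 3) * X)
    = \<alpha> * coeff_y4 v \<alpha> b / (Psi1 v * Psi3 v * Psi4 v)"
  proof -
    have "(X * b - 1 * \<alpha> * v ^ 7 + - 1 * \<alpha> * u ^ 7 + - (\<alpha> * u ^ 3) * X) * K = - (\<alpha> * coeff_y4 v \<alpha> b * Psi2 v)"
      using XK uv unfolding y Psi Kdef c by algebra
    then show ?thesis using YP1 by (rule scale)
  qed
  moreover have "1 / Y * (- Y * t - 1 * v ^ 4 - - 1 * u ^ 4 + - (\<alpha> * u ^ 3) * - Y)
    = coeff_y1 v \<alpha> b / (Psi3 v * Psi4 v)"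
  proof -
    have "(- Y * t - 1 * v ^ 4 - - 1 * u ^ 4 + - (\<alpha> * u ^ 3) * - Y) * K = - (coeff_y1 v \<alpha> b * (Psi1 v * Psi2 v))"
      using YK e2 uv unfolding y Psi Kdef c by algebra
    then show ?thesis using YP by (rule scale)
  qed
  moreover have "1 / Y * (- X + 1 * v ^ 2 + - 1 * u ^ 2 + - (\<alpha> * u ^ 3) * Y)
    = coeff_y2 v \<alpha> b / (Psi3 v * Psi4 v)"
  proof -
    have "(- X + 1 * v ^ 2 + - 1 * u ^ 2 + - (\<alpha> * u ^ 3) * Y) * K = - (coeff_y2 v \<alpha> b * (Psi1 v * Psi2 v))"
      using XK YK uv unfolding y Psi Kdef c by algebra
    then show ?thesis using YP by (rule scale)
  qed
  moreover have "1 / Y * (- (1 * \<alpha> * v ^ 3) + - (\<alpha> * u ^ 3) * 1)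
    = \<alpha> * Psi6 v * K / (Psi1 v * Psi3 v * Psi4 v)"
  proof -
    have "(- (1 * \<alpha> * v ^ 3) + - (\<alpha> * u ^ 3) * 1) * K = - (\<alpha> * Psi6 v * K * Psi2 v)"
      using uv unfolding Psi by algebra
    then show ?thesis using YP1 by (rule scale)
  qed
  moreover have "1 / Y * (- 1 * \<alpha> * u ^ 3 + - (\<alpha> * u ^ 3) * - 1) = 0" "1 / Y * (Y + - (\<alpha> * u ^ 3) * 0) = 1"
    using Y by simp_all
  ultimately show ?thesis using rel by simp
qed

end

section \<open>Coefficients of the square and crossing relations\<close>

theorem theorem2:
  fixes \<C> :: "('o, 'm::ab_group_add, complex, 'z) trivalent_structure_scheme" (structure)
    and v \<alpha> d b t :: complex
  assumes "trivalent_ribbon_category \<C>"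
    and "\<exists>B. finite B \<and> box \<C> 4 \<subseteq> module.span (smul \<C>) B"
    and "vector_space.dim (smul \<C>) (box \<C> 4) \<le> 5"
    and "QEJac \<C> v \<alpha> d b t"
    and "v ^ 10 \<noteq> 1"
    and "v ^ 12 \<noteq> 1"
  shows "\<alpha> \<noteq> 0 \<and> b + qbracket v 3 * \<alpha> \<noteq> 0 \<and> v ^ 8 \<noteq> 1 \<and>
    d = - (qbracket v 5 * b / \<alpha>) - qbrace v 8 \<and>
    t = (b - qbracket v 5 * \<alpha>) / qbrace v 2 \<and>
    dgm_S \<C>
      + (\<alpha> * Psi6 v * (b + qbracket v 3 * \<alpha>) / (Psi1 v * Psi3 v * Psi4 v)) \<odot> neg_crossing \<C>
      + (coeff_y1 v \<alpha> b / (Psi3 v * Psi4 v)) \<odot> dgm_I \<C>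
      + (coeff_y2 v \<alpha> b / (Psi3 v * Psi4 v)) \<odot> dgm_H \<C>
      + (\<alpha> * coeff_y4 v \<alpha> b / (Psi1 v * Psi3 v * Psi4 v)) \<odot> dgm_U \<C>
      + (\<alpha> * coeff_y3 v \<alpha> b / (Psi1 v * Psi3 v * Psi4 v)) \<odot> dgm_one \<C> = 0 \<and>
    neg_crossing \<C> - pos_crossing \<C>
      + (Psi1 v * Psi2 v * Psi3 v * Psi4 v / (b + qbracket v 3 * \<alpha>)) \<odot> (dgm_I \<C> - dgm_H \<C>)
      - ((Psi1 v)\<^sup>2 * Psi2 v * Psi3 v * Psi4 v * \<alpha> / (b + qbracket v 3 * \<alpha>))
          \<odot> (dgm_one \<C> - dgm_U \<C>) = 0"
proof -
  interpret trivalent_ribbon_category \<C> by fact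
  interpret exceptional_category \<C> v \<alpha> d b t by unfold_locales fact
  define u where "u = inverse v"
  define K where "K = b + (v ^ 3 - u ^ 3) * \<alpha>"
  define c where "c = (v + u) * (v ^ 2 + u ^ 2)"
  define X where "X = \<alpha> * (v ^ 3 - u ^ 3) * (v - u) * c / K"
  define Y where "Y = - ((v ^ 3 - u ^ 3) * c / K)"
  have uv: "v * u = 1" unfolding u_def by (rule v_inverse)
  have q: "qbracket v 3 = v ^ 3 - u ^ 3" "qbracket v 5 = v ^ 5 - u ^ 5"
    "qbrace v 8 = v ^ 8 + u ^ 8" "qbrace v 2 = v ^ 2 + u ^ 2"
    by (simp_all add: qbracket_def qbrace_def u_def power_int_minus power_inverse)
  have \<alpha>: "\<alpha> \<noteq> 0" by (rule alpha_nonzero) fact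
  have z2: "v ^ 2 + u ^ 2 \<noteq> 0" unfolding u_def by (rule v2_nonzero[OF \<alpha>])
  obtain x y where "comb (- x) x (- y) y 1 (- 1) 0 = 0"
    using exists_skew[OF assms(2,3) \<alpha> assms(6)] by blast
  from skew_solution[OF this \<alpha> assms(5,6), folded u_def, folded K_def c_def]
  have K: "K \<noteq> 0" and skew: "comb (- X) X (- Y) Y 1 (- 1) 0 = 0" by (simp_all add: X_def Y_def)
  \<comment> \<open>v^8 = 1 means v^4 = 1 or v^4 = -1; the first contradicts v^12 \<noteq> 1, the
    second contradicts {2} \<noteq> 0.\<close>
  have v8: "v ^ 8 \<noteq> 1"
  proof
    assume "v ^ 8 = 1"
    then have "(v ^ 4 - 1) * (v ^ 2 + u ^ 2) = 0" using uv by algebra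
    then have "v ^ 12 = 1" using z2 by algebra
    with assms(6) show False ..
  qed
  \<comment> \<open>These two factors make Y nonzero, which the division in the square relation
    requires.\<close>
  have "v ^ 3 - u ^ 3 \<noteq> 0" "c \<noteq> 0"
  proof -
    show "v ^ 3 - u ^ 3 \<noteq> 0"
    proof
      assume "v ^ 3 - u ^ 3 = 0"
      with uv have "v ^ 12 = 1" by algebra
      with assms(6) show False ..
    qed
    have "v + u \<noteq> 0"
    proof
      assume "v + u = 0"
      with uv have "v ^ 12 = 1" by algebra
      with assms(6) show False ..
    qed
    with z2 show "c \<noteq> 0" by (simp add: c_def)
  qed
  then have Y: "Y \<noteq> 0" using K by (simp add: Y_def)
  have d: "d = - (qbracket v 5 * b / \<alpha>) - qbrace v 8"
    using scalar_relations(1) \<alpha> unfolding q u_def[symmetric] by (simp add: field_simps)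
  have t: "t = (b - qbracket v 5 * \<alpha>) / qbrace v 2"
    using scalar_relations(2) z2 unfolding q u_def[symmetric] by (simp add: field_simps)
  have S: "comb (\<alpha> * coeff_y3 v \<alpha> b / (Psi1 v * Psi3 v * Psi4 v)) (\<alpha> * coeff_y4 v \<alpha> b / (Psi1 v * Psi3 v * Psi4 v))
    (coeff_y1 v \<alpha> b / (Psi3 v * Psi4 v)) (coeff_y2 v \<alpha> b / (Psi3 v * Psi4 v))
    (\<alpha> * Psi6 v * K / (Psi1 v * Psi3 v * Psi4 v)) 0 1 = 0"
    by (rule square_relation[OF skew, folded u_def, folded K_def c_def])
      (use K Y in \<open>simp_all add: X_def Y_def\<close>)
  \<comment> \<open>Here Psi1 Psi3 = [3] and Psi2 Psi4 = c, so X and -Y are the coefficients of the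
    crossing relation in factored form.\<close>
  have "Psi1 v * Psi2 v * Psi3 v * Psi4 v = (v ^ 3 - u ^ 3) * c"
    "(Psi1 v)\<^sup>2 * Psi2 v * Psi3 v * Psi4 v * \<alpha> = \<alpha> * (v ^ 3 - u ^ 3) * (v - u) * c"
  proof -
    have P: "Psi1 v = v - u" "Psi2 v = v + u" "Psi3 v = v ^ 2 + 1 + u ^ 2" "Psi4 v = v ^ 2 + u ^ 2"
      by (simp_all add: Psi1_def Psi2_def Psi3_def Psi4_def u_def power_int_minus power_inverse)
    show "Psi1 v * Psi2 v * Psi3 v * Psi4 v = (v ^ 3 - u ^ 3) * c"
      "(Psi1 v)\<^sup>2 * Psi2 v * Psi3 v * Psi4 v * \<alpha> = \<alpha> * (v ^ 3 - u ^ 3) * (v - u) * c"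
      using uv unfolding P c_def by algebra+
  qed
  then have XY: "Psi1 v * Psi2 v * Psi3 v * Psi4 v / K = - Y"
    "(Psi1 v)\<^sup>2 * Psi2 v * Psi3 v * Psi4 v * \<alpha> / K = X" by (simp_all add: X_def Y_def)
  have "b + qbracket v 3 * \<alpha> = K" by (simp add: q K_def)
  then show ?thesis
    using \<alpha> K v8 d t S skew XY by (simp add: comb_def algebra_simps)
qed

end
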